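(* Let $n$ be a positive integer and let $h=(h(1),n,\ldots,n)$ be a Hessenberg function, i.e. $1\le h(1)\le n$ and $h(j)=n$ for $2\le j\le n$. Let $X(h)$ be the associated regular semisimple Hessenberg variety, with Tymoczko's action of $\mathfrak{S}_n$ on $H^*(X(h);\mathbb{C})$, and let $R(X(h),q):=\sum_{i=0}^{m} H^{2i}(X(h);\mathbb{C})\, q^i \in R(\mathfrak{S}_n)[q]$, where $m=\dim_{\mathbb{C}}X(h)$ and $R(\mathfrak{S}_n)$ is the representation ring of $\mathfrak{S}_n$. Then $$R(X(h),q)=\big(\mathrm{Ind}_{\mathfrak{S}_n}^{\mathfrak{S}_n} 1\big)\frac{1-q^{h(1)-1}}{1-q}\,\frac{1-q^{n}}{1-q}\prod_{j=1}^{n-2} \frac{1-q^j}{1-q} +\big(\mathrm{Ind}_{\mathfrak{S}_{n-1}\times \mathfrak{S}_1}^{\mathfrak{S}_n} 1\big)\,q^{h(1)-1}\,\frac{1-q^{n-h(1)}}{1-q}\prod_{j=1}^{n-2}\frac{1-q^j}{1-q},$$ where each $1$ in $\mathrm{Ind}\,1$ denotes the trivial representation. In particular, for $h=(h(1),n,\ldots,n)$ and every $k$, the $\mathfrak{S}_n$-representation $H^{2k}(X(h);\mathbb{C})$ is a permutation representation, i.e. a direct sum of induced representations $\mathrm{Ind}_{\mathfrak{S}_\lambda}^{\mathfrak{S}_n}1$ of the trivial representation, where $\mathfrak{S}_{\lambda}=\mathfrak{S}_{\lambda_1}\times\dots\times\mathfrak{S}_{\lambda_\ell}$ for partitions $\lambda=(\lambda_1,\ldots,\lambda_\ell)$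 of $n$.
   Context: Write $[n]=\{1,\dots,n\}$. A Hessenberg function is a nondecreasing function $h:[n]\to[n]$ with $h(i)\ge i$ for all $i\in[n]$; it is written as $h=(h(1),\dots,h(n))$. The flag variety $Flag(\mathbb{C}^n)$ consists of sequences $V_\bullet=(V_1\subset\cdots\subset V_n=\mathbb{C}^n)$ of linear subspaces with $\dim_{\mathbb{C}} V_i=i$. Fix a diagonal matrix $S$ with distinct eigenvalues. The regular semisimple Hessenberg variety is $X(h)=\{V_\bullet\in Flag(\mathbb{C}^n)\mid SV_i\subset V_{h(i)}\text{ for all } i\in[n]\}$. Its odd-degree cohomology vanishes. The torus $T\subset GL(n,\mathbb{C})$ of invertible diagonal matrices acts on $X(h)$, with fixed points identified with the symmetric group $\mathfrak{S}_n$ by sending $w$ to the flag with $V_i=\mathrm{span}\{e_{w(1)},\dots,e_{w(i)}\}$, where $e_1,\dots,e_n$ is the standard basis of $\mathbb{C}^n$. Identify $H^*(BT;\mathbb{C})=\mathbb{C}[t_1,\dots,t_n]$, where $t_i$ is the first Chern class of the line bundle over $BT$ corresponding to the projection $\mathrm{diag}(g_1,\dots,g_n)\mapsto g_i$ ($\deg t_i=2$). It is known that the restriction map to fixed points $H^*_T(X(h);\mathbb{C})\to\bigoplus_{w\in\mathfrak{S}_n}\mathbb{C}[t_1,\dots,t_n]$ is injective with image the set of $\alpha=(\alpha(w))_w$ such that $\alpha(w)-\alpha(w')$ is divisible by $t_{w(i)}-t_{w(j)}$ whenever $w'=w(j\ i)$ for some $1\le j<i\le n$ with $i\le h(j)$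 (here $(j\ i)$ is the transposition). It is also known that $H^*(X(h);\mathbb{C})\cong H^*_T(X(h);\mathbb{C})/(t_1,\dots,t_n)$, where $t_i$ denotes the element whose every $w$-component is $t_i$. Tymoczko's action: for $v\in\mathfrak{S}_n$ and $\alpha=(\alpha(w))_w$, set $(v\cdot\alpha)(w)=v\cdot\alpha(v^{-1}w)$, where on the right $v\cdot f(t_1,\dots,t_n)=f(t_{v(1)},\dots,t_{v(n)})$. This preserves the image above, hence defines an action on $H^*_T(X(h);\mathbb{C})$, and it descends to $H^*(X(h);\mathbb{C})$ because $v\cdot t_i=t_{v(i)}$.
   Formalization: The displayed formula for R(X(h),q) is stated only for n ≥ 2, because for n = 1 its right-hand side is 0 (or undefined) while X(h) is a point; the permutation-representation claim is proved for all n ≥ 1. *)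

theory Defs
  imports
    "HOL-Homology.Homology"
    "HOL-Combinatorics.Permutations"
    "HOL-Computational_Algebra.Polynomial"
    "HOL-Library.Function_Algebras"
    "HOL-Library.Poly_Mapping"
    "HOL-Algebra.Free_Abelian_Groups"
    "HOL-Algebra.Coset"
    "HOL-Algebra.Generated_Groups"
    "Jordan_Normal_Form.Matrix"
begin

section \<open>Complex representations of the symmetric group\<close>

definition Sn :: "nat \<Rightarrow> (nat \<Rightarrow> nat) set" where
  "Sn n = {w. w permutes {1..n}}"

text \<open>A complex vector space with a (left) action of permutations. The fields \<open>monoid.mult\<close> and \<open>one\<close>
  of the module record play no role.\<close>
type_synonym 'a rep = "(complex, 'a) module \<times> ((nat \<Rightarrow> nat) \<Rightarrow> 'a \<Rightarrow> 'a)"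

definition complex_field :: "complex ring" where
  "complex_field =
     \<lparr>carrier = UNIV, monoid.mult = (*), one = 1, zero = 0, add = (+)\<rparr>"

definition is_rep :: "nat \<Rightarrow> 'a rep \<Rightarrow> bool" where
  "is_rep n R \<longleftrightarrow> (case R of (V, a) \<Rightarrow>
     Module.module complex_field V \<and>
     (\<forall>g\<in>Sn n. \<forall>x\<in>carrier V. a g x \<in> carrier V) \<and>
     (\<forall>g\<in>Sn n. \<forall>x\<in>carrier V. \<forall>y\<in>carrier V. a g (x \<oplus>\<^bsub>V\<^esub> y) = a g x \<oplus>\<^bsub>V\<^esub> a g y) \<and>
     (\<forall>g\<in>Sn n. \<forall>c. \<forall>x\<in>carrier V. a g (c \<odot>\<^bsub>V\<^esub> x) = c \<odot>\<^bsub>V\<^esub> a g x) \<and>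
     (\<forall>x\<in>carrier V. a id x = x) \<and>
     (\<forall>g\<in>Sn n. \<forall>h\<in>Sn n. \<forall>x\<in>carrier V. a (g \<circ> h) x = a g (a h x)))"

definition rep_iso :: "nat \<Rightarrow> 'a rep \<Rightarrow> 'b rep \<Rightarrow> bool" where
  "rep_iso n R R' \<longleftrightarrow> is_rep n R \<and> is_rep n R' \<and> (case (R, R') of ((V, a), (W, b)) \<Rightarrow>
     \<exists>\<phi>. bij_betw \<phi> (carrier V) (carrier W) \<and>
       (\<forall>x\<in>carrier V. \<forall>y\<in>carrier V. \<phi> (x \<oplus>\<^bsub>V\<^esub> y) = \<phi> x \<oplus>\<^bsub>W\<^esub> \<phi> y) \<and>
       (\<forall>c. \<forall>x\<in>carrier V. \<phi> (c \<odot>\<^bsub>V\<^esub> x) = c \<odot>\<^bsub>W\<^esub> \<phi> x) \<and>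
       (\<forall>g\<in>Sn n. \<forall>x\<in>carrier V. \<phi> (a g x) = b g (\<phi> x)))"

definition trivial_rep :: "complex rep" where
  "trivial_rep =
     (\<lparr>carrier = UNIV, monoid.mult = undefined, one = undefined, zero = 0, add = (+), module.smult = (*)\<rparr>,
      \<lambda>g x. x)"

definition induced_rep :: "nat \<Rightarrow> (nat \<Rightarrow> nat) set \<Rightarrow> 'a rep \<Rightarrow> ((nat \<Rightarrow> nat) \<Rightarrow> 'a) rep" where
  "induced_rep n H R = (case R of (V, \<sigma>) \<Rightarrow>
     (\<lparr>carrier = {f \<in> Sn n \<rightarrow>\<^sub>E carrier V.
                    \<forall>g\<in>Sn n. \<forall>h\<in>H. f (g \<circ> h) = \<sigma> (Hilbert_Choice.inv h) (f g)},
       monoid.mult = undefined, one = undefined,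
       zero = (\<lambda>g\<in>Sn n. \<zero>\<^bsub>V\<^esub>),
       add = (\<lambda>f f'. \<lambda>g\<in>Sn n. f g \<oplus>\<^bsub>V\<^esub> f' g),
       module.smult = (\<lambda>c f. \<lambda>g\<in>Sn n. c \<odot>\<^bsub>V\<^esub> f g)\<rparr>,
      \<lambda>g f. \<lambda>x\<in>Sn n. f (Hilbert_Choice.inv g \<circ> x)))"

definition direct_sum :: "'a rep list \<Rightarrow> (nat \<Rightarrow> 'a) rep" where
  "direct_sum Rs =
     (\<lparr>carrier = (\<Pi>\<^sub>E i\<in>{..<length Rs}. carrier (fst (Rs ! i))),
       monoid.mult = undefined, one = undefined,
       zero = (\<lambda>i\<in>{..<length Rs}. \<zero>\<^bsub>fst (Rs ! i)\<^esub>),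
       add = (\<lambda>f f'. \<lambda>i\<in>{..<length Rs}. f i \<oplus>\<^bsub>fst (Rs ! i)\<^esub> f' i),
       module.smult = (\<lambda>c f. \<lambda>i\<in>{..<length Rs}. c \<odot>\<^bsub>fst (Rs ! i)\<^esub> f i)\<rparr>,
      \<lambda>g f. \<lambda>i\<in>{..<length Rs}. snd (Rs ! i) g (f i))"

definition is_partition :: "nat \<Rightarrow> nat list \<Rightarrow> bool" where
  "is_partition n \<mu> \<longleftrightarrow> sorted_wrt (\<ge>) \<mu> \<and> (\<forall>l\<in>set \<mu>. 0 < l) \<and> sum_list \<mu> = n"

text \<open>The subgroup of permutations that preserve each of the consecutive blocks of sizes
  \<open>\<mu>\<^sub>1, \<mu>\<^sub>2, \<dots>\<close>.\<close>
definition young_subgroup :: "nat \<Rightarrow> nat list \<Rightarrow> (nat \<Rightarrow> nat) set" where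
  "young_subgroup n \<mu> = {w \<in> Sn n. \<forall>i<length \<mu>.
     w ` {sum_list (take i \<mu>) <.. sum_list (take (Suc i) \<mu>)} =
       {sum_list (take i \<mu>) <.. sum_list (take (Suc i) \<mu>)}}"

definition Ind_trivial :: "nat \<Rightarrow> nat list \<Rightarrow> ((nat \<Rightarrow> nat) \<Rightarrow> complex) rep" where
  "Ind_trivial n \<mu> = induced_rep n (young_subgroup n \<mu>) trivial_rep"

definition is_permutation_rep :: "nat \<Rightarrow> 'a rep \<Rightarrow> bool" where
  "is_permutation_rep n R \<longleftrightarrow>
     (\<exists>L. (\<forall>\<mu>\<in>set L. is_partition n \<mu>) \<and> rep_iso n R (direct_sum (map (Ind_trivial n) L)))"


section \<open>The representation ring\<close>

text \<open>The additive group of \<open>R(\<SS>\<^sub>n)\<close> is the free abelian group on the matrix representations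
  modulo \<open>[\<rho>] - [\<sigma>]\<close> for equivalent \<open>\<rho>, \<sigma>\<close> and \<open>[\<rho> \<oplus> \<sigma>] - [\<rho>] - [\<sigma>]\<close>. Since group records are
  multiplicative, sums in \<open>R(\<SS>\<^sub>n)\<close> are written with \<open>\<otimes>\<close> and integer multiples with \<open>[^]\<close>. The
  tensor product is not needed: in \<open>R(\<SS>\<^sub>n)[q]\<close> we only add, and multiply by elements of
  \<open>\<int>[q]\<close>.\<close>

type_synonym mat_rep = "nat \<times> ((nat \<Rightarrow> nat) \<Rightarrow> complex mat)"

definition is_mat_rep :: "nat \<Rightarrow> mat_rep \<Rightarrow> bool" where
  "is_mat_rep n \<rho> \<longleftrightarrow> (\<forall>g\<in>Sn n. snd \<rho> g \<in> carrier_mat (fst \<rho>) (fst \<rho>)) \<and>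
     snd \<rho> id = 1\<^sub>m (fst \<rho>) \<and>
     (\<forall>g\<in>Sn n. \<forall>h\<in>Sn n. snd \<rho> (g \<circ> h) = snd \<rho> g * snd \<rho> h)"

definition mat_rep_equiv :: "nat \<Rightarrow> mat_rep \<Rightarrow> mat_rep \<Rightarrow> bool" where
  "mat_rep_equiv n \<rho> \<sigma> \<longleftrightarrow> fst \<rho> = fst \<sigma> \<and>
     (\<exists>P\<in>carrier_mat (fst \<rho>) (fst \<rho>). invertible_mat P \<and>
        (\<forall>g\<in>Sn n. P * snd \<rho> g = snd \<sigma> g * P))"

definition mat_rep_sum :: "mat_rep \<Rightarrow> mat_rep \<Rightarrow> mat_rep" where
  "mat_rep_sum \<rho> \<sigma> = (fst \<rho> + fst \<sigma>, \<lambda>g.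
     four_block_mat (snd \<rho> g) (0\<^sub>m (fst \<rho>) (fst \<sigma>)) (0\<^sub>m (fst \<sigma>) (fst \<rho>)) (snd \<sigma> g))"

definition free_reps :: "nat \<Rightarrow> (mat_rep \<Rightarrow>\<^sub>0 int) monoid" where
  "free_reps n = free_Abelian_group {\<rho>. is_mat_rep n \<rho>}"

definition rep_relations :: "nat \<Rightarrow> (mat_rep \<Rightarrow>\<^sub>0 int) set" where
  "rep_relations n = generate (free_reps n)
     ({frag_of \<rho> - frag_of \<sigma> | \<rho> \<sigma>. is_mat_rep n \<rho> \<and> is_mat_rep n \<sigma> \<and> mat_rep_equiv n \<rho> \<sigma>} \<union>
      {frag_of (mat_rep_sum \<rho> \<sigma>) - frag_of \<rho> - frag_of \<sigma> | \<rho> \<sigma>. is_mat_rep n \<rho> \<and> is_mat_rep n \<sigma>})"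

definition rep_ring :: "nat \<Rightarrow> (mat_rep \<Rightarrow>\<^sub>0 int) set monoid" where
  "rep_ring n = free_reps n Mod rep_relations n"

definition mat_form :: "nat \<Rightarrow> 'a rep \<Rightarrow> mat_rep" where
  "mat_form n R = (SOME \<rho>. is_mat_rep n \<rho> \<and>
     rep_iso n (module_vec TYPE(complex) (fst \<rho>), \<lambda>g x. snd \<rho> g *\<^sub>v x) R)"

text \<open>The class of a finite-dimensional representation; it does not depend on the chosen matrix
  form.\<close>
definition rep_class :: "nat \<Rightarrow> 'a rep \<Rightarrow> (mat_rep \<Rightarrow>\<^sub>0 int) set" where
  "rep_class n R = rep_relations n #>\<^bsub>free_reps n\<^esub> frag_of (mat_form n R)"

text \<open>Elements of \<open>R(\<SS>\<^sub>n)[q]\<close> are given by their sequences of coefficients.\<close>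
type_synonym rep_poly = "nat \<Rightarrow> (mat_rep \<Rightarrow>\<^sub>0 int) set"

definition rep_poly_add :: "nat \<Rightarrow> rep_poly \<Rightarrow> rep_poly \<Rightarrow> rep_poly" where
  "rep_poly_add n A B = (\<lambda>i. A i \<otimes>\<^bsub>rep_ring n\<^esub> B i)"

definition rep_times_poly :: "nat \<Rightarrow> (mat_rep \<Rightarrow>\<^sub>0 int) set \<Rightarrow> int poly \<Rightarrow> rep_poly" where
  "rep_times_poly n a P = (\<lambda>i. a [^]\<^bsub>rep_ring n\<^esub> (coeff P i :: int))"

abbreviation qvar :: "int poly" where "qvar \<equiv> [:0, 1:]"

text \<open>\<open>(1 - q\<^sup>j)/(1 - q)\<close>; the division in \<open>\<int>[q]\<close> is exact.\<close>
definition q_number :: "nat \<Rightarrow> int poly" where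
  "q_number j = (1 - qvar ^ j) div (1 - qvar)"


section \<open>Singular cohomology with complex coefficients\<close>

type_synonym 'a cochain = "((nat \<Rightarrow> real) \<Rightarrow> 'a) \<Rightarrow> complex"

definition cochains :: "nat \<Rightarrow> 'a topology \<Rightarrow> 'a cochain set" where
  "cochains p X = {\<phi>. \<forall>\<sigma>. \<not> singular_simplex p X \<sigma> \<longrightarrow> \<phi> \<sigma> = 0}"

text \<open>\<open>coboundary p X\<close> maps \<open>p\<close>-cochains to \<open>(p+1)\<close>-cochains.\<close>
definition coboundary :: "nat \<Rightarrow> 'a topology \<Rightarrow> 'a cochain \<Rightarrow> 'a cochain" where
  "coboundary p X \<phi> = (\<lambda>\<sigma>. if singular_simplex (Suc p) X \<sigma>
     then \<Sum>k\<le>Suc p. (-1) ^ k * \<phi> (singular_face (Suc p) k \<sigma>) else 0)"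

definition cocycles :: "nat \<Rightarrow> 'a topology \<Rightarrow> 'a cochain set" where
  "cocycles p X = {\<phi> \<in> cochains p X. coboundary p X \<phi> = 0}"

definition coboundaries :: "nat \<Rightarrow> 'a topology \<Rightarrow> 'a cochain set" where
  "coboundaries p X = (case p of 0 \<Rightarrow> {0} | Suc r \<Rightarrow> coboundary r X ` cochains r X)"

definition coh_class :: "nat \<Rightarrow> 'a topology \<Rightarrow> 'a cochain \<Rightarrow> 'a cochain set" where
  "coh_class p X \<phi> = {\<phi> + \<beta> | \<beta>. \<beta> \<in> coboundaries p X}"

definition cscale :: "complex \<Rightarrow> ('b \<Rightarrow> complex) \<Rightarrow> ('b \<Rightarrow> complex)" where
  "cscale c x = (\<lambda>i. c * x i)"

text \<open>In the scalar multiplication the coboundaries have to be added again to obtain a full coset for \<open>c = 0\<close>.\<close>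
definition cohomology :: "nat \<Rightarrow> 'a topology \<Rightarrow> (complex, 'a cochain set) module" where
  "cohomology p X =
     \<lparr>carrier = coh_class p X ` cocycles p X,
      monoid.mult = undefined, one = undefined,
      zero = coboundaries p X,
      add = (\<lambda>A B. {a + b | a b. a \<in> A \<and> b \<in> B}),
      module.smult = (\<lambda>c A. {cscale c a + \<beta> | a \<beta>. a \<in> A \<and> \<beta> \<in> coboundaries p X})\<rparr>"

definition cochain_pullback ::
    "nat \<Rightarrow> 'a topology \<Rightarrow> ('a \<Rightarrow> 'b) \<Rightarrow> 'b cochain \<Rightarrow> 'a cochain" where
  "cochain_pullback p X f \<phi> = (\<lambda>\<sigma>. if singular_simplex p X \<sigma> then \<phi> (simplex_map p f \<sigma>) else 0)"

text \<open>The map induced on \<open>H\<^sup>p\<close> by a continuous map \<open>f\<close> from \<open>X\<close> to another space.\<close>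
definition coh_pullback ::
    "nat \<Rightarrow> 'a topology \<Rightarrow> ('a \<Rightarrow> 'b) \<Rightarrow> 'b cochain set \<Rightarrow> 'a cochain set" where
  "coh_pullback p X f A =
     {cochain_pullback p X f \<phi> + \<beta> | \<phi> \<beta>. \<phi> \<in> A \<and> \<beta> \<in> coboundaries p X}"

definition unit_cochain :: "'a topology \<Rightarrow> 'a cochain" where
  "unit_cochain X = (\<lambda>\<sigma>. if singular_simplex 0 X \<sigma> then 1 else 0)"

text \<open>The front \<open>p\<close>-face of a \<open>(p+r)\<close>-simplex is literally a restriction, because the standard
  \<open>p\<close>-simplex is the subset of the standard \<open>(p+r)\<close>-simplex where the last \<open>r\<close> coordinates vanish.\<close>
definition cup :: "'a topology \<Rightarrow> nat \<Rightarrow> nat \<Rightarrow> 'a cochain \<Rightarrow> 'a cochain \<Rightarrow> 'a cochain" where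
  "cup X p r \<phi> \<psi> = (\<lambda>\<sigma>. if singular_simplex (p + r) X \<sigma>
     then \<phi> (restrict \<sigma> (standard_simplex p)) *
          \<psi> (\<lambda>x\<in>standard_simplex r. \<sigma> (\<lambda>i. if i < p then 0 else x (i - p)))
     else 0)"


section \<open>Flags and regular semisimple Hessenberg varieties\<close>

definition hessenberg :: "nat \<Rightarrow> (nat \<Rightarrow> nat) \<Rightarrow> bool" where
  "hessenberg n h \<longleftrightarrow> (\<forall>i\<in>{1..n}. i \<le> h i \<and> h i \<le> n) \<and> mono_on {1..n} h"

text \<open>\<open>\<complex>\<^sup>n\<close> is realised as the functions \<open>nat \<Rightarrow> complex\<close> that vanish outside \<open>{1..n}\<close>.\<close>
definition Cn :: "nat \<Rightarrow> (nat \<Rightarrow> complex) set" where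
  "Cn n = {x. \<forall>i. i \<notin> {1..n} \<longrightarrow> x i = 0}"

global_interpretation cvec: vector_space "cscale :: complex \<Rightarrow> (nat \<Rightarrow> complex) \<Rightarrow> nat \<Rightarrow> complex"
  by unfold_locales (auto simp: cscale_def fun_eq_iff algebra_simps)

definition basis_vec :: "nat \<Rightarrow> nat \<Rightarrow> complex" where
  "basis_vec i = (\<lambda>j. if j = i then 1 else 0)"

type_synonym flag = "nat \<Rightarrow> (nat \<Rightarrow> complex) set"

definition Flag :: "nat \<Rightarrow> flag set" where
  "Flag n = {V \<in> extensional {1..n}.
     (\<forall>i\<in>{1..n}. cvec.subspace (V i) \<and> V i \<subseteq> Cn n \<and> cvec.dim (V i) = i) \<and>
     (\<forall>i\<in>{1..n}. \<forall>j\<in>{i..n}. V i \<subseteq> V j) \<and> V n = Cn n}"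

definition flag_of :: "nat \<Rightarrow> (nat \<Rightarrow> nat \<Rightarrow> complex) \<Rightarrow> flag" where
  "flag_of n b = (\<lambda>i\<in>{1..n}. cvec.span (b ` {1..i}))"

text \<open>The bases \<open>(b\<^sub>1, \<dots>, b\<^sub>n)\<close> of \<open>\<complex>\<^sup>n\<close>, i.e. the columns of the elements of \<open>GL(n,\<complex>)\<close>.\<close>
definition frames :: "nat \<Rightarrow> (nat \<Rightarrow> nat \<Rightarrow> complex) set" where
  "frames n = {b. (\<forall>j\<in>{1..n}. b j \<in> Cn n) \<and> (\<forall>j. j \<notin> {1..n} \<longrightarrow> b j = 0) \<and>
                  cvec.independent (b ` {1..n}) \<and> inj_on b {1..n}}"

definition quotient_topology :: "'a topology \<Rightarrow> ('a \<Rightarrow> 'b) \<Rightarrow> 'b topology" where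
  "quotient_topology X f =
     topology (\<lambda>U. U \<subseteq> f ` topspace X \<and> openin X {x \<in> topspace X. f x \<in> U})"

lemma openin_quotient_topology:
  "openin (quotient_topology X f) U \<longleftrightarrow>
     U \<subseteq> f ` topspace X \<and> openin X {x \<in> topspace X. f x \<in> U}"
proof -
  have "istopology (\<lambda>U. U \<subseteq> f ` topspace X \<and> openin X {x \<in> topspace X. f x \<in> U})"
    unfolding istopology_def
  proof (intro conjI allI impI)
    fix S T
    assume "S \<subseteq> f ` topspace X \<and> openin X {x \<in> topspace X. f x \<in> S}"
      and "T \<subseteq> f ` topspace X \<and> openin X {x \<in> topspace X. f x \<in> T}"
    moreover have "{x \<in> topspace X. f x \<in> S \<inter> T} =
        {x \<in> topspace X. f x \<in> S} \<inter> {x \<in> topspace X. f x \<in> T}"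
      by blast
    ultimately show "S \<inter> T \<subseteq> f ` topspace X" "openin X {x \<in> topspace X. f x \<in> S \<inter> T}"
      by auto
  next
    fix K
    assume K: "\<forall>S\<in>K. S \<subseteq> f ` topspace X \<and> openin X {x \<in> topspace X. f x \<in> S}"
    have "{x \<in> topspace X. f x \<in> \<Union>K} = (\<Union>S\<in>K. {x \<in> topspace X. f x \<in> S})"
      by blast
    with K show "\<Union>K \<subseteq> f ` topspace X" "openin X {x \<in> topspace X. f x \<in> \<Union>K}"
      by auto
  qed
  then show ?thesis
    by (simp add: quotient_topology_def topology_inverse')
qed

text \<open>The flag variety carries its (analytic) topology as the homogeneous space \<open>GL(n,\<complex>)/B\<close>.\<close>
definition flag_topology :: "nat \<Rightarrow> flag topology" where
  "flag_topology n = quotient_topology (top_of_set (frames n)) (flag_of n)"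

text \<open>\<open>X(h)\<close> for the diagonal matrix \<open>S = diag(s\<^sub>1, \<dots>, s\<^sub>n)\<close>.\<close>
definition hess_variety :: "nat \<Rightarrow> (nat \<Rightarrow> complex) \<Rightarrow> (nat \<Rightarrow> nat) \<Rightarrow> flag set" where
  "hess_variety n s h =
     {V \<in> Flag n. \<forall>i\<in>{1..n}. (\<lambda>x j. s j * x j) ` V i \<subseteq> V (h i)}"

definition hess_space :: "nat \<Rightarrow> (nat \<Rightarrow> complex) \<Rightarrow> (nat \<Rightarrow> nat) \<Rightarrow> flag topology" where
  "hess_space n s h = subtopology (flag_topology n) (hess_variety n s h)"


section \<open>Torus-equivariant cohomology\<close>

definition torus :: "nat \<Rightarrow> (nat \<Rightarrow> complex) set" where
  "torus n = {g. (\<forall>i\<in>{1..n}. g i \<noteq> 0) \<and> (\<forall>i. i \<notin> {1..n} \<longrightarrow> g i = 1)}"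

definition flag_act :: "nat \<Rightarrow> (nat \<Rightarrow> complex) \<Rightarrow> flag \<Rightarrow> flag" where
  "flag_act n g V = (\<lambda>i\<in>{1..n}. (\<lambda>x j. g j * x j) ` V i)"

text \<open>A model of \<open>ET\<close>: the \<open>n\<close>-th power of the contractible space of nonzero complex sequences
  (with the topology of pointwise convergence), on which \<open>T = (\<complex>\<^sup>*)\<^sup>n\<close> acts freely by scaling.\<close>
definition ET :: "nat \<Rightarrow> (nat \<Rightarrow> nat \<Rightarrow> complex) set" where
  "ET n = {z. \<forall>i. z i \<noteq> 0 \<longleftrightarrow> i \<in> {1..n}}"

definition ET_act :: "(nat \<Rightarrow> complex) \<Rightarrow> (nat \<Rightarrow> nat \<Rightarrow> complex) \<Rightarrow> nat \<Rightarrow> nat \<Rightarrow> complex" where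
  "ET_act g z = (\<lambda>i k. g i * z i k)"

type_synonym 'a borel_space = "((nat \<Rightarrow> nat \<Rightarrow> complex) \<times> 'a) set topology"

definition borel_orbit ::
    "nat \<Rightarrow> ((nat \<Rightarrow> complex) \<Rightarrow> 'a \<Rightarrow> 'a) \<Rightarrow>
     (nat \<Rightarrow> nat \<Rightarrow> complex) \<times> 'a \<Rightarrow> ((nat \<Rightarrow> nat \<Rightarrow> complex) \<times> 'a) set" where
  "borel_orbit n act = (\<lambda>(z, x). {(ET_act g z, act g x) | g. g \<in> torus n})"

text \<open>The Borel construction \<open>ET \<times>\<^sub>T X\<close>: orbits of the diagonal action on \<open>ET \<times> X\<close>.\<close>
definition borel_construction ::
    "nat \<Rightarrow> 'a topology \<Rightarrow> ((nat \<Rightarrow> complex) \<Rightarrow> 'a \<Rightarrow> 'a) \<Rightarrow> 'a borel_space" where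
  "borel_construction n X act =
     quotient_topology (prod_topology (top_of_set (ET n)) X) (borel_orbit n act)"

definition BT :: "nat \<Rightarrow> unit borel_space" where
  "BT n = borel_construction n (discrete_topology UNIV) (\<lambda>g x. x)"

definition hess_borel :: "nat \<Rightarrow> (nat \<Rightarrow> complex) \<Rightarrow> (nat \<Rightarrow> nat) \<Rightarrow> flag borel_space" where
  "hess_borel n s h = borel_construction n (hess_space n s h) (flag_act n)"

definition equiv_cohomology ::
    "nat \<Rightarrow> (nat \<Rightarrow> complex) \<Rightarrow> (nat \<Rightarrow> nat) \<Rightarrow> nat \<Rightarrow>
     (complex, ((nat \<Rightarrow> nat \<Rightarrow> complex) \<times> flag) set cochain set) module" where
  "equiv_cohomology n s h p = cohomology p (hess_borel n s h)"

text \<open>Inclusion of \<open>X(h)\<close> as a fibre of \<open>ET \<times>\<^sub>T X(h) \<rightarrow> BT\<close>; as \<open>ET\<close> is path connected, the choice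
  of the base point is irrelevant in cohomology.\<close>
definition fibre_inclusion :: "nat \<Rightarrow> flag \<Rightarrow> ((nat \<Rightarrow> nat \<Rightarrow> complex) \<times> flag) set" where
  "fibre_inclusion n V =
     borel_orbit n (flag_act n) (\<lambda>i k. if i \<in> {1..n} \<and> k = 0 then 1 else 0, V)"

definition forget ::
    "nat \<Rightarrow> (nat \<Rightarrow> complex) \<Rightarrow> (nat \<Rightarrow> nat) \<Rightarrow> nat \<Rightarrow>
     ((nat \<Rightarrow> nat \<Rightarrow> complex) \<times> flag) set cochain set \<Rightarrow> flag cochain set" where
  "forget n s h p = coh_pullback p (hess_space n s h) (fibre_inclusion n)"

definition fixed_flag :: "nat \<Rightarrow> (nat \<Rightarrow> nat) \<Rightarrow> flag" where
  "fixed_flag n w = flag_of n (\<lambda>i. basis_vec (w i))"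

text \<open>The inclusion \<open>BT = ET \<times>\<^sub>T {w} \<rightarrow> ET \<times>\<^sub>T X(h)\<close> of a fixed point.\<close>
definition fixed_point_inclusion ::
    "nat \<Rightarrow> (nat \<Rightarrow> nat) \<Rightarrow> ((nat \<Rightarrow> nat \<Rightarrow> complex) \<times> unit) set \<Rightarrow>
     ((nat \<Rightarrow> nat \<Rightarrow> complex) \<times> flag) set" where
  "fixed_point_inclusion n w A = (\<lambda>(z, _). (z, fixed_flag n w)) ` A"


section \<open>The identification of the cohomology of \<open>BT\<close> with the polynomial ring\<close>

text \<open>The line bundle \<open>ET \<times>\<^sub>T \<complex>\<close> over \<open>BT\<close> of the character \<open>diag(g\<^sub>1, \<dots>, g\<^sub>n) \<mapsto> g\<^sub>i\<close>.\<close>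
definition line_bundle :: "nat \<Rightarrow> nat \<Rightarrow> complex borel_space" where
  "line_bundle n i = borel_construction n euclidean (\<lambda>g c. g i * c)"

definition nonzero_vectors :: "nat \<Rightarrow> nat \<Rightarrow> ((nat \<Rightarrow> nat \<Rightarrow> complex) \<times> complex) set set" where
  "nonzero_vectors n i = borel_orbit n (\<lambda>g c. g i * c) ` (ET n \<times> (UNIV - {0}))"

definition zero_section ::
    "((nat \<Rightarrow> nat \<Rightarrow> complex) \<times> unit) set \<Rightarrow> ((nat \<Rightarrow> nat \<Rightarrow> complex) \<times> complex) set" where
  "zero_section A = (\<lambda>(z, _). (z, 0)) ` A"

text \<open>The affine 2-simplex with vertices \<open>1, \<omega>, \<omega>\<^sup>2\<close> (\<open>\<omega> = exp(2\<pi>i/3)\<close>) in the fibre over \<open>[z]\<close>. It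
  encloses the origin positively, so it represents the canonical generator of \<open>H\<^sub>2(\<complex>, \<complex>\<^sup>*)\<close>.\<close>
definition fibre_simplex ::
    "nat \<Rightarrow> nat \<Rightarrow> (nat \<Rightarrow> nat \<Rightarrow> complex) \<Rightarrow> (nat \<Rightarrow> real) \<Rightarrow>
     ((nat \<Rightarrow> nat \<Rightarrow> complex) \<times> complex) set" where
  "fibre_simplex n i z = (\<lambda>x\<in>standard_simplex 2.
     borel_orbit n (\<lambda>g c. g i * c) (z, \<Sum>k\<le>2. of_real (x k) * cis (2 * pi * real k / 3)))"

text \<open>Relative cocycles representing the Thom class in \<open>H\<^sup>2(L, L - 0)\<close>.\<close>
definition thom_cocycle ::
    "nat \<Rightarrow> nat \<Rightarrow> ((nat \<Rightarrow> nat \<Rightarrow> complex) \<times> complex) set cochain \<Rightarrow> bool" where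
  "thom_cocycle n i u \<longleftrightarrow> u \<in> cocycles 2 (line_bundle n i) \<and>
     (\<forall>\<sigma>. singular_simplex 2 (subtopology (line_bundle n i) (nonzero_vectors n i)) \<sigma> \<longrightarrow> u \<sigma> = 0) \<and>
     (\<forall>z\<in>ET n. u (fibre_simplex n i z) = 1)"

text \<open>A cocycle representing the first Chern class of \<open>line_bundle n i\<close>, i.e. its Euler class: the
  restriction of the Thom class to the zero section. The Thom class being unique, all choices are
  cohomologous.\<close>
definition chern_cocycle ::
    "nat \<Rightarrow> nat \<Rightarrow> ((nat \<Rightarrow> nat \<Rightarrow> complex) \<times> unit) set cochain" where
  "chern_cocycle n i =
     cochain_pullback 2 (BT n) zero_section (SOME u. thom_cocycle n i u)"

text \<open>Polynomials in variables indexed by \<open>nat\<close>; a monomial is the finitely supported function of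
  its exponents.\<close>
type_synonym cpoly = "(nat \<Rightarrow>\<^sub>0 nat) \<Rightarrow>\<^sub>0 complex"

definition tvar :: "nat \<Rightarrow> cpoly" where
  "tvar i = Poly_Mapping.single (Poly_Mapping.single i 1) 1"

definition polys :: "nat \<Rightarrow> cpoly set" where
  "polys n = {f. \<forall>m\<in>Poly_Mapping.keys f. Poly_Mapping.keys m \<subseteq> {1..n}}"

definition homog_polys :: "nat \<Rightarrow> nat \<Rightarrow> cpoly set" where
  "homog_polys n k = {f \<in> polys n.
     \<forall>m\<in>Poly_Mapping.keys f. (\<Sum>i\<in>Poly_Mapping.keys m. Poly_Mapping.lookup m i) = k}"

primrec chern_word :: "nat \<Rightarrow> nat list \<Rightarrow> ((nat \<Rightarrow> nat \<Rightarrow> complex) \<times> unit) set cochain" where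
  "chern_word n [] = unit_cochain (BT n)"
| "chern_word n (i # is) = cup (BT n) 2 (2 * length is) (chern_cocycle n i) (chern_word n is)"

definition chern_monomial ::
    "nat \<Rightarrow> (nat \<Rightarrow>\<^sub>0 nat) \<Rightarrow> ((nat \<Rightarrow> nat \<Rightarrow> complex) \<times> unit) set cochain" where
  "chern_monomial n m =
     chern_word n (concat (map (\<lambda>i. replicate (Poly_Mapping.lookup m i) i) [1..<Suc n]))"

text \<open>The degree \<open>2k\<close> part of \<open>\<complex>[t\<^sub>1, \<dots>, t\<^sub>n] \<rightarrow> H\<^sup>*(BT)\<close>, which sends \<open>t\<^sub>i\<close> to the first Chern class
  of \<open>line_bundle n i\<close>.\<close>
definition poly_to_BT ::
    "nat \<Rightarrow> nat \<Rightarrow> cpoly \<Rightarrow> ((nat \<Rightarrow> nat \<Rightarrow> complex) \<times> unit) set cochain set" where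
  "poly_to_BT n k f = coh_class (2 * k) (BT n)
     (\<Sum>m\<in>Poly_Mapping.keys f. cscale (Poly_Mapping.lookup f m) (chern_monomial n m))"


section \<open>Restriction to fixed points and Tymoczko's action\<close>

text \<open>The degree \<open>2k\<close> part of the restriction map to \<open>\<Oplus>\<^sub>w \<complex>[t\<^sub>1, \<dots>, t\<^sub>n]\<close>, the cohomology of \<open>BT\<close>
  being identified with polynomials.\<close>
definition restriction ::
    "nat \<Rightarrow> nat \<Rightarrow> ((nat \<Rightarrow> nat \<Rightarrow> complex) \<times> flag) set cochain set \<Rightarrow>
     (nat \<Rightarrow> nat) \<Rightarrow> cpoly" where
  "restriction n k x = (\<lambda>w\<in>Sn n. inv_into (homog_polys n k) (poly_to_BT n k)
     (coh_pullback (2 * k) (BT n) (fixed_point_inclusion n w) x))"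

definition GKM :: "nat \<Rightarrow> (nat \<Rightarrow> nat) \<Rightarrow> ((nat \<Rightarrow> nat) \<Rightarrow> cpoly) set" where
  "GKM n h = {\<alpha> \<in> Sn n \<rightarrow>\<^sub>E polys n. \<forall>w\<in>Sn n. \<forall>i j.
     1 \<le> j \<and> j < i \<and> i \<le> n \<and> i \<le> h j \<longrightarrow>
       (\<exists>f\<in>polys n. \<alpha> w - \<alpha> (w \<circ> Transposition.transpose j i) = (tvar (w i) - tvar (w j)) * f)}"

definition GKM_degree :: "nat \<Rightarrow> (nat \<Rightarrow> nat) \<Rightarrow> nat \<Rightarrow> ((nat \<Rightarrow> nat) \<Rightarrow> cpoly) set" where
  "GKM_degree n h k = GKM n h \<inter> (Sn n \<rightarrow>\<^sub>E homog_polys n k)"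

text \<open>The ideal \<open>(t\<^sub>1, \<dots>, t\<^sub>n)\<close> of the ring \<open>GKM n h\<close>.\<close>
definition GKM_t_ideal :: "nat \<Rightarrow> (nat \<Rightarrow> nat) \<Rightarrow> ((nat \<Rightarrow> nat) \<Rightarrow> cpoly) set" where
  "GKM_t_ideal n h =
     {\<lambda>w\<in>Sn n. \<Sum>i=1..n. tvar i * \<beta> i w | \<beta>. \<forall>i\<in>{1..n}. \<beta> i \<in> GKM n h}"

text \<open>\<open>v \<cdot> f(t\<^sub>1, \<dots>, t\<^sub>n) = f(t\<^bsub>v(1)\<^esub>, \<dots>, t\<^bsub>v(n)\<^esub>)\<close>\<close>
definition perm_poly :: "(nat \<Rightarrow> nat) \<Rightarrow> cpoly \<Rightarrow> cpoly" where
  "perm_poly v f = (\<Sum>m\<in>Poly_Mapping.keys f. Poly_Mapping.single 0 (Poly_Mapping.lookup f m) *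
     (\<Prod>i\<in>Poly_Mapping.keys m. tvar (v i) ^ Poly_Mapping.lookup m i))"

definition dot_action ::
    "nat \<Rightarrow> (nat \<Rightarrow> nat) \<Rightarrow> ((nat \<Rightarrow> nat) \<Rightarrow> cpoly) \<Rightarrow> (nat \<Rightarrow> nat) \<Rightarrow> cpoly" where
  "dot_action n v \<alpha> = (\<lambda>w\<in>Sn n. perm_poly v (\<alpha> (Hilbert_Choice.inv v \<circ> w)))"

text \<open>Transport of the dot action along the (injective) restriction map.\<close>
definition tymoczko_equiv ::
    "nat \<Rightarrow> (nat \<Rightarrow> complex) \<Rightarrow> (nat \<Rightarrow> nat) \<Rightarrow> nat \<Rightarrow> (nat \<Rightarrow> nat) \<Rightarrow>
     ((nat \<Rightarrow> nat \<Rightarrow> complex) \<times> flag) set cochain set \<Rightarrow>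
     ((nat \<Rightarrow> nat \<Rightarrow> complex) \<times> flag) set cochain set" where
  "tymoczko_equiv n s h k v x =
     inv_into (carrier (equiv_cohomology n s h (2 * k))) (restriction n k)
       (dot_action n v (restriction n k x))"

text \<open>The induced action on \<open>H\<^bsup>2k\<^esup>(X(h))\<close>: lift to equivariant cohomology, act, and forget.\<close>
definition tymoczko ::
    "nat \<Rightarrow> (nat \<Rightarrow> complex) \<Rightarrow> (nat \<Rightarrow> nat) \<Rightarrow> nat \<Rightarrow> (nat \<Rightarrow> nat) \<Rightarrow>
     flag cochain set \<Rightarrow> flag cochain set" where
  "tymoczko n s h k v y =
     forget n s h (2 * k) (tymoczko_equiv n s h k v
       (inv_into (carrier (equiv_cohomology n s h (2 * k))) (forget n s h (2 * k)) y))"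

definition hess_rep ::
    "nat \<Rightarrow> (nat \<Rightarrow> complex) \<Rightarrow> (nat \<Rightarrow> nat) \<Rightarrow> nat \<Rightarrow> flag cochain set rep" where
  "hess_rep n s h k = (cohomology (2 * k) (hess_space n s h), tymoczko n s h k)"

text \<open>\<open>R(X(h), q)\<close>. All degrees are included, as those above \<open>2 dim\<^sub>\<complex> X(h)\<close> contribute zero.\<close>
definition hess_R :: "nat \<Rightarrow> (nat \<Rightarrow> complex) \<Rightarrow> (nat \<Rightarrow> nat) \<Rightarrow> rep_poly" where
  "hess_R n s h = (\<lambda>i. rep_class n (hess_rep n s h i))"

end

theory Submission
  imports Defs
begin

text \<open>Write \<open>a = h(1)\<close>, and for a permutation \<open>w\<close> put
  \<open>x\<^sub>p(w) = t\<^bsub>w(p)\<^esub>\<close>. The functions \<open>x\<^sub>1, \<dots>,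
  x\<^sub>n\<close> lie in the ring \<open>GKM n h\<close>, and the dot action fixes them. The
  conditions that define this ring are indexed by transpositions of positions; those among the
  positions \<open>2, \<dots>, n\<close> are all present, and of those involving the position
  \<open>1\<close> only the ones with \<open>2, \<dots>, a\<close>. Hence the restriction of a
  member to \<open>{w. w(1) = k}\<close> is a member of the ring of a full flag variety in
  dimension \<open>n - 1\<close>, which is free over the polynomials in \<open>t\<close> with the
  basis \<open>\<Prod>\<^sub>p x\<^sub>p\<^bsup>c(p)\<^esup>\<close>, where \<open>p = 2, \<dots>,
  n\<close> and \<open>c(p) < p - 1\<close>.

  The proof uses a modification of this basis (function \<open>taut\<close>): at the positions
  \<open>p > a\<close> the top power \<open>x\<^sub>p\<^bsup>p-2\<^esup>\<close> is replaced by
  \<open>\<Prod>(x\<^sub>1 - x\<^sub>q)\<close> over \<open>2 \<le> q < p\<close>, which has the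
  same degree. Call an exponent vector high if it has the top value at some \<open>p > a\<close>,
  and low otherwise. A high element is divisible by \<open>x\<^sub>1 - x\<^sub>i\<close> for
  \<open>i = 2, \<dots>, a\<close> (\<open>high_taut_dvd\<close>). It may therefore be cut off to
  \<open>{w. w(1) = k}\<close> without violating the conditions that relate different values of
  \<open>w(1)\<close>. The elements that are cut off in this way are permuted by
  \<open>\<SS>\<^sub>n\<close> through \<open>k\<close>, so they span copies of \<open>Ind
  1\<close> from \<open>\<SS>\<^bsub>n-1\<^esub> \<times> \<SS>\<^sub>1\<close>. The low elements,
  multiplied by \<open>x\<^sub>1\<^sup>d\<close> for \<open>d < n\<close>, are invariant and span
  copies of the trivial representation.

  These elements form a basis of \<open>GKM n h\<close> over the polynomials in \<open>t\<close>
  (\<open>basis_independent\<close>, \<open>basis_spanning\<close>). Independence holds on each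
  \<open>{w. w(1) = k}\<close> and then, for the powers of \<open>x\<^sub>1\<close>, by comparing
  the values of \<open>k\<close>. For spanning, a member has coefficients \<open>P k c\<close> on
  \<open>{w. w(1) = k}\<close>. If \<open>c\<close> is low then \<open>P k c\<close> and \<open>P
  l c\<close> agree modulo \<open>t\<^sub>k - t\<^sub>l\<close>: when \<open>t\<^sub>k\<close> and
  \<open>t\<^sub>l\<close> are identified, the high elements vanish on all \<open>w\<close> for
  which \<open>l\<close> is among the values at \<open>2, \<dots>, a\<close>, the conditions for
  the transpositions \<open>(1 i)\<close> equate the low parts, and the low monomials are
  independent already on those \<open>w\<close> (\<open>low_taut_independent\<close>). By
  interpolation (\<open>newton_interpolation\<close>) \<open>P k c\<close> is then a polynomial in
  \<open>t\<^sub>k\<close> of degree less than \<open>n\<close>.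

  A homogeneous basis over the polynomials in \<open>t\<close> is a basis of the quotient by the
  ideal \<open>(t\<^sub>1, \<dots>, t\<^sub>n)\<close>, which by assumption is
  \<open>H\<^sup>*(X(h))\<close> as a vector space. That it is so as a representation
  (\<open>hess_rep_iso_perm_rep\<close>) uses that the restrictions to fixed points and to the
  fibre are linear, and that the ideal is stable under the dot action. Counting low and high
  exponents by degree gives the two products of \<open>q\<close>-numbers
  (\<open>card_low_degree\<close>, \<open>card_high_degree\<close>); the second one arises as a
  difference by \<open>[n-1] = [a-1] + q\<^bsup>a-1\<^esup> [n-a]\<close>. Finally, classes in the
  representation ring are computed from explicit matrix forms
  (\<open>rep_class_two_types\<close>).\<close>

unbundle no vec_syntax

section \<open>Representations\<close>

text \<open>Every law is an equation or a closure property of the operations themselves; in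
  particular the additive inverse is the multiple by \<open>-1\<close>. In this form the laws can
  be checked pointwise and transported along bijections by rewriting.\<close>

locale representation =
  fixes n :: nat and V :: "(complex, 'a) module" and a :: "(nat \<Rightarrow> nat) \<Rightarrow> 'a \<Rightarrow> 'a"
  assumes zero_closed: "\<zero>\<^bsub>V\<^esub> \<in> carrier V"
    and add_closed: "x \<in> carrier V \<Longrightarrow> y \<in> carrier V \<Longrightarrow> x \<oplus>\<^bsub>V\<^esub> y \<in> carrier V"
    and smult_closed: "x \<in> carrier V \<Longrightarrow> c \<odot>\<^bsub>V\<^esub> x \<in> carrier V"
    and act_closed: "g \<in> Sn n \<Longrightarrow> x \<in> carrier V \<Longrightarrow> a g x \<in> carrier V"
    and add_commute: "x \<in> carrier V \<Longrightarrow> y \<in> carrier V \<Longrightarrow> x \<oplus>\<^bsub>V\<^esub> y = y \<oplus>\<^bsub>V\<^esub> x"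
    and add_assoc: "x \<in> carrier V \<Longrightarrow> y \<in> carrier V \<Longrightarrow> z \<in> carrier V \<Longrightarrow>
      (x \<oplus>\<^bsub>V\<^esub> y) \<oplus>\<^bsub>V\<^esub> z = x \<oplus>\<^bsub>V\<^esub> (y \<oplus>\<^bsub>V\<^esub> z)"
    and zero_add: "x \<in> carrier V \<Longrightarrow> \<zero>\<^bsub>V\<^esub> \<oplus>\<^bsub>V\<^esub> x = x"
    and add_neg: "x \<in> carrier V \<Longrightarrow> x \<oplus>\<^bsub>V\<^esub> ((-1) \<odot>\<^bsub>V\<^esub> x) = \<zero>\<^bsub>V\<^esub>"
    and one_smult: "x \<in> carrier V \<Longrightarrow> 1 \<odot>\<^bsub>V\<^esub> x = x"
    and smult_add_left: "x \<in> carrier V \<Longrightarrow> (c + d) \<odot>\<^bsub>V\<^esub> x = c \<odot>\<^bsub>V\<^esub> x \<oplus>\<^bsub>V\<^esub> d \<odot>\<^bsub>V\<^esub> x"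
    and smult_smult: "x \<in> carrier V \<Longrightarrow> (c * d) \<odot>\<^bsub>V\<^esub> x = c \<odot>\<^bsub>V\<^esub> (d \<odot>\<^bsub>V\<^esub> x)"
    and smult_add_right: "x \<in> carrier V \<Longrightarrow> y \<in> carrier V \<Longrightarrow>
      c \<odot>\<^bsub>V\<^esub> (x \<oplus>\<^bsub>V\<^esub> y) = c \<odot>\<^bsub>V\<^esub> x \<oplus>\<^bsub>V\<^esub> c \<odot>\<^bsub>V\<^esub> y"
    and act_add: "g \<in> Sn n \<Longrightarrow> x \<in> carrier V \<Longrightarrow> y \<in> carrier V \<Longrightarrow> a g (x \<oplus>\<^bsub>V\<^esub> y) = a g x \<oplus>\<^bsub>V\<^esub> a g y"
    and act_smult: "g \<in> Sn n \<Longrightarrow> x \<in> carrier V \<Longrightarrow> a g (c \<odot>\<^bsub>V\<^esub> x) = c \<odot>\<^bsub>V\<^esub> a g x"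
    and act_id: "x \<in> carrier V \<Longrightarrow> a id x = x"
    and act_comp: "g \<in> Sn n \<Longrightarrow> u \<in> Sn n \<Longrightarrow> x \<in> carrier V \<Longrightarrow> a (g \<circ> u) x = a g (a u x)"

lemma cring_complex_field: "cring complex_field"
proof (rule cringI)
  show "abelian_group complex_field"
    by (rule abelian_groupI)
      (auto simp: complex_field_def add.assoc intro: exI[of _ "- x" for x] ab_left_minus)
  show "comm_monoid complex_field"
    by (rule comm_monoidI) (auto simp: complex_field_def)
qed (auto simp: complex_field_def ring_distribs)

lemma is_rep_iff: "is_rep n (V, a) \<longleftrightarrow> representation n V a"
proof
  assume R: "is_rep n (V, a)"
  then have "Module.module complex_field V" by (simp add: is_rep_def)
  then interpret M: Module.module complex_field V .
  show "representation n V a"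
  proof
    fix x assume x: "x \<in> carrier V"
    have "x \<oplus>\<^bsub>V\<^esub> ((-1) \<odot>\<^bsub>V\<^esub> x) = (1 + (-1)) \<odot>\<^bsub>V\<^esub> x"
      using M.smult_l_distr[of 1 "-1" x] M.smult_one[OF x] x by (simp add: complex_field_def)
    also have "\<dots> = \<zero>\<^bsub>V\<^esub>"
      using M.smult_l_null[OF x] by (simp add: complex_field_def)
    finally show "x \<oplus>\<^bsub>V\<^esub> ((-1) \<odot>\<^bsub>V\<^esub> x) = \<zero>\<^bsub>V\<^esub>" .
    show "1 \<odot>\<^bsub>V\<^esub> x = x" using M.smult_one[OF x] by (simp add: complex_field_def)
    show "c \<odot>\<^bsub>V\<^esub> x \<in> carrier V" for c using M.smult_closed[of c x] x by (simp add: complex_field_def)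
    show "(c + d) \<odot>\<^bsub>V\<^esub> x = c \<odot>\<^bsub>V\<^esub> x \<oplus>\<^bsub>V\<^esub> d \<odot>\<^bsub>V\<^esub> x" for c d
      using M.smult_l_distr[of c d x] x by (simp add: complex_field_def)
    show "(c * d) \<odot>\<^bsub>V\<^esub> x = c \<odot>\<^bsub>V\<^esub> (d \<odot>\<^bsub>V\<^esub> x)" for c d
      using M.smult_assoc1[of c d x] x by (simp add: complex_field_def)
    show "c \<odot>\<^bsub>V\<^esub> (x \<oplus>\<^bsub>V\<^esub> y) = c \<odot>\<^bsub>V\<^esub> x \<oplus>\<^bsub>V\<^esub> c \<odot>\<^bsub>V\<^esub> y" if "y \<in> carrier V" for c y
      using M.smult_r_distr[of c x y] x that by (simp add: complex_field_def)
    show "\<zero>\<^bsub>V\<^esub> \<oplus>\<^bsub>V\<^esub> x = x" using x by (rule M.l_zero)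
    show "x \<oplus>\<^bsub>V\<^esub> y = y \<oplus>\<^bsub>V\<^esub> x" if "y \<in> carrier V" for y using x that by (rule M.a_comm)
    show "(x \<oplus>\<^bsub>V\<^esub> y) \<oplus>\<^bsub>V\<^esub> z = x \<oplus>\<^bsub>V\<^esub> (y \<oplus>\<^bsub>V\<^esub> z)" if "y \<in> carrier V" "z \<in> carrier V" for y z
      using x that by (rule M.a_assoc)
  qed (use R in \<open>auto simp: is_rep_def\<close>)
next
  assume "representation n V a"
  then interpret R: representation n V a .
  have "Module.module complex_field V"
  proof (rule moduleI)
    show "abelian_group V"
    proof (rule abelian_groupI)
      show "\<exists>y\<in>carrier V. y \<oplus>\<^bsub>V\<^esub> x = \<zero>\<^bsub>V\<^esub>" if "x \<in> carrier V" for x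
        using that R.add_commute[of x "(-1) \<odot>\<^bsub>V\<^esub> x"]
        by (intro bexI[of _ "(-1) \<odot>\<^bsub>V\<^esub> x"]) (simp_all add: R.smult_closed R.add_neg)
    qed (fact R.add_closed R.zero_closed R.add_assoc R.add_commute R.zero_add)+
  qed (simp_all add: cring_complex_field R.smult_closed R.smult_add_right,
       simp_all add: complex_field_def R.smult_add_left R.smult_smult R.one_smult)
  then show "is_rep n (V, a)"
    unfolding is_rep_def by (simp add: R.act_closed R.act_add R.act_smult R.act_id R.act_comp)
qed

lemma Sn_id: "id \<in> Sn n"
  by (simp add: Sn_def permutes_id)

lemma Sn_comp: "v \<in> Sn n \<Longrightarrow> w \<in> Sn n \<Longrightarrow> v \<circ> w \<in> Sn n"
  by (simp add: Sn_def permutes_compose)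

lemma Sn_inj: "w \<in> Sn n \<Longrightarrow> inj w"
  by (simp add: Sn_def permutes_inj)

lemma Sn_image: "w \<in> Sn n \<Longrightarrow> w ` {1..n} = {1..n}"
  by (simp add: Sn_def permutes_image)

lemma Sn_mem: "w \<in> Sn n \<Longrightarrow> i \<in> {1..n} \<Longrightarrow> w i \<in> {1..n}"
  using Sn_image by blast

lemma Sn_transpose: "i \<in> {1..n} \<Longrightarrow> j \<in> {1..n} \<Longrightarrow> Transposition.transpose i j \<in> Sn n"
  by (simp add: Sn_def permutes_swap_id)

lemma finite_Sn [simp]: "finite (Sn n)"
  unfolding Sn_def by (rule finite_permutations) simp

lemma Sn_inv: "v \<in> Sn n \<Longrightarrow> Hilbert_Choice.inv v \<in> Sn n"
  by (simp add: Sn_def permutes_inv)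

lemma Sn_inv_comp:
  "g \<in> Sn n \<Longrightarrow> u \<in> Sn n \<Longrightarrow> Hilbert_Choice.inv (g \<circ> u) = Hilbert_Choice.inv u \<circ> Hilbert_Choice.inv g"
  by (rule o_inv_distrib) (auto simp: Sn_def permutes_bij)

definition intertwiner :: "nat \<Rightarrow> 'a rep \<Rightarrow> 'b rep \<Rightarrow> ('a \<Rightarrow> 'b) \<Rightarrow> bool" where
  "intertwiner n R R' \<phi> \<longleftrightarrow> bij_betw \<phi> (carrier (fst R)) (carrier (fst R')) \<and>
     (\<forall>x\<in>carrier (fst R). \<forall>y\<in>carrier (fst R). \<phi> (x \<oplus>\<^bsub>fst R\<^esub> y) = \<phi> x \<oplus>\<^bsub>fst R'\<^esub> \<phi> y) \<and>
     (\<forall>c. \<forall>x\<in>carrier (fst R). \<phi> (c \<odot>\<^bsub>fst R\<^esub> x) = c \<odot>\<^bsub>fst R'\<^esub> \<phi> x) \<and>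
     (\<forall>g\<in>Sn n. \<forall>x\<in>carrier (fst R). \<phi> (snd R g x) = snd R' g (\<phi> x))"

lemma rep_iso_iff: "rep_iso n R R' \<longleftrightarrow> is_rep n R \<and> is_rep n R' \<and> (\<exists>\<phi>. intertwiner n R R' \<phi>)"
  by (simp add: rep_iso_def intertwiner_def case_prod_beta)

lemma intertwinerD:
  assumes "intertwiner n R R' \<phi>"
  shows "bij_betw \<phi> (carrier (fst R)) (carrier (fst R'))"
    and "x \<in> carrier (fst R) \<Longrightarrow> y \<in> carrier (fst R) \<Longrightarrow> \<phi> (x \<oplus>\<^bsub>fst R\<^esub> y) = \<phi> x \<oplus>\<^bsub>fst R'\<^esub> \<phi> y"
    and "x \<in> carrier (fst R) \<Longrightarrow> \<phi> (c \<odot>\<^bsub>fst R\<^esub> x) = c \<odot>\<^bsub>fst R'\<^esub> \<phi> x"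
    and "g \<in> Sn n \<Longrightarrow> x \<in> carrier (fst R) \<Longrightarrow> \<phi> (snd R g x) = snd R' g (\<phi> x)"
  using assms unfolding intertwiner_def by simp_all

lemma rep_isoI:
  assumes "is_rep n R" "is_rep n R'" "bij_betw \<phi> (carrier (fst R)) (carrier (fst R'))"
    and "\<And>x y. x \<in> carrier (fst R) \<Longrightarrow> y \<in> carrier (fst R) \<Longrightarrow>
      \<phi> (x \<oplus>\<^bsub>fst R\<^esub> y) = \<phi> x \<oplus>\<^bsub>fst R'\<^esub> \<phi> y"
    and "\<And>c x. x \<in> carrier (fst R) \<Longrightarrow> \<phi> (c \<odot>\<^bsub>fst R\<^esub> x) = c \<odot>\<^bsub>fst R'\<^esub> \<phi> x"
    and "\<And>g x. g \<in> Sn n \<Longrightarrow> x \<in> carrier (fst R) \<Longrightarrow> \<phi> (snd R g x) = snd R' g (\<phi> x)"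
  shows "rep_iso n R R'"
  unfolding rep_iso_iff intertwiner_def using assms by (auto intro!: exI[of _ \<phi>])

lemma rep_iso_sym:
  assumes "rep_iso n R R'"
  shows "rep_iso n R' R"
proof -
  have reps: "is_rep n R" "is_rep n R'" using assms by (auto simp: rep_iso_iff)
  obtain f where "intertwiner n R R' f" using assms by (auto simp: rep_iso_iff)
  note f = intertwinerD[OF this]
  let ?V = "fst R" and ?W = "fst R'"
  let ?g = "inv_into (carrier ?V) f"
  have gf: "?g (f x) = x" if "x \<in> carrier ?V" for x using f(1) that by (rule bij_betw_inv_into_left)
  have ex: "\<exists>x\<in>carrier ?V. y = f x" if "y \<in> carrier ?W" for y
    using f(1) that by (auto simp: bij_betw_def)
  interpret R: representation n ?V "snd R" using reps by (simp add: is_rep_iff[symmetric])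
  show ?thesis
  proof (rule rep_isoI[where \<phi> = ?g])
    fix y y' assume "y \<in> carrier ?W" "y' \<in> carrier ?W"
    then obtain x x' where x: "x \<in> carrier ?V" "y = f x" "x' \<in> carrier ?V" "y' = f x'" using ex by blast
    then show "?g (y \<oplus>\<^bsub>?W\<^esub> y') = ?g y \<oplus>\<^bsub>?V\<^esub> ?g y'"
      using gf R.add_closed by (simp flip: f(2))
  next
    fix c y assume "y \<in> carrier ?W"
    then obtain x where x: "x \<in> carrier ?V" "y = f x" using ex by blast
    then show "?g (c \<odot>\<^bsub>?W\<^esub> y) = c \<odot>\<^bsub>?V\<^esub> ?g y"
      using gf R.smult_closed by (simp flip: f(3))
  next
    fix u y assume u: "u \<in> Sn n" and "y \<in> carrier ?W"
    then obtain x where x: "x \<in> carrier ?V" "y = f x" using ex by blast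
    then show "?g (snd R' u y) = snd R u (?g y)"
      using gf R.act_closed[OF u] by (simp flip: f(4)[OF u])
  qed (fact reps bij_betw_inv_into[OF f(1)])+
qed

lemma rep_iso_trans:
  assumes "rep_iso n R R'" "rep_iso n R' R''"
  shows "rep_iso n R R''"
proof -
  obtain f where "intertwiner n R R' f" using assms(1) by (auto simp: rep_iso_iff)
  note f = intertwinerD[OF this]
  obtain g where "intertwiner n R' R'' g" using assms(2) by (auto simp: rep_iso_iff)
  note g = intertwinerD[OF this]
  note fW = bij_betw_apply[OF f(1)]
  show ?thesis
  proof (rule rep_isoI[where \<phi> = "g \<circ> f"])
    show "is_rep n R" "is_rep n R''" using assms by (auto simp: rep_iso_iff)
    show "bij_betw (g \<circ> f) (carrier (fst R)) (carrier (fst R''))" using f(1) g(1) by (rule bij_betw_trans)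
  qed (simp_all add: f(2-4) g(2-4) fW)
qed

text \<open>The laws of a representation are carried over by the bijection. For cohomology this is
  the way to see that Tymoczko's formulas define an action at all: they involve a choice of lifts,
  and the laws are not visible from them.\<close>

lemma rep_iso_transport:
  assumes W: "is_rep n (W, b)" and f: "bij_betw f (carrier W) (carrier V)"
    and add: "\<And>x y. x \<in> carrier W \<Longrightarrow> y \<in> carrier W \<Longrightarrow> f (x \<oplus>\<^bsub>W\<^esub> y) = f x \<oplus>\<^bsub>V\<^esub> f y"
    and smult: "\<And>c x. x \<in> carrier W \<Longrightarrow> f (c \<odot>\<^bsub>W\<^esub> x) = c \<odot>\<^bsub>V\<^esub> f x"
    and zero: "f \<zero>\<^bsub>W\<^esub> = \<zero>\<^bsub>V\<^esub>"
    and act: "\<And>g x. g \<in> Sn n \<Longrightarrow> x \<in> carrier W \<Longrightarrow> f (b g x) = a g (f x)"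
  shows "rep_iso n (W, b) (V, a)"
proof -
  interpret W: representation n W b using W by (simp add: is_rep_iff)
  have V: "carrier V = f ` carrier W" using f by (simp add: bij_betw_def)
  note ops = add[symmetric] smult[symmetric] zero[symmetric] act[symmetric]
  note closed = W.zero_closed W.add_closed W.smult_closed W.act_closed Sn_id Sn_comp
  have "representation n V a"
  proof
    fix x y assume "x \<in> carrier V" "y \<in> carrier V"
    then show "x \<oplus>\<^bsub>V\<^esub> y = y \<oplus>\<^bsub>V\<^esub> x"
      unfolding V by (elim imageE) (simp add: ops W.add_commute)
  qed (auto simp: V ops closed W.zero_add W.add_neg W.one_smult W.act_id
        W.smult_smult W.act_comp W.add_assoc W.smult_add_left W.smult_add_right W.act_add W.act_smult)
  then have "is_rep n (V, a)" by (simp add: is_rep_iff)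
  then show ?thesis
    using W f add smult act by (auto simp: rep_iso_def intro!: exI[of _ f])
qed

lemma is_rep_direct_sum:
  assumes "\<And>R. R \<in> set Rs \<Longrightarrow> is_rep n R"
  shows "is_rep n (direct_sum Rs)"
proof -
  have L: "representation n (fst (Rs ! i)) (snd (Rs ! i))" if "i < length Rs" for i
    using assms[of "Rs ! i"] that by (simp add: is_rep_iff[symmetric])
  let ?V = "fst (direct_sum Rs)" and ?I = "{..<length Rs}"
  have mem: "x i \<in> carrier (fst (Rs ! i))" if "x \<in> carrier ?V" "i \<in> ?I" for x i
    using that by (auto simp: direct_sum_def)
  have ext: "x = y" if "x \<in> carrier ?V" "y \<in> carrier ?V" "\<And>i. i \<in> ?I \<Longrightarrow> x i = y i" for x y
    using that by (intro PiE_ext[of x ?I _ y]) (auto simp: direct_sum_def)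
  have zero: "\<zero>\<^bsub>?V\<^esub> i = \<zero>\<^bsub>fst (Rs ! i)\<^esub>"
    and add: "(x \<oplus>\<^bsub>?V\<^esub> y) i = x i \<oplus>\<^bsub>fst (Rs ! i)\<^esub> y i"
    and smult: "(c \<odot>\<^bsub>?V\<^esub> x) i = c \<odot>\<^bsub>fst (Rs ! i)\<^esub> x i"
    and act: "snd (direct_sum Rs) g x i = snd (Rs ! i) g (x i)" if "i \<in> ?I" for i x y c g
    using that by (simp_all add: direct_sum_def)
  have cl: "\<zero>\<^bsub>?V\<^esub> \<in> carrier ?V"
    "x \<in> carrier ?V \<Longrightarrow> y \<in> carrier ?V \<Longrightarrow> x \<oplus>\<^bsub>?V\<^esub> y \<in> carrier ?V"
    "x \<in> carrier ?V \<Longrightarrow> c \<odot>\<^bsub>?V\<^esub> x \<in> carrier ?V"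
    "g \<in> Sn n \<Longrightarrow> x \<in> carrier ?V \<Longrightarrow> snd (direct_sum Rs) g x \<in> carrier ?V" for x y c g
    using L[THEN representation.zero_closed] L[THEN representation.add_closed]
      L[THEN representation.smult_closed] L[THEN representation.act_closed]
    by (auto simp: direct_sum_def PiE_iff)
  have L: "representation n (fst (Rs ! i)) (snd (Rs ! i))" if "i \<in> ?I" for i
    using L that by simp
  have "representation n ?V (snd (direct_sum Rs))"
  proof
    fix x y z and c d g u
    assume x: "x \<in> carrier ?V"
    show "\<zero>\<^bsub>?V\<^esub> \<oplus>\<^bsub>?V\<^esub> x = x" "x \<oplus>\<^bsub>?V\<^esub> ((-1) \<odot>\<^bsub>?V\<^esub> x) = \<zero>\<^bsub>?V\<^esub>" "1 \<odot>\<^bsub>?V\<^esub> x = x"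
      "snd (direct_sum Rs) id x = x"
      "(c + d) \<odot>\<^bsub>?V\<^esub> x = c \<odot>\<^bsub>?V\<^esub> x \<oplus>\<^bsub>?V\<^esub> d \<odot>\<^bsub>?V\<^esub> x"
      "(c * d) \<odot>\<^bsub>?V\<^esub> x = c \<odot>\<^bsub>?V\<^esub> (d \<odot>\<^bsub>?V\<^esub> x)"
      by (rule ext;
          simp add: x cl mem zero add smult act Sn_id representation.zero_add[OF L]
            representation.add_neg[OF L] representation.one_smult[OF L] representation.act_id[OF L]
            representation.smult_add_left[OF L] representation.smult_smult[OF L])+
    assume g: "g \<in> Sn n"
    show "snd (direct_sum Rs) g (c \<odot>\<^bsub>?V\<^esub> x) = c \<odot>\<^bsub>?V\<^esub> snd (direct_sum Rs) g x"
      by (rule ext; simp add: x g cl mem smult act representation.act_smult[OF L])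
    show "snd (direct_sum Rs) (g \<circ> u) x = snd (direct_sum Rs) g (snd (direct_sum Rs) u x)" if "u \<in> Sn n"
      by (rule ext; simp add: x g that Sn_comp cl mem act representation.act_comp[OF L])
  next
    fix x y z and c g assume x: "x \<in> carrier ?V" and y: "y \<in> carrier ?V"
    show "x \<oplus>\<^bsub>?V\<^esub> y = y \<oplus>\<^bsub>?V\<^esub> x"
      by (rule ext; simp add: x y cl mem add representation.add_commute[OF L])
    show "c \<odot>\<^bsub>?V\<^esub> (x \<oplus>\<^bsub>?V\<^esub> y) = c \<odot>\<^bsub>?V\<^esub> x \<oplus>\<^bsub>?V\<^esub> c \<odot>\<^bsub>?V\<^esub> y"
      by (rule ext; simp add: x y cl mem add smult representation.smult_add_right[OF L])
    show "snd (direct_sum Rs) g (x \<oplus>\<^bsub>?V\<^esub> y) = snd (direct_sum Rs) g x \<oplus>\<^bsub>?V\<^esub> snd (direct_sum Rs) g y"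
      if "g \<in> Sn n"
      by (rule ext; simp add: x y that cl mem add act representation.act_add[OF L])
    show "(x \<oplus>\<^bsub>?V\<^esub> y) \<oplus>\<^bsub>?V\<^esub> z = x \<oplus>\<^bsub>?V\<^esub> (y \<oplus>\<^bsub>?V\<^esub> z)" if "z \<in> carrier ?V"
      by (rule ext; simp add: x y that cl mem add representation.add_assoc[OF L])
  qed (fact cl)+
  then show ?thesis by (simp flip: is_rep_iff)
qed

section \<open>Permutation representations\<close>

text \<open>Spaces of functions on an \<open>\<SS>\<^sub>n\<close>-set with the action by
  translation. Both the permutation representation on \<open>X\<close> (\<open>C\<close> consists
  of all functions) and the representations induced from trivial ones (\<open>C\<close> consists
  of the invariant functions on \<open>\<SS>\<^sub>n\<close>) are of this form.\<close>

definition fun_rep ::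
    "'i set \<Rightarrow> ('i \<Rightarrow> complex) set \<Rightarrow> ((nat \<Rightarrow> nat) \<Rightarrow> 'i \<Rightarrow> 'i) \<Rightarrow> ('i \<Rightarrow> complex) rep" where
  "fun_rep X C act =
     (\<lparr>carrier = C, monoid.mult = undefined, one = undefined,
       zero = (\<lambda>x\<in>X. 0), add = (\<lambda>f f'. \<lambda>x\<in>X. f x + f' x),
       module.smult = (\<lambda>c f. \<lambda>x\<in>X. c * f x)\<rparr>,
      \<lambda>g f. \<lambda>x\<in>X. f (act (Hilbert_Choice.inv g) x))"

lemma fun_rep_simps:
  "carrier (fst (fun_rep X C act)) = C"
  "\<zero>\<^bsub>fst (fun_rep X C act)\<^esub> = (\<lambda>x\<in>X. 0)"
  "f \<oplus>\<^bsub>fst (fun_rep X C act)\<^esub> f' = (\<lambda>x\<in>X. f x + f' x)"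
  "c \<odot>\<^bsub>fst (fun_rep X C act)\<^esub> f = (\<lambda>x\<in>X. c * f x)"
  "snd (fun_rep X C act) g f = (\<lambda>x\<in>X. f (act (Hilbert_Choice.inv g) x))"
  by (simp_all add: fun_rep_def)

lemma is_rep_fun_rep:
  assumes act: "\<And>g x. g \<in> Sn n \<Longrightarrow> x \<in> X \<Longrightarrow> act g x \<in> X" "\<And>x. x \<in> X \<Longrightarrow> act id x = x"
      "\<And>g u x. g \<in> Sn n \<Longrightarrow> u \<in> Sn n \<Longrightarrow> x \<in> X \<Longrightarrow> act (g \<circ> u) x = act g (act u x)"
    and C: "C \<subseteq> X \<rightarrow>\<^sub>E UNIV" "(\<lambda>x\<in>X. 0) \<in> C"
      "\<And>f f'. f \<in> C \<Longrightarrow> f' \<in> C \<Longrightarrow> (\<lambda>x\<in>X. f x + f' x) \<in> C"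
      "\<And>c f. f \<in> C \<Longrightarrow> (\<lambda>x\<in>X. c * f x) \<in> C"
      "\<And>g f. g \<in> Sn n \<Longrightarrow> f \<in> C \<Longrightarrow> (\<lambda>x\<in>X. f (act g x)) \<in> C"
  shows "is_rep n (fun_rep X C act)"
proof -
  have ext: "(\<lambda>x\<in>X. F x) = f" if "f \<in> C" "\<And>x. x \<in> X \<Longrightarrow> F x = f x" for F f
    using that C(1) by (auto simp: fun_eq_iff restrict_def PiE_def extensional_def)
  have "representation n (fst (fun_rep X C act)) (snd (fun_rep X C act))"
  proof (unfold_locales, unfold fun_rep_simps)
    fix f f' f'' c d g u assume f: "f \<in> C"
    show "(\<lambda>x\<in>X. (\<lambda>x\<in>X. 0) x + f x) = f" "(\<lambda>x\<in>X. 1 * f x) = f"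
      "(\<lambda>x\<in>X. f (act (Hilbert_Choice.inv id) x)) = f"
      using f by (auto intro!: ext simp: act inv_id)
    show "(\<lambda>x\<in>X. f x + (\<lambda>x\<in>X. (-1) * f x) x) = (\<lambda>x\<in>X. 0)"
      "(\<lambda>x\<in>X. (c + d) * f x) = (\<lambda>x\<in>X. (\<lambda>x\<in>X. c * f x) x + (\<lambda>x\<in>X. d * f x) x)"
      "(\<lambda>x\<in>X. c * d * f x) = (\<lambda>x\<in>X. c * (\<lambda>x\<in>X. d * f x) x)"
      "(\<lambda>x\<in>X. f x + f' x) = (\<lambda>x\<in>X. f' x + f x)"
      "(\<lambda>x\<in>X. (\<lambda>x\<in>X. f x + f' x) x + f'' x) = (\<lambda>x\<in>X. f x + (\<lambda>x\<in>X. f' x + f'' x) x)"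
      "(\<lambda>x\<in>X. c * (\<lambda>x\<in>X. f x + f' x) x) = (\<lambda>x\<in>X. (\<lambda>x\<in>X. c * f x) x + (\<lambda>x\<in>X. c * f' x) x)"
      by (auto intro!: restrict_ext simp: algebra_simps)
    assume g: "g \<in> Sn n"
    show "(\<lambda>x\<in>X. (\<lambda>x\<in>X. f x + f' x) (act (Hilbert_Choice.inv g) x)) =
        (\<lambda>x\<in>X. (\<lambda>x\<in>X. f (act (Hilbert_Choice.inv g) x)) x + (\<lambda>x\<in>X. f' (act (Hilbert_Choice.inv g) x)) x)"
      "(\<lambda>x\<in>X. (\<lambda>x\<in>X. c * f x) (act (Hilbert_Choice.inv g) x)) =
        (\<lambda>x\<in>X. c * (\<lambda>x\<in>X. f (act (Hilbert_Choice.inv g) x)) x)"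
      using act(1)[OF Sn_inv[OF g]] by (auto intro!: restrict_ext)
    show "(\<lambda>x\<in>X. f (act (Hilbert_Choice.inv g) x)) \<in> C" by (rule C(5)[OF Sn_inv[OF g] f])
    assume u: "u \<in> Sn n"
    show "(\<lambda>x\<in>X. f (act (Hilbert_Choice.inv (g \<circ> u)) x)) =
        (\<lambda>x\<in>X. (\<lambda>x\<in>X. f (act (Hilbert_Choice.inv u) x)) (act (Hilbert_Choice.inv g) x))"
      using act(1)[OF Sn_inv[OF g]] by (auto intro!: restrict_ext simp: Sn_inv_comp[OF g u] act(3)[OF Sn_inv[OF u] Sn_inv[OF g]])
  qed (use C in auto)
  then show ?thesis by (simp flip: is_rep_iff)
qed

definition perm_rep :: "'i set \<Rightarrow> ((nat \<Rightarrow> nat) \<Rightarrow> 'i \<Rightarrow> 'i) \<Rightarrow> ('i \<Rightarrow> complex) rep" where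
  "perm_rep X act = fun_rep X (X \<rightarrow>\<^sub>E UNIV) act"

lemma is_rep_perm_rep:
  assumes "\<And>g x. g \<in> Sn n \<Longrightarrow> x \<in> X \<Longrightarrow> act g x \<in> X" "\<And>x. x \<in> X \<Longrightarrow> act id x = x"
    "\<And>g u x. g \<in> Sn n \<Longrightarrow> u \<in> Sn n \<Longrightarrow> x \<in> X \<Longrightarrow> act (g \<circ> u) x = act g (act u x)"
  shows "is_rep n (perm_rep X act)"
  unfolding perm_rep_def by (rule is_rep_fun_rep) (use assms in auto)

text \<open>With values in the trivial representation, equivariance under a subgroup is invariance
  under right translation by it.\<close>

lemma Ind_trivial_eq:
  "Ind_trivial n \<mu> = fun_rep (Sn n)
     {f \<in> Sn n \<rightarrow>\<^sub>E UNIV. \<forall>g\<in>Sn n. \<forall>h\<in>young_subgroup n \<mu>. f (g \<circ> h) = f g} (\<circ>)"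
  by (simp add: Ind_trivial_def induced_rep_def trivial_rep_def fun_rep_def)

lemma is_rep_Ind_trivial: "is_rep n (Ind_trivial n \<mu>)"
proof -
  have Y: "h \<in> Sn n" if "h \<in> young_subgroup n \<mu>" for h
    using that by (simp add: young_subgroup_def)
  show ?thesis
    unfolding Ind_trivial_eq
  proof (rule is_rep_fun_rep)
    fix g f assume g: "g \<in> Sn n"
      and f: "f \<in> {f \<in> Sn n \<rightarrow>\<^sub>E UNIV. \<forall>g\<in>Sn n. \<forall>h\<in>young_subgroup n \<mu>. f (g \<circ> h) = f g}"
    have "f (g \<circ> (x \<circ> h)) = f (g \<circ> x)" if "x \<in> Sn n" "h \<in> young_subgroup n \<mu>" for x h
      using f that Sn_comp[OF g that(1)] by (auto simp: o_assoc)
    then show "(\<lambda>x\<in>Sn n. f (g \<circ> x)) \<in>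
        {f \<in> Sn n \<rightarrow>\<^sub>E UNIV. \<forall>g\<in>Sn n. \<forall>h\<in>young_subgroup n \<mu>. f (g \<circ> h) = f g}"
      by (auto simp: Sn_comp Y)
  qed (auto simp: Sn_comp Y o_assoc)
qed

lemma young_subgroup_whole: "young_subgroup n [n] = Sn n"
proof -
  have "{0<..n} = {1..n}" by auto
  then have "w ` {0<..n} = {0<..n}" if "w \<in> Sn n" for w
    using that permutes_image[of w "{1..n}"] by (simp add: Sn_def)
  then show ?thesis by (auto simp: young_subgroup_def)
qed

lemma young_subgroup_point:
  assumes "n \<ge> 1"
  shows "young_subgroup n [n - 1, 1] = {w \<in> Sn n. w n = n}"
proof -
  have "w ` {0<..n - 1} = {0<..n - 1} \<longleftrightarrow> w n = n" if w: "w \<in> Sn n" for w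
  proof -
    have b: "bij w" using w by (simp add: Sn_def permutes_bij)
    have "{0<..n} = {1..n}" by auto
    then have im: "w ` {0<..n} = {0<..n}"
      using w permutes_image[of w "{1..n}"] by (simp add: Sn_def)
    have d: "{0<..n - 1} = {0<..n} - {n}" using assms by auto
    have "w ` ({0<..n} - {n}) = {0<..n} - {w n}"
      using image_set_diff[OF bij_is_inj[OF b], of "{0<..n}" "{n}"] im by simp
    moreover have "w n \<in> w ` {0<..n}" by (rule imageI) (use assms in simp)
    then have "{0<..n} - {w n} = {0<..n} - {n} \<longleftrightarrow> w n = n" using im assms by auto
    ultimately show ?thesis unfolding d by simp
  qed
  moreover have "{n - 1<..n} = {n}" using assms by auto
  ultimately show ?thesis
    using assms by (auto simp: young_subgroup_def All_less_Suc)
qed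

lemma carrier_Ind_whole: "carrier (fst (Ind_trivial n [n])) = range (\<lambda>c. \<lambda>x\<in>Sn n. c)"
proof -
  have "f = (\<lambda>x\<in>Sn n. f id)" if f: "f \<in> Sn n \<rightarrow>\<^sub>E UNIV" "\<forall>g\<in>Sn n. \<forall>h\<in>Sn n. f (g \<circ> h) = f g" for f
  proof
    show "f x = (\<lambda>x\<in>Sn n. f id) x" for x
      using f(2)[rule_format, OF Sn_id, of x] PiE_arb[OF f(1), of x] by (simp add: restrict_def)
  qed
  then have "f \<in> range (\<lambda>c. \<lambda>x\<in>Sn n. c)"
    if "f \<in> Sn n \<rightarrow>\<^sub>E UNIV" "\<forall>g\<in>Sn n. \<forall>h\<in>Sn n. f (g \<circ> h) = f g" for f
    using that by (intro range_eqI)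
  then show ?thesis
    unfolding Ind_trivial_eq young_subgroup_whole by (auto simp: fun_rep_def Sn_comp)
qed

text \<open>The coset of \<open>x\<close> modulo the stabiliser of \<open>n\<close> is determined
  by \<open>x n\<close>, and the transposition of \<open>k\<close> and \<open>n\<close> represents
  the coset that belongs to \<open>k\<close>.\<close>

lemma carrier_Ind_point:
  assumes "n \<ge> 1"
  shows "carrier (fst (Ind_trivial n [n - 1, 1])) = range (\<lambda>u. \<lambda>x\<in>Sn n. u (x n))"
proof -
  have "f = (\<lambda>x\<in>Sn n. f (Transposition.transpose (x n) n))"
    if f: "f \<in> Sn n \<rightarrow>\<^sub>E UNIV" "\<forall>g\<in>Sn n. \<forall>h\<in>{w \<in> Sn n. w n = n}. f (g \<circ> h) = f g" for f
  proof
    show "f x = (\<lambda>x\<in>Sn n. f (Transposition.transpose (x n) n)) x" for x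
    proof (cases "x \<in> Sn n")
      case x: True
      let ?t = "Transposition.transpose (x n) n"
      have "x n \<in> {1..n}" using x permutes_in_image[of x "{1..n}" n] assms by (simp add: Sn_def)
      then have t: "?t \<in> Sn n" using assms by (auto simp: Sn_def intro: permutes_swap_id)
      have "?t \<circ> (?t \<circ> x) = x" by (simp add: fun_eq_iff)
      have "?t \<circ> x \<in> {w \<in> Sn n. w n = n}" using Sn_comp[OF t x] by simp
      from f(2)[THEN bspec, OF t, THEN bspec, OF this]
      have "f (?t \<circ> (?t \<circ> x)) = f ?t" .
      then show ?thesis using x \<open>?t \<circ> (?t \<circ> x) = x\<close> by simp
    qed (use PiE_arb[OF f(1), of x] in simp)
  qed
  then have "f \<in> range (\<lambda>u. \<lambda>x\<in>Sn n. u (x n))"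
    if "f \<in> Sn n \<rightarrow>\<^sub>E UNIV" "\<forall>g\<in>Sn n. \<forall>h\<in>{w \<in> Sn n. w n = n}. f (g \<circ> h) = f g" for f
    using that by (intro range_eqI[where x = "\<lambda>k. f (Transposition.transpose k n)"])
  then show ?thesis
    unfolding Ind_trivial_eq young_subgroup_point[OF assms] by (auto simp: fun_rep_def Sn_comp)
qed

text \<open>The way in which \<open>\<SS>\<^sub>n\<close> permutes a basis of the cohomology: some
  elements are invariant, the others come in families that are indexed by the possible values of
  \<open>w 1\<close>.\<close>

fun basis_perm :: "(nat \<Rightarrow> nat) \<Rightarrow> 'd + nat \<times> 'e \<Rightarrow> 'd + nat \<times> 'e" where
  "basis_perm v (Inl d) = Inl d"
| "basis_perm v (Inr (k, e)) = Inr (v k, e)"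

lemma basis_perm_comp: "basis_perm v (basis_perm u b) = basis_perm (v \<circ> u) b"
  by (cases b) auto

lemma basis_perm_id: "basis_perm id b = b"
  by (cases b) auto

lemma direct_sum_simps:
  "carrier (fst (direct_sum Rs)) = (\<Pi>\<^sub>E i\<in>{..<length Rs}. carrier (fst (Rs ! i)))"
  "\<zero>\<^bsub>fst (direct_sum Rs)\<^esub> = (\<lambda>i\<in>{..<length Rs}. \<zero>\<^bsub>fst (Rs ! i)\<^esub>)"
  "f \<oplus>\<^bsub>fst (direct_sum Rs)\<^esub> f' = (\<lambda>i\<in>{..<length Rs}. f i \<oplus>\<^bsub>fst (Rs ! i)\<^esub> f' i)"
  "c \<odot>\<^bsub>fst (direct_sum Rs)\<^esub> f = (\<lambda>i\<in>{..<length Rs}. c \<odot>\<^bsub>fst (Rs ! i)\<^esub> f i)"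
  "snd (direct_sum Rs) g f = (\<lambda>i\<in>{..<length Rs}. snd (Rs ! i) g (f i))"
  by (simp_all add: direct_sum_def)

lemma Ind_trivial_simps:
  "f \<oplus>\<^bsub>fst (Ind_trivial n \<mu>)\<^esub> f' = (\<lambda>x\<in>Sn n. f x + f' x)"
  "c \<odot>\<^bsub>fst (Ind_trivial n \<mu>)\<^esub> f = (\<lambda>x\<in>Sn n. c * f x)"
  "snd (Ind_trivial n \<mu>) g f = (\<lambda>x\<in>Sn n. f (Hilbert_Choice.inv g \<circ> x))"
  unfolding Ind_trivial_eq by (simp_all only: fun_rep_simps)

text \<open>The orbits are the points of \<open>D\<close>, with stabiliser
  \<open>\<SS>\<^sub>n\<close>, and the sets \<open>{1..n} \<times> {e}\<close>, in which
  \<open>(n, e)\<close> has the stabiliser \<open>\<SS>\<^bsub>n-1\<^esub> \<times>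
  \<SS>\<^sub>1\<close>. A function on \<open>X\<close> therefore corresponds to a family of
  functions on \<open>\<SS>\<^sub>n\<close>: a constant one for each point of \<open>D\<close>,
  and one that depends on \<open>x n\<close> only for each \<open>e\<close>.\<close>

lemma perm_rep_iso_direct_sum:
  fixes D :: "'d set" and E :: "'e set"
  assumes n: "n \<ge> 1" and fin: "finite D" "finite E"
  defines "X \<equiv> D <+> ({1..n} \<times> E)"
    and "L \<equiv> replicate (card D) [n] @ replicate (card E) [n - 1, 1]"
  shows "rep_iso n (perm_rep X basis_perm) (direct_sum (map (Ind_trivial n) L))"
proof -
  let ?W = "direct_sum (map (Ind_trivial n) L)" and ?N = "card D" and ?M = "card E"
  obtain f where "bij_betw f {0..<?N} D" using ex_bij_betw_nat_finite[OF fin(1)] by (rule exE)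
  then have f: "bij_betw f {..<?N} D" by (simp add: atLeast0LessThan)
  obtain e where "bij_betw e {0..<?M} E" using ex_bij_betw_nat_finite[OF fin(2)] by (rule exE)
  then have e: "bij_betw e {..<?M} E" by (simp add: atLeast0LessThan)
  define \<Phi> where "\<Phi> \<kappa> = (\<lambda>i\<in>{..<?N + ?M}. \<lambda>x\<in>Sn n. if i < ?N then \<kappa> (Inl (f i)) else \<kappa> (Inr (x n, e (i - ?N))))"
    for \<kappa> :: "'d + nat \<times> 'e \<Rightarrow> complex"
  have len: "length (map (Ind_trivial n) L) = ?N + ?M" by (simp add: L_def)
  have nth: "map (Ind_trivial n) L ! i = Ind_trivial n (if i < ?N then [n] else [n - 1, 1])"
    if "i < ?N + ?M" for i
    using that by (simp add: L_def nth_append)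
  have point: "x n \<in> {1..n}" if "x \<in> Sn n" for x
    by (rule Sn_mem[OF that]) (use n in simp)
  have fD: "f i \<in> D" if "i < ?N" for i
    by (rule bij_betw_apply[OF f]) (use that in auto)
  have eE: "e (i - ?N) \<in> E" if "i < ?N + ?M" "\<not> i < ?N" for i
    by (rule bij_betw_apply[OF e]) (use that in auto)
  have perm_X: "basis_perm g b \<in> X" if g: "g \<in> Sn n" and b: "b \<in> X" for g b
    using Sn_mem[OF g] b unfolding X_def by (cases b) auto
  have inX: "Inl (f i) \<in> X" if "i < ?N" for i using fD[OF that] by (auto simp: X_def)
  have inX': "Inr (k, e (i - ?N)) \<in> X" if "i < ?N + ?M" "\<not> i < ?N" "k \<in> {1..n}" for i k
    using eE[OF that(1,2)] that(3) by (auto simp: X_def)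
  have inXp: "Inr (x n, e (i - ?N)) \<in> X" if "i < ?N + ?M" "\<not> i < ?N" "x \<in> Sn n" for i x
    by (rule inX'[OF that(1,2) point[OF that(3)]])
  let ?R1 = "range (\<lambda>c. \<lambda>x\<in>Sn n. c)" and ?R2 = "range (\<lambda>u. \<lambda>x\<in>Sn n. u (x n))"
  have carr: "carrier (fst ?W) = (\<Pi>\<^sub>E i\<in>{..<?N + ?M}. if i < ?N then ?R1 else ?R2)"
    unfolding direct_sum_simps len
  proof (rule PiE_cong)
    fix i assume "i \<in> {..<?N + ?M}"
    then show "carrier (fst (map (Ind_trivial n) L ! i)) = (if i < ?N then ?R1 else ?R2)"
      by (cases "i < ?N") (simp_all only: nth lessThan_iff if_True if_False carrier_Ind_whole
        carrier_Ind_point[OF n])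
  qed
  have carrW: "F \<in> carrier (fst ?W)" if "F \<in> extensional {..<?N + ?M}"
    and R: "\<And>i. i < ?N \<Longrightarrow> F i \<in> ?R1" "\<And>i. i < ?N + ?M \<Longrightarrow> \<not> i < ?N \<Longrightarrow> F i \<in> ?R2" for F
    unfolding carr PiE_iff
  proof (intro conjI ballI that(1))
    show "F i \<in> (if i < ?N then ?R1 else ?R2)" if "i \<in> {..<?N + ?M}" for i
      using R[of i] that by (cases "i < ?N") (simp_all only: if_True if_False lessThan_iff not_False_eq_True simp_thms)
  qed
  have memW: "F i \<in> (if i < ?N then ?R1 else ?R2)" if "F \<in> carrier (fst ?W)" "i < ?N + ?M" for F i
    using PiE_mem[OF that(1)[unfolded carr], of i] that(2) by (simp only: lessThan_iff)
  have W1: "\<exists>c. F i = (\<lambda>x\<in>Sn n. c)" if "F \<in> carrier (fst ?W)" "i < ?N" for F i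
    using memW[OF that(1), of i] that(2) by (simp add: image_iff)
  have W2: "\<exists>u. F i = (\<lambda>x\<in>Sn n. u (x n))" if "F \<in> carrier (fst ?W)" "i < ?N + ?M" "\<not> i < ?N" for F i
    using memW[OF that(1,2)] that(3) by (simp add: image_iff)
  show ?thesis
  proof (rule rep_isoI[where \<phi> = \<Phi>])
    show "is_rep n (perm_rep X basis_perm)"
      by (rule is_rep_perm_rep) (auto simp: perm_X basis_perm_id basis_perm_comp)
    show "is_rep n ?W"
      by (rule is_rep_direct_sum) (auto simp: is_rep_Ind_trivial)
    show "bij_betw \<Phi> (carrier (fst (perm_rep X basis_perm))) (carrier (fst ?W))"
      unfolding bij_betw_def perm_rep_def fun_rep_simps
    proof
      show "inj_on \<Phi> (X \<rightarrow>\<^sub>E UNIV)"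
      proof (rule inj_onI)
        fix \<kappa> \<kappa>' assume \<kappa>: "\<kappa> \<in> X \<rightarrow>\<^sub>E UNIV" "\<kappa>' \<in> X \<rightarrow>\<^sub>E UNIV" and eq: "\<Phi> \<kappa> = \<Phi> \<kappa>'"
        show "\<kappa> = \<kappa>'"
        proof (rule PiE_ext[OF \<kappa>])
          fix b assume b: "b \<in> X"
          show "\<kappa> b = \<kappa>' b"
          proof (cases b)
            case (Inl d)
            then have "d \<in> f ` {..<?N}" using b f by (auto simp: X_def bij_betw_def)
            then obtain i where i: "i < ?N" "d = f i" by auto
            have "\<Phi> \<kappa> i id = \<Phi> \<kappa>' i id" using eq by simp
            then show ?thesis using i Inl by (simp add: \<Phi>_def Sn_id)
          next
            case (Inr p)
            then obtain k y where p: "b = Inr (k, y)" "k \<in> {1..n}" "y \<in> E" using b by (auto simp: X_def)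
            then have "y \<in> e ` {..<?M}" using e by (auto simp: bij_betw_def)
            then obtain i where i: "i < ?M" "y = e i" by auto
            have t: "Transposition.transpose k n \<in> Sn n" using p n by (intro Sn_transpose) auto
            have "\<Phi> \<kappa> (?N + i) (Transposition.transpose k n) = \<Phi> \<kappa>' (?N + i) (Transposition.transpose k n)"
              using eq by simp
            then show ?thesis using i p t by (simp add: \<Phi>_def)
          qed
        qed
      qed
      show "\<Phi> ` (X \<rightarrow>\<^sub>E UNIV) = carrier (fst ?W)"
      proof (intro equalityI subsetI)
        fix F assume "F \<in> \<Phi> ` (X \<rightarrow>\<^sub>E UNIV)"
        then obtain \<kappa> where F: "F = \<Phi> \<kappa>" by auto
        show "F \<in> carrier (fst ?W)"
        proof (rule carrW)
          show "F \<in> extensional {..<?N + ?M}" by (simp add: F \<Phi>_def)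
          show "F i \<in> range (\<lambda>c. \<lambda>x\<in>Sn n. c)" if "i < ?N" for i
            using that by (intro range_eqI[where x = "\<kappa> (Inl (f i))"]) (simp add: F \<Phi>_def)
          show "F i \<in> range (\<lambda>u. \<lambda>x\<in>Sn n. u (x n))" if "i < ?N + ?M" "\<not> i < ?N" for i
            using that by (intro range_eqI[where x = "\<lambda>k. \<kappa> (Inr (k, e (i - ?N)))"]) (simp add: F \<Phi>_def)
        qed
      next
        \<comment> \<open>The values of a component are read off at the identity or at coset
          representatives.\<close>
        fix F assume F: "F \<in> carrier (fst ?W)"
        define \<kappa> where "\<kappa> = (\<lambda>b\<in>X. case b of Inl d \<Rightarrow> F (inv_into {..<?N} f d) id
          | Inr (k, y) \<Rightarrow> F (?N + inv_into {..<?M} e y) (Transposition.transpose k n))"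
        have "F = \<Phi> \<kappa>"
        proof
          fix i
          consider "i < ?N" | "i < ?N + ?M" "\<not> i < ?N" | "\<not> i < ?N + ?M" by linarith
          then show "F i = \<Phi> \<kappa> i"
          proof cases
            case 1
            then obtain c where c: "F i = (\<lambda>x\<in>Sn n. c)" using W1[OF F 1] by (elim exE)
            have "\<kappa> (Inl (f i)) = c"
              using 1 c bij_betw_inv_into_left[OF f] inX by (simp add: \<kappa>_def Sn_id)
            then show ?thesis using 1 c by (simp add: \<Phi>_def)
          next
            case 2
            then obtain u where u: "F i = (\<lambda>x\<in>Sn n. u (x n))" using W2[OF F 2] by (elim exE)
            have t: "Transposition.transpose k n \<in> Sn n" if "k \<in> {1..n}" for k
              using that n by (intro Sn_transpose) auto
            have iN: "?N + inv_into {..<?M} e (e (i - ?N)) = i"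
              using 2 bij_betw_inv_into_left[OF e, of "i - ?N"] by simp
            have "\<kappa> (Inr (k, e (i - ?N))) = u k" if "k \<in> {1..n}" for k
              using inX'[OF 2 that] t[OF that] unfolding \<kappa>_def by (simp add: iN u)
            then show ?thesis using 2 u point by (auto simp: \<Phi>_def fun_eq_iff restrict_def)
          next
            case 3
            then show ?thesis
              using F PiE_arb[of F _ _ i] unfolding direct_sum_simps len by (simp add: \<Phi>_def)
          qed
        qed
        moreover have "\<kappa> \<in> X \<rightarrow>\<^sub>E UNIV" by (simp add: \<kappa>_def)
        ultimately show "F \<in> \<Phi> ` (X \<rightarrow>\<^sub>E UNIV)" by (rule image_eqI)
      qed
    qed
  next
    fix \<kappa> \<kappa>' :: "'d + nat \<times> 'e \<Rightarrow> complex" and c g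
    show "\<Phi> (\<kappa> \<oplus>\<^bsub>fst (perm_rep X basis_perm)\<^esub> \<kappa>') = \<Phi> \<kappa> \<oplus>\<^bsub>fst ?W\<^esub> \<Phi> \<kappa>'"
      unfolding perm_rep_def fun_rep_simps direct_sum_simps len \<Phi>_def
      by (intro restrict_ext, simp add: nth Ind_trivial_simps, intro restrict_ext)
        (simp add: inX inXp)
    show "\<Phi> (c \<odot>\<^bsub>fst (perm_rep X basis_perm)\<^esub> \<kappa>) = c \<odot>\<^bsub>fst ?W\<^esub> \<Phi> \<kappa>"
      unfolding perm_rep_def fun_rep_simps direct_sum_simps len \<Phi>_def
      by (intro restrict_ext, simp add: nth Ind_trivial_simps, intro restrict_ext)
        (simp add: inX inXp)
    assume g: "g \<in> Sn n"
    have "Hilbert_Choice.inv g (x n) = (Hilbert_Choice.inv g \<circ> x) n" for x by simp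
    show "\<Phi> (snd (perm_rep X basis_perm) g \<kappa>) = snd ?W g (\<Phi> \<kappa>)"
      unfolding perm_rep_def fun_rep_simps direct_sum_simps len \<Phi>_def
      by (intro restrict_ext, simp add: nth Ind_trivial_simps, intro restrict_ext)
        (simp add: inX inXp Sn_comp Sn_inv[OF g])
  qed
qed

section \<open>Classes in the representation ring\<close>

definition mat_module :: "mat_rep \<Rightarrow> complex vec rep" where
  "mat_module \<rho> = (module_vec TYPE(complex) (fst \<rho>), \<lambda>g x. snd \<rho> g *\<^sub>v x)"

text \<open>The class of a representation is defined through an arbitrary choice of a matrix form.
  Naming the matrix representation makes it possible to compute with explicit matrices instead.\<close>

definition has_form :: "nat \<Rightarrow> mat_rep \<Rightarrow> 'a rep \<Rightarrow> bool" where
  "has_form n \<rho> R \<longleftrightarrow> is_mat_rep n \<rho> \<and> rep_iso n (mat_module \<rho>) R"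

lemma mat_module_simps:
  "carrier (fst (mat_module \<rho>)) = carrier_vec (fst \<rho>)"
  "\<zero>\<^bsub>fst (mat_module \<rho>)\<^esub> = 0\<^sub>v (fst \<rho>)"
  "x \<oplus>\<^bsub>fst (mat_module \<rho>)\<^esub> y = x + y"
  "c \<odot>\<^bsub>fst (mat_module \<rho>)\<^esub> x = c \<cdot>\<^sub>v x"
  "snd (mat_module \<rho>) g x = snd \<rho> g *\<^sub>v x"
  by (simp_all add: mat_module_def module_vec_def)

lemma is_mat_repD:
  assumes "is_mat_rep n \<rho>"
  shows "g \<in> Sn n \<Longrightarrow> snd \<rho> g \<in> carrier_mat (fst \<rho>) (fst \<rho>)" "snd \<rho> id = 1\<^sub>m (fst \<rho>)"
    "g \<in> Sn n \<Longrightarrow> u \<in> Sn n \<Longrightarrow> snd \<rho> (g \<circ> u) = snd \<rho> g * snd \<rho> u"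
  using assms by (auto simp: is_mat_rep_def)

lemma is_rep_mat_module:
  assumes "is_mat_rep n \<rho>"
  shows "is_rep n (mat_module \<rho>)"
proof -
  note \<rho> = is_mat_repD[OF assms]
  let ?d = "fst \<rho>"
  have "representation n (fst (mat_module \<rho>)) (snd (mat_module \<rho>))"
  proof (unfold_locales, unfold mat_module_simps)
    fix x y z :: "complex vec" and c d g u
    assume x: "x \<in> carrier_vec ?d"
    show "0\<^sub>v ?d + x = x" "x + (-1) \<cdot>\<^sub>v x = 0\<^sub>v ?d" "1 \<cdot>\<^sub>v x = x"
      "(c + d) \<cdot>\<^sub>v x = c \<cdot>\<^sub>v x + d \<cdot>\<^sub>v x" "(c * d) \<cdot>\<^sub>v x = c \<cdot>\<^sub>v (d \<cdot>\<^sub>v x)" "snd \<rho> id *\<^sub>v x = x"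
      "c \<cdot>\<^sub>v x \<in> carrier_vec ?d"
      using x \<rho>(2) by (auto simp: algebra_simps)
    show "x + y = y + x" if "y \<in> carrier_vec ?d" using x that by (rule comm_add_vec)
    show "x + y + z = x + (y + z)" if "y \<in> carrier_vec ?d" "z \<in> carrier_vec ?d"
      using x that by (rule assoc_add_vec)
    show "c \<cdot>\<^sub>v (x + y) = c \<cdot>\<^sub>v x + c \<cdot>\<^sub>v y" if "y \<in> carrier_vec ?d"
      using x that by (rule smult_add_distrib_vec)
    show "x + y \<in> carrier_vec ?d" if "y \<in> carrier_vec ?d" using x that by (rule add_carrier_vec)
    assume g: "g \<in> Sn n"
    show "snd \<rho> g *\<^sub>v x \<in> carrier_vec ?d" using \<rho>(1)[OF g] x by (rule mult_mat_vec_carrier)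
    show "snd \<rho> g *\<^sub>v (x + y) = snd \<rho> g *\<^sub>v x + snd \<rho> g *\<^sub>v y" if "y \<in> carrier_vec ?d"
      using \<rho>(1)[OF g] x that by (rule mult_add_distrib_mat_vec)
    show "snd \<rho> g *\<^sub>v (c \<cdot>\<^sub>v x) = c \<cdot>\<^sub>v (snd \<rho> g *\<^sub>v x)"
      using \<rho>(1)[OF g] x by (rule mult_mat_vec)
    show "snd \<rho> (g \<circ> u) *\<^sub>v x = snd \<rho> g *\<^sub>v (snd \<rho> u *\<^sub>v x)" if u: "u \<in> Sn n"
      unfolding \<rho>(3)[OF g u] using \<rho>(1)[OF g] \<rho>(1)[OF u] x by (rule assoc_mult_mat_vec)
  qed (rule zero_carrier_vec)
  then show ?thesis by (simp flip: is_rep_iff)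
qed

lemma mat_mult_unit_vec:
  fixes A :: "complex mat"
  assumes "A \<in> carrier_mat e d" "k < d"
  shows "A *\<^sub>v unit_vec d k = col A k"
  using assms by (intro eq_vecI) auto

text \<open>The columns are the images of the unit vectors. Additivity is applied one coordinate
  at a time, to the truncations of a vector to its first \<open>k\<close> coordinates.\<close>

lemma linear_map_matrix:
  fixes \<phi> :: "complex vec \<Rightarrow> complex vec"
  assumes closed: "\<And>x. x \<in> carrier_vec d \<Longrightarrow> \<phi> x \<in> carrier_vec e"
    and add: "\<And>x y. x \<in> carrier_vec d \<Longrightarrow> y \<in> carrier_vec d \<Longrightarrow> \<phi> (x + y) = \<phi> x + \<phi> y"
    and smult: "\<And>c x. x \<in> carrier_vec d \<Longrightarrow> \<phi> (c \<cdot>\<^sub>v x) = c \<cdot>\<^sub>v \<phi> x"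
  shows "\<exists>A\<in>carrier_mat e d. \<forall>x\<in>carrier_vec d. \<phi> x = A *\<^sub>v x"
proof -
  define A where "A = mat e d (\<lambda>(i, j). \<phi> (unit_vec d j) $ i)"
  have A: "A \<in> carrier_mat e d" by (simp add: A_def)
  have "\<phi> (vec d (\<lambda>j. if j < k then x $ j else 0)) = A *\<^sub>v vec d (\<lambda>j. if j < k then x $ j else 0)"
    if "x \<in> carrier_vec d" "k \<le> d" for x k
    using that(2)
  proof (induction k)
    case 0
    have z: "vec d (\<lambda>j. if j < 0 then x $ j else 0) = 0 \<cdot>\<^sub>v 0\<^sub>v d" by auto
    have "\<phi> (0 \<cdot>\<^sub>v 0\<^sub>v d) = 0 \<cdot>\<^sub>v \<phi> (0\<^sub>v d)" by (rule smult) simp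
    also have "\<dots> = 0\<^sub>v e" using closed[of "0\<^sub>v d"] by auto
    also have "\<dots> = A *\<^sub>v (0 \<cdot>\<^sub>v 0\<^sub>v d)" using A by (intro eq_vecI) auto
    finally show ?case unfolding z .
  next
    case (Suc k)
    let ?v = "vec d (\<lambda>j. if j < k then x $ j else 0)"
    have s: "vec d (\<lambda>j. if j < Suc k then x $ j else 0) = ?v + x $ k \<cdot>\<^sub>v unit_vec d k"
      using Suc.prems by (intro eq_vecI) (auto simp: unit_vec_def less_Suc_eq)
    have "\<phi> (?v + x $ k \<cdot>\<^sub>v unit_vec d k) = \<phi> ?v + x $ k \<cdot>\<^sub>v \<phi> (unit_vec d k)"
      by (subst add) (simp_all add: smult)
    also have "\<phi> (unit_vec d k) = col A k"
      using Suc.prems closed[of "unit_vec d k"] by (intro eq_vecI) (auto simp: A_def)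
    also have "col A k = A *\<^sub>v unit_vec d k"
      using Suc.prems A by (simp add: mat_mult_unit_vec)
    also have "\<phi> ?v + x $ k \<cdot>\<^sub>v (A *\<^sub>v unit_vec d k) = A *\<^sub>v (?v + x $ k \<cdot>\<^sub>v unit_vec d k)"
      using Suc.IH Suc.prems A
      by (subst mult_add_distrib_mat_vec[OF A]) (simp_all add: mult_mat_vec[OF A])
    finally show ?case unfolding s .
  qed
  from this[of _ d] have "\<phi> x = A *\<^sub>v x" if "x \<in> carrier_vec d" for x
  proof -
    have "vec d (\<lambda>j. if j < d then x $ j else 0) = x" using that by (intro eq_vecI) auto
    then show ?thesis using \<open>\<And>x. x \<in> carrier_vec d \<Longrightarrow> d \<le> d \<Longrightarrow> _\<close>[OF that] by simp
  qed
  then show ?thesis using A by blast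
qed

text \<open>The trace of \<open>A * B\<close> is \<open>e\<close> and the trace of \<open>B *
  A\<close> is \<open>d\<close>; the two traces are equal.\<close>

lemma two_sided_inverse_dim:
  fixes A B :: "complex mat"
  assumes A: "A \<in> carrier_mat e d" and B: "B \<in> carrier_mat d e"
    and AB: "A * B = 1\<^sub>m e" and BA: "B * A = 1\<^sub>m d"
  shows "d = e"
proof -
  have "of_nat e = (\<Sum>i<e. (A * B) $$ (i, i))" by (simp add: AB)
  also have "\<dots> = (\<Sum>i<e. \<Sum>j<d. A $$ (i, j) * B $$ (j, i))"
    using A B by (intro sum.cong refl) (simp add: scalar_prod_def atLeast0LessThan)
  also have "\<dots> = (\<Sum>j<d. \<Sum>i<e. B $$ (j, i) * A $$ (i, j))"
    by (subst sum.swap) (simp add: mult.commute)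
  also have "\<dots> = (\<Sum>j<d. (B * A) $$ (j, j))"
    using A B by (intro sum.cong refl) (simp add: scalar_prod_def atLeast0LessThan)
  also have "\<dots> = of_nat d" by (simp add: BA)
  finally show ?thesis by (simp only: of_nat_eq_iff)
qed

lemma mat_vec_ext:
  fixes A B :: "complex mat"
  assumes A: "A \<in> carrier_mat e d" and B: "B \<in> carrier_mat e d"
    and eq: "\<And>x. x \<in> carrier_vec d \<Longrightarrow> A *\<^sub>v x = B *\<^sub>v x"
  shows "A = B"
proof (rule eq_matI)
  fix i j assume ij: "i < dim_row B" "j < dim_col B"
  then have "col A j = col B j"
    using eq[of "unit_vec d j"] A B by (simp add: mat_mult_unit_vec[OF A] mat_mult_unit_vec[OF B])
  then show "A $$ (i, j) = B $$ (i, j)" using ij A B by (metis carrier_matD index_col)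
qed (use A B in auto)

text \<open>The isomorphism and its inverse are given by matrices. These are inverse to each
  other, hence square by the preceding trace argument, which is what equivalence of matrix
  representations asks for.\<close>

lemma mat_rep_equiv_if_iso:
  assumes \<rho>: "is_mat_rep n \<rho>" and \<sigma>: "is_mat_rep n \<sigma>" and iso: "rep_iso n (mat_module \<rho>) (mat_module \<sigma>)"
  shows "mat_rep_equiv n \<rho> \<sigma>"
proof -
  let ?d = "fst \<rho>" and ?e = "fst \<sigma>"
  have ex: "\<exists>A\<in>carrier_mat (fst \<sigma>) (fst \<rho>). bij_betw (\<lambda>x. A *\<^sub>v x) (carrier_vec (fst \<rho>)) (carrier_vec (fst \<sigma>)) \<and>
      (\<forall>g\<in>Sn n. A * snd \<rho> g = snd \<sigma> g * A)"
  proof -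
    obtain \<phi> where "intertwiner n (mat_module \<rho>) (mat_module \<sigma>) \<phi>" using iso by (auto simp: rep_iso_iff)
    note \<phi> = intertwinerD[OF this, unfolded mat_module_simps]
    have cl: "\<phi> x \<in> carrier_vec ?e" if "x \<in> carrier_vec ?d" for x
      using bij_betw_apply[OF \<phi>(1) that] .
    obtain A where A: "A \<in> carrier_mat ?e ?d" "\<forall>x\<in>carrier_vec ?d. \<phi> x = A *\<^sub>v x"
      using linear_map_matrix[of ?d \<phi> ?e, OF cl \<phi>(2,3)] by blast
    have "bij_betw (\<lambda>x. A *\<^sub>v x) (carrier_vec ?d) (carrier_vec ?e)"
      using \<phi>(1) A(2) by (subst bij_betw_cong[where g = \<phi>]) auto
    moreover have "A * snd \<rho> g = snd \<sigma> g * A" if g: "g \<in> Sn n" for g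
    proof (rule mat_vec_ext[of _ ?e ?d])
      note G = is_mat_repD(1)[OF \<rho> g] and G' = is_mat_repD(1)[OF \<sigma> g]
      show "A * snd \<rho> g \<in> carrier_mat ?e ?d" "snd \<sigma> g * A \<in> carrier_mat ?e ?d"
        using A(1) G G' by auto
      fix x :: "complex vec" assume x: "x \<in> carrier_vec ?d"
      have "A * snd \<rho> g *\<^sub>v x = A *\<^sub>v (snd \<rho> g *\<^sub>v x)" using A(1) G x by (rule assoc_mult_mat_vec)
      also have "\<dots> = \<phi> (snd \<rho> g *\<^sub>v x)" using A(2) G x by (simp add: mult_mat_vec_carrier[OF G])
      also have "\<dots> = snd \<sigma> g *\<^sub>v \<phi> x" using g x by (rule \<phi>(4))
      also have "\<dots> = snd \<sigma> g *\<^sub>v (A *\<^sub>v x)" using A(2) x by simp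
      also have "\<dots> = snd \<sigma> g * A *\<^sub>v x" using G' A(1) x by (rule assoc_mult_mat_vec[symmetric])
      finally show "A * snd \<rho> g *\<^sub>v x = snd \<sigma> g * A *\<^sub>v x" .
    qed
    ultimately show ?thesis using A(1) by blast
  qed
  then obtain A where A: "A \<in> carrier_mat ?e ?d" and bij: "bij_betw (\<lambda>x. A *\<^sub>v x) (carrier_vec ?d) (carrier_vec ?e)"
    and eqv: "\<forall>g\<in>Sn n. A * snd \<rho> g = snd \<sigma> g * A" by blast
  let ?\<psi> = "inv_into (carrier_vec ?d) (\<lambda>x. A *\<^sub>v x)"
  have \<psi>: "?\<psi> y \<in> carrier_vec ?d" "A *\<^sub>v ?\<psi> y = y" if "y \<in> carrier_vec ?e" for y
    using bij_betw_apply[OF bij_betw_inv_into[OF bij] that] bij_betw_inv_into_right[OF bij that] by auto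
  have \<psi>A: "?\<psi> (A *\<^sub>v x) = x" if "x \<in> carrier_vec ?d" for x
    using bij_betw_inv_into_left[OF bij that] .
  have "\<exists>B\<in>carrier_mat ?d ?e. \<forall>y\<in>carrier_vec ?e. ?\<psi> y = B *\<^sub>v y"
  proof (rule linear_map_matrix)
    fix x y :: "complex vec" and c assume x: "x \<in> carrier_vec ?e"
    show "?\<psi> x \<in> carrier_vec ?d" by (rule \<psi>(1)[OF x])
    have "A *\<^sub>v (c \<cdot>\<^sub>v ?\<psi> x) = c \<cdot>\<^sub>v x" using \<psi>[OF x] A by (simp add: mult_mat_vec[OF A])
    then show "?\<psi> (c \<cdot>\<^sub>v x) = c \<cdot>\<^sub>v ?\<psi> x" using \<psi>A[of "c \<cdot>\<^sub>v ?\<psi> x"] \<psi>(1)[OF x] by simp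
    assume y: "y \<in> carrier_vec ?e"
    have "A *\<^sub>v (?\<psi> x + ?\<psi> y) = x + y"
      using \<psi>[OF x] \<psi>[OF y] by (simp add: mult_add_distrib_mat_vec[OF A])
    then show "?\<psi> (x + y) = ?\<psi> x + ?\<psi> y"
      using \<psi>A[of "?\<psi> x + ?\<psi> y"] \<psi>(1)[OF x] \<psi>(1)[OF y] by simp
  qed
  then obtain B where B: "B \<in> carrier_mat ?d ?e" "\<forall>y\<in>carrier_vec ?e. ?\<psi> y = B *\<^sub>v y" by blast
  have AB: "A * B = 1\<^sub>m ?e"
  proof (rule mat_vec_ext[of _ ?e ?e])
    fix x :: "complex vec" assume x: "x \<in> carrier_vec ?e"
    then show "A * B *\<^sub>v x = 1\<^sub>m ?e *\<^sub>v x"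
      using \<psi>(2)[OF x] B(2) by (simp add: assoc_mult_mat_vec[OF A B(1)])
  qed (use A B(1) in auto)
  have BA: "B * A = 1\<^sub>m ?d"
  proof (rule mat_vec_ext[of _ ?d ?d])
    fix x :: "complex vec" assume x: "x \<in> carrier_vec ?d"
    then show "B * A *\<^sub>v x = 1\<^sub>m ?d *\<^sub>v x"
      using \<psi>A[OF x] B(2) mult_mat_vec_carrier[OF A x] by (simp add: assoc_mult_mat_vec[OF B(1) A])
  qed (use A B(1) in auto)
  have de: "?d = ?e" by (rule two_sided_inverse_dim[OF A B(1) AB BA])
  have "invertible_mat A"
    unfolding invertible_mat_def inverts_mat_def
    using A B(1) AB BA de by (auto intro!: exI[of _ B])
  then show ?thesis
    unfolding mat_rep_equiv_def using A eqv de by auto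
qed

lemma has_form_trivial: "has_form n (1, \<lambda>g. 1\<^sub>m 1) (Ind_trivial n [n])"
proof -
  let ?\<rho> = "(1, \<lambda>g. 1\<^sub>m 1) :: mat_rep"
  let ?\<phi> = "\<lambda>v :: complex vec. \<lambda>x\<in>Sn n. v $ 0"
  have \<rho>: "is_mat_rep n ?\<rho>" by (simp add: is_mat_rep_def)
  have "rep_iso n (mat_module ?\<rho>) (Ind_trivial n [n])"
  proof (rule rep_isoI[where \<phi> = ?\<phi>])
    show "bij_betw ?\<phi> (carrier (fst (mat_module ?\<rho>))) (carrier (fst (Ind_trivial n [n])))"
      unfolding mat_module_simps carrier_Ind_whole bij_betw_def
    proof
      show "inj_on ?\<phi> (carrier_vec (fst ?\<rho>))"
      proof (rule inj_onI)
        fix v w :: "complex vec" assume v: "v \<in> carrier_vec (fst ?\<rho>)" "w \<in> carrier_vec (fst ?\<rho>)"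
          and eq: "(\<lambda>x\<in>Sn n. v $ 0) = (\<lambda>x\<in>Sn n. w $ 0)"
        have "v $ 0 = w $ 0" using fun_cong[OF eq, of id] by (simp add: Sn_id)
        then show "v = w" using v by (intro eq_vecI) auto
      qed
      show "?\<phi> ` carrier_vec (fst ?\<rho>) = range (\<lambda>c. \<lambda>x\<in>Sn n. c)"
      proof (intro equalityI subsetI)
        fix F :: "(nat \<Rightarrow> nat) \<Rightarrow> complex" assume "F \<in> range (\<lambda>c. \<lambda>x\<in>Sn n. c)"
        then obtain c where "F = (\<lambda>x\<in>Sn n. c)" by auto
        then show "F \<in> ?\<phi> ` carrier_vec (fst ?\<rho>)"
          by (intro image_eqI[where x = "vec 1 (\<lambda>_. c)"]) simp_all
      qed auto
    qed
  qed (use \<rho> in \<open>auto simp: is_rep_mat_module is_rep_Ind_trivial mat_module_simps Ind_trivial_simps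
      Sn_comp Sn_inv intro!: restrict_ext\<close>)
  with \<rho> show ?thesis by (simp add: has_form_def)
qed

text \<open>Matrices are indexed from \<open>0\<close> and the permuted points from
  \<open>1\<close>, which accounts for the successors.\<close>

definition perm_matrix :: "nat \<Rightarrow> (nat \<Rightarrow> nat) \<Rightarrow> complex mat" where
  "perm_matrix n g = mat n n (\<lambda>(i, j). if Suc i = g (Suc j) then 1 else 0)"

lemma perm_matrix_mult_vec:
  assumes g: "g \<in> Sn n" and v: "v \<in> carrier_vec n"
  shows "perm_matrix n g *\<^sub>v v = vec n (\<lambda>i. v $ (Hilbert_Choice.inv g (Suc i) - 1))"
proof (rule eq_vecI)
  fix i assume "i < dim_vec (vec n (\<lambda>i. v $ (Hilbert_Choice.inv g (Suc i) - 1)))"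
  then have i: "i < n" by simp
  let ?k = "Hilbert_Choice.inv g (Suc i)"
  have k: "?k \<in> {1..n}" using Sn_mem[OF Sn_inv[OF g], of "Suc i"] i by simp
  have gp: "g permutes {1..n}" using g by (simp add: Sn_def)
  have "(perm_matrix n g *\<^sub>v v) $ i = (\<Sum>j<n. (if Suc i = g (Suc j) then 1 else 0) * v $ j)"
    using i v by (simp add: perm_matrix_def scalar_prod_def atLeast0LessThan)
  also have "\<dots> = (\<Sum>j<n. if j = ?k - 1 then v $ j else 0)"
  proof (intro sum.cong refl)
    fix j
    have "Suc i = g (Suc j) \<longleftrightarrow> ?k = Suc j"
      unfolding permutes_inv_eq[OF gp] by (rule eq_commute)
    also have "\<dots> \<longleftrightarrow> j = ?k - 1"
      using k unfolding atLeastAtMost_iff by arith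
    finally show "(if Suc i = g (Suc j) then 1 else 0) * v $ j = (if j = ?k - 1 then v $ j else 0)"
      by (simp only: if_distrib[of "\<lambda>a. a * v $ j"] mult_1_left mult_zero_left)
  qed
  also have "\<dots> = (if ?k - 1 \<in> {..<n} then v $ (?k - 1) else 0)" by (rule sum.delta) simp
  also have "\<dots> = v $ (?k - 1)" using k by auto
  finally show "(perm_matrix n g *\<^sub>v v) $ i = vec n (\<lambda>i. v $ (Hilbert_Choice.inv g (Suc i) - 1)) $ i"
    using i by simp
qed (simp add: perm_matrix_def)

lemma has_form_point:
  assumes n: "n \<ge> 1"
  shows "has_form n (n, perm_matrix n) (Ind_trivial n [n - 1, 1])"
proof -
  let ?\<rho> = "(n, perm_matrix n) :: mat_rep"
  have c: "perm_matrix n g \<in> carrier_mat n n" for g by (simp add: perm_matrix_def)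
  have \<rho>: "is_mat_rep n ?\<rho>"
    unfolding is_mat_rep_def fst_conv snd_conv
  proof (intro conjI ballI c)
    show "perm_matrix n id = 1\<^sub>m n"
      by (intro eq_matI) (auto simp: perm_matrix_def)
    fix g u assume g: "g \<in> Sn n" and u: "u \<in> Sn n"
    show "perm_matrix n (g \<circ> u) = perm_matrix n g * perm_matrix n u"
    proof (rule mat_vec_ext[of _ n n])
      fix x :: "complex vec" assume x: "x \<in> carrier_vec n"
      have y: "perm_matrix n u *\<^sub>v x \<in> carrier_vec n" using c x by (rule mult_mat_vec_carrier)
      have "perm_matrix n (g \<circ> u) *\<^sub>v x = perm_matrix n g *\<^sub>v (perm_matrix n u *\<^sub>v x)"
        unfolding perm_matrix_mult_vec[OF g y] perm_matrix_mult_vec[OF Sn_comp[OF g u] x]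
      proof (rule eq_vecI)
        fix i assume "i < dim_vec (vec n (\<lambda>i. (perm_matrix n u *\<^sub>v x) $ (Hilbert_Choice.inv g (Suc i) - 1)))"
        then have i: "i < n" by simp
        then have k: "Hilbert_Choice.inv g (Suc i) \<in> {1..n}"
          using Sn_mem[OF Sn_inv[OF g], of "Suc i"] by simp
        then show "vec n (\<lambda>i. x $ (Hilbert_Choice.inv (g \<circ> u) (Suc i) - 1)) $ i =
            vec n (\<lambda>i. (perm_matrix n u *\<^sub>v x) $ (Hilbert_Choice.inv g (Suc i) - 1)) $ i"
          using i by (auto simp: perm_matrix_mult_vec[OF u x] Sn_inv_comp[OF g u])
      qed simp
      then show "perm_matrix n (g \<circ> u) *\<^sub>v x = perm_matrix n g * perm_matrix n u *\<^sub>v x"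
        by (simp add: assoc_mult_mat_vec[OF c c x])
    qed (use c mult_carrier_mat[OF c c] in auto)
  qed
  let ?\<phi> = "\<lambda>v :: complex vec. \<lambda>x\<in>Sn n. v $ (x n - 1)"
  have pt: "x n \<in> {1..n}" if "x \<in> Sn n" for x using Sn_mem[OF that, of n] n by simp
  have "rep_iso n (mat_module ?\<rho>) (Ind_trivial n [n - 1, 1])"
  proof (rule rep_isoI[where \<phi> = ?\<phi>])
    show "is_rep n (mat_module ?\<rho>)" by (rule is_rep_mat_module[OF \<rho>])
    show "is_rep n (Ind_trivial n [n - 1, 1])" by (rule is_rep_Ind_trivial)
    show "bij_betw ?\<phi> (carrier (fst (mat_module ?\<rho>))) (carrier (fst (Ind_trivial n [n - 1, 1])))"
      unfolding mat_module_simps carrier_Ind_point[OF n] bij_betw_def fst_conv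
    proof
      show "inj_on ?\<phi> (carrier_vec n)"
      proof (rule inj_onI)
        fix v w :: "complex vec" assume v: "v \<in> carrier_vec n" "w \<in> carrier_vec n" and eq: "?\<phi> v = ?\<phi> w"
        show "v = w"
        proof (rule eq_vecI)
          fix i assume "i < dim_vec w"
          then have "Suc i \<in> {1..n}" using v by simp
          then have "Transposition.transpose (Suc i) n \<in> Sn n"
            using n by (auto simp: Sn_def intro: permutes_swap_id)
          then show "v $ i = w $ i" using fun_cong[OF eq, of "Transposition.transpose (Suc i) n"] by simp
        qed (use v in auto)
      qed
      show "?\<phi> ` carrier_vec n = range (\<lambda>u. \<lambda>x\<in>Sn n. u (x n))"
      proof (intro equalityI subsetI)
        fix F assume "F \<in> ?\<phi> ` carrier_vec n"
        then obtain v where "F = ?\<phi> v" by auto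
        then show "F \<in> range (\<lambda>u. \<lambda>x\<in>Sn n. u (x n))"
          by (intro range_eqI[where x = "\<lambda>k. v $ (k - 1)"])
      next
        fix F :: "(nat \<Rightarrow> nat) \<Rightarrow> complex" assume "F \<in> range (\<lambda>u. \<lambda>x\<in>Sn n. u (x n))"
        then obtain u where F: "F = (\<lambda>x\<in>Sn n. u (x n))" by auto
        have "?\<phi> (vec n (\<lambda>i. u (Suc i))) = F"
          unfolding F
        proof (rule restrict_ext)
          fix x assume "x \<in> Sn n"
          then have "x n \<in> {1..n}" by (rule pt)
          then have "x n - 1 < n" "Suc (x n - 1) = x n" by auto
          then show "vec n (\<lambda>i. u (Suc i)) $ (x n - 1) = u (x n)" by simp
        qed
        then show "F \<in> ?\<phi> ` carrier_vec n" by (intro image_eqI[where x = "vec n (\<lambda>i. u (Suc i))"]) simp_all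
      qed
    qed
  next
    fix v w :: "complex vec" and c g
    assume v: "v \<in> carrier (fst (mat_module ?\<rho>))"
    have lt: "x n - 1 < n" if "x \<in> Sn n" for x using pt[OF that] by auto
    show "?\<phi> (c \<odot>\<^bsub>fst (mat_module ?\<rho>)\<^esub> v) = c \<odot>\<^bsub>fst (Ind_trivial n [n - 1, 1])\<^esub> ?\<phi> v"
      using v lt unfolding mat_module_simps Ind_trivial_simps by (intro restrict_ext) simp
    show "?\<phi> (v \<oplus>\<^bsub>fst (mat_module ?\<rho>)\<^esub> w) = ?\<phi> v \<oplus>\<^bsub>fst (Ind_trivial n [n - 1, 1])\<^esub> ?\<phi> w"
      if "w \<in> carrier (fst (mat_module ?\<rho>))"
      using v that lt unfolding mat_module_simps Ind_trivial_simps by (intro restrict_ext) simp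
    assume g: "g \<in> Sn n"
    show "?\<phi> (snd (mat_module ?\<rho>) g v) = snd (Ind_trivial n [n - 1, 1]) g (?\<phi> v)"
      unfolding mat_module_simps Ind_trivial_simps snd_conv
    proof (rule restrict_ext)
      fix x assume x: "x \<in> Sn n"
      have "Suc (x n - 1) = x n" using pt[OF x] by auto
      moreover have "v \<in> carrier_vec n" using v by (simp only: mat_module_simps fst_conv)
      ultimately show "(perm_matrix n g *\<^sub>v v) $ (x n - 1) = ?\<phi> v (Hilbert_Choice.inv g \<circ> x)"
        using lt[OF x] Sn_comp[OF Sn_inv[OF g] x] by (simp add: perm_matrix_mult_vec[OF g])
    qed
  qed
  with \<rho> show ?thesis by (simp add: has_form_def)
qed

lemma is_mat_rep_sum:
  assumes \<rho>: "is_mat_rep n \<rho>" and \<sigma>: "is_mat_rep n \<sigma>"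
  shows "is_mat_rep n (mat_rep_sum \<rho> \<sigma>)"
  unfolding is_mat_rep_def mat_rep_sum_def fst_conv snd_conv
proof (intro conjI ballI)
  fix g assume g: "g \<in> Sn n"
  note G = is_mat_repD(1)[OF \<rho> g] is_mat_repD(1)[OF \<sigma> g]
  show "four_block_mat (snd \<rho> g) (0\<^sub>m (fst \<rho>) (fst \<sigma>)) (0\<^sub>m (fst \<sigma>) (fst \<rho>)) (snd \<sigma> g)
      \<in> carrier_mat (fst \<rho> + fst \<sigma>) (fst \<rho> + fst \<sigma>)"
    using G by (rule four_block_carrier_mat)
  fix u assume u: "u \<in> Sn n"
  note U = is_mat_repD(1)[OF \<rho> u] is_mat_repD(1)[OF \<sigma> u]
  show "four_block_mat (snd \<rho> (g \<circ> u)) (0\<^sub>m (fst \<rho>) (fst \<sigma>)) (0\<^sub>m (fst \<sigma>) (fst \<rho>)) (snd \<sigma> (g \<circ> u)) =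
    four_block_mat (snd \<rho> g) (0\<^sub>m (fst \<rho>) (fst \<sigma>)) (0\<^sub>m (fst \<sigma>) (fst \<rho>)) (snd \<sigma> g) *
    four_block_mat (snd \<rho> u) (0\<^sub>m (fst \<rho>) (fst \<sigma>)) (0\<^sub>m (fst \<sigma>) (fst \<rho>)) (snd \<sigma> u)"
    using G U is_mat_repD(3)[OF \<rho> g u] is_mat_repD(3)[OF \<sigma> g u]
    by (subst mult_four_block_mat[OF G(1) _ _ G(2) U(1) _ _ U(2)]) simp_all
qed (simp add: is_mat_repD(2)[OF \<rho>] is_mat_repD(2)[OF \<sigma>])

text \<open>A block diagonal matrix acts separately on the first \<open>fst \<rho>\<close> and the
  last \<open>fst \<sigma>\<close> entries of a vector; these two parts correspond to the head and
  to the tail of a member of the direct sum.\<close>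

lemma has_form_direct_sum_Cons:
  assumes "has_form n \<rho> R" "has_form n \<sigma> (direct_sum Rs)" and Rs: "\<And>R'. R' \<in> set Rs \<Longrightarrow> is_rep n R'"
  shows "has_form n (mat_rep_sum \<rho> \<sigma>) (direct_sum (R # Rs))"
proof -
  let ?d = "fst \<rho>" and ?e = "fst \<sigma>" and ?W = "direct_sum (R # Rs)"
  have \<rho>: "is_mat_rep n \<rho>" and \<sigma>: "is_mat_rep n \<sigma>" and R: "is_rep n R"
    using assms by (auto simp: has_form_def rep_iso_def)
  have sum: "is_mat_rep n (mat_rep_sum \<rho> \<sigma>)" by (rule is_mat_rep_sum[OF \<rho> \<sigma>])
  obtain f where "intertwiner n (mat_module \<rho>) R f"
    using assms(1) by (auto simp: has_form_def rep_iso_iff)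
  note f = intertwinerD[OF this, unfolded mat_module_simps]
  obtain e where "intertwiner n (mat_module \<sigma>) (direct_sum Rs) e"
    using assms(2) by (auto simp: has_form_def rep_iso_iff)
  note e = intertwinerD[OF this, unfolded mat_module_simps]
  define \<Phi> where "\<Phi> v = (\<lambda>i\<in>{..<Suc (length Rs)}. case i of 0 \<Rightarrow> f (vec_first v ?d)
    | Suc j \<Rightarrow> e (vec_last v ?e) j)" for v
  have cf: "vec_first v ?d \<in> carrier_vec ?d" and cl: "vec_last v ?e \<in> carrier_vec ?e" for v :: "complex vec"
    by simp_all
  have "rep_iso n (mat_module (mat_rep_sum \<rho> \<sigma>)) ?W"
  proof (rule rep_isoI[where \<phi> = \<Phi>])
    show "is_rep n (mat_module (mat_rep_sum \<rho> \<sigma>))" by (rule is_rep_mat_module[OF sum])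
    show "is_rep n ?W" by (rule is_rep_direct_sum) (use R Rs in auto)
    have dim: "fst (mat_rep_sum \<rho> \<sigma>) = ?d + ?e" by (simp add: mat_rep_sum_def)
    have eC: "e y \<in> (\<Pi>\<^sub>E i\<in>{..<length Rs}. carrier (fst (Rs ! i)))" if "y \<in> carrier_vec ?e" for y
      using bij_betw_apply[OF e(1) that] by (simp only: direct_sum_simps)
    show "bij_betw \<Phi> (carrier (fst (mat_module (mat_rep_sum \<rho> \<sigma>)))) (carrier (fst ?W))"
      unfolding mat_module_simps dim direct_sum_simps bij_betw_def
    proof
      show "inj_on \<Phi> (carrier_vec (?d + ?e))"
      proof (rule inj_onI)
        fix v w assume v: "v \<in> carrier_vec (?d + ?e)" "w \<in> carrier_vec (?d + ?e)" and eq: "\<Phi> v = \<Phi> w"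
        have "f (vec_first v ?d) = f (vec_first w ?d)" using fun_cong[OF eq, of 0] by (simp add: \<Phi>_def)
        then have 1: "vec_first v ?d = vec_first w ?d"
          using inj_onD[OF bij_betw_imp_inj_on[OF f(1)] _ cf cf] by blast
        have "e (vec_last v ?e) = e (vec_last w ?e)"
        proof (rule PiE_ext[OF eC[OF cl] eC[OF cl]])
          fix j assume "j \<in> {..<length Rs}"
          then show "e (vec_last v ?e) j = e (vec_last w ?e) j"
            using fun_cong[OF eq, of "Suc j"] by (simp add: \<Phi>_def)
        qed
        then have 2: "vec_last v ?e = vec_last w ?e"
          using inj_onD[OF bij_betw_imp_inj_on[OF e(1)] _ cl cl] by blast
        have "v = vec_first v ?d @\<^sub>v vec_last v ?e" by (rule vec_first_last_append[OF v(1), symmetric])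
        also have "\<dots> = vec_first w ?d @\<^sub>v vec_last w ?e" by (simp only: 1 2)
        also have "\<dots> = w" by (rule vec_first_last_append[OF v(2)])
        finally show "v = w" .
      qed
      show "\<Phi> ` carrier_vec (?d + ?e) = (\<Pi>\<^sub>E i\<in>{..<length (R # Rs)}. carrier (fst ((R # Rs) ! i)))"
      proof (intro equalityI subsetI)
        fix F assume "F \<in> \<Phi> ` carrier_vec (?d + ?e)"
        then obtain v where v: "F = \<Phi> v" by auto
        show "F \<in> (\<Pi>\<^sub>E i\<in>{..<length (R # Rs)}. carrier (fst ((R # Rs) ! i)))"
        proof (rule PiE_I)
          fix i assume i: "i \<in> {..<length (R # Rs)}"
          show "F i \<in> carrier (fst ((R # Rs) ! i))"
          proof (cases i)
            case 0
            then show ?thesis using bij_betw_apply[OF f(1) cf] by (simp add: v \<Phi>_def)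
          next
            case (Suc j)
            then have "j \<in> {..<length Rs}" using i by simp
            then show ?thesis using PiE_mem[OF eC[OF cl], of j] Suc by (simp add: v \<Phi>_def)
          qed
        qed (simp add: v \<Phi>_def)
      next
        fix F assume F: "F \<in> (\<Pi>\<^sub>E i\<in>{..<length (R # Rs)}. carrier (fst ((R # Rs) ! i)))"
        have "F 0 \<in> carrier (fst R)" using PiE_mem[OF F, of 0] by simp
        then obtain x where x: "x \<in> carrier_vec ?d" "f x = F 0"
          using bij_betw_imp_surj_on[OF f(1)] by (metis imageE)
        have "(\<lambda>j\<in>{..<length Rs}. F (Suc j)) \<in> carrier (fst (direct_sum Rs))"
          unfolding direct_sum_simps
        proof (rule PiE_I)
          fix j assume "j \<in> {..<length Rs}"
          then show "(\<lambda>j\<in>{..<length Rs}. F (Suc j)) j \<in> carrier (fst (Rs ! j))"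
            using PiE_mem[OF F, of "Suc j"] by simp
        qed simp
        then obtain y where y: "y \<in> carrier_vec ?e" "e y = (\<lambda>j\<in>{..<length Rs}. F (Suc j))"
          using bij_betw_imp_surj_on[OF e(1)] by (metis imageE)
        have fl: "vec_first (x @\<^sub>v y) ?d = x" "vec_last (x @\<^sub>v y) ?e = y"
          using x y by (auto simp: vec_first_def vec_last_def)
        have "\<Phi> (x @\<^sub>v y) = F"
        proof
          fix i
          show "\<Phi> (x @\<^sub>v y) i = F i"
          proof (cases i)
            case 0
            then show ?thesis by (simp add: \<Phi>_def fl x)
          next
            case (Suc j)
            then show ?thesis using PiE_arb[OF F, of i] by (simp add: \<Phi>_def fl y)
          qed
        qed
        moreover have "x @\<^sub>v y \<in> carrier_vec (?d + ?e)" using x y by simp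
        ultimately show "F \<in> \<Phi> ` carrier_vec (?d + ?e)" by (metis image_eqI)
      qed
    qed
    fix v w c g assume "v \<in> carrier (fst (mat_module (mat_rep_sum \<rho> \<sigma>)))"
    then have v: "v \<in> carrier_vec (?d + ?e)" by (simp only: mat_module_simps dim)
    have sm: "vec_first (c \<cdot>\<^sub>v v) ?d = c \<cdot>\<^sub>v vec_first v ?d" "vec_last (c \<cdot>\<^sub>v v) ?e = c \<cdot>\<^sub>v vec_last v ?e"
      using v by (auto simp: vec_first_def vec_last_def)
    show "\<Phi> (c \<odot>\<^bsub>fst (mat_module (mat_rep_sum \<rho> \<sigma>))\<^esub> v) = c \<odot>\<^bsub>fst ?W\<^esub> \<Phi> v"
      unfolding mat_module_simps direct_sum_simps \<Phi>_def sm f(3)[OF cf] e(3)[OF cl]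
      by (auto intro!: restrict_ext split: nat.split)
    show "\<Phi> (v \<oplus>\<^bsub>fst (mat_module (mat_rep_sum \<rho> \<sigma>))\<^esub> w) = \<Phi> v \<oplus>\<^bsub>fst ?W\<^esub> \<Phi> w"
      if "w \<in> carrier (fst (mat_module (mat_rep_sum \<rho> \<sigma>)))"
    proof -
      have w: "w \<in> carrier_vec (?d + ?e)" using that by (simp only: mat_module_simps dim)
      have ad: "vec_first (v + w) ?d = vec_first v ?d + vec_first w ?d"
        "vec_last (v + w) ?e = vec_last v ?e + vec_last w ?e"
        using v w by (auto simp: vec_first_def vec_last_def)
      show ?thesis
        unfolding mat_module_simps direct_sum_simps \<Phi>_def ad f(2)[OF cf cf] e(2)[OF cl cl]
        by (auto intro!: restrict_ext split: nat.split)
    qed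
    assume g: "g \<in> Sn n"
    note G = is_mat_repD(1)[OF \<rho> g] is_mat_repD(1)[OF \<sigma> g]
    have "snd (mat_rep_sum \<rho> \<sigma>) g *\<^sub>v (vec_first v ?d @\<^sub>v vec_last v ?e) =
        (snd \<rho> g *\<^sub>v vec_first v ?d) @\<^sub>v (snd \<sigma> g *\<^sub>v vec_last v ?e)"
      unfolding mat_rep_sum_def snd_conv by (rule mult_mat_vec_split[OF G cf cl])
    then have "snd (mat_rep_sum \<rho> \<sigma>) g *\<^sub>v v =
        (snd \<rho> g *\<^sub>v vec_first v ?d) @\<^sub>v (snd \<sigma> g *\<^sub>v vec_last v ?e)"
      by (simp only: vec_first_last_append[OF v])
    then have gv: "vec_first (snd (mat_rep_sum \<rho> \<sigma>) g *\<^sub>v v) ?d = snd \<rho> g *\<^sub>v vec_first v ?d"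
      "vec_last (snd (mat_rep_sum \<rho> \<sigma>) g *\<^sub>v v) ?e = snd \<sigma> g *\<^sub>v vec_last v ?e"
      using G by (auto simp: vec_first_def vec_last_def)
    show "\<Phi> (snd (mat_module (mat_rep_sum \<rho> \<sigma>)) g v) = snd ?W g (\<Phi> v)"
      unfolding mat_module_simps direct_sum_simps \<Phi>_def gv f(4)[OF g cf] e(4)[OF g cl]
      by (auto intro!: restrict_ext split: nat.split)
  qed
  with sum show ?thesis by (simp add: has_form_def)
qed

lemma has_form_empty: "has_form n (0, \<lambda>g. 1\<^sub>m 0) (direct_sum [])"
proof -
  let ?\<rho> = "(0, \<lambda>g. 1\<^sub>m 0) :: mat_rep"
  have \<rho>: "is_mat_rep n ?\<rho>" by (simp add: is_mat_rep_def)
  have one: "v = w" if "v \<in> carrier_vec 0" "w \<in> carrier_vec 0" for v w :: "complex vec"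
    using that by (intro eq_vecI) auto
  have D: "is_rep n (direct_sum [])" by (rule is_rep_direct_sum) simp
  have c: "carrier (fst (direct_sum [])) = {\<lambda>_. undefined}" by (simp add: direct_sum_simps)
  have "rep_iso n (mat_module ?\<rho>) (direct_sum [])"
  proof (rule rep_isoI[where \<phi> = "\<lambda>_ _. undefined"])
    have v0: "carrier_vec 0 = {0\<^sub>v 0 :: complex vec}" using one by auto
    show "bij_betw (\<lambda>_ _. undefined) (carrier (fst (mat_module ?\<rho>))) (carrier (fst (direct_sum [])))"
      unfolding mat_module_simps c fst_conv v0 by (simp add: bij_betw_def)
  qed (use \<rho> D in \<open>auto simp: is_rep_mat_module direct_sum_simps\<close>)
  with \<rho> show ?thesis by (simp add: has_form_def)
qed

text \<open>The element of \<open>R(\<SS>\<^sub>n)\<close> given by a formal integer combination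
  of matrix representations.\<close>

definition form_class :: "nat \<Rightarrow> (mat_rep \<Rightarrow>\<^sub>0 int) \<Rightarrow> (mat_rep \<Rightarrow>\<^sub>0 int) set" where
  "form_class n x = rep_relations n #>\<^bsub>free_reps n\<^esub> x"

lemma comm_group_free_reps: "comm_group (free_reps n)"
  by (simp add: free_reps_def abelian_free_Abelian_group)

lemma group_free_reps: "group (free_reps n)"
  by (simp add: free_reps_def)

lemma carrier_free_reps: "x \<in> carrier (free_reps n) \<longleftrightarrow> Poly_Mapping.keys x \<subseteq> {\<rho>. is_mat_rep n \<rho>}"
  by (simp add: free_reps_def)

lemma frag_of_carrier: "is_mat_rep n \<rho> \<Longrightarrow> frag_of \<rho> \<in> carrier (free_reps n)"
  by (simp add: carrier_free_reps)

lemma add_carrier: "x \<in> carrier (free_reps n) \<Longrightarrow> y \<in> carrier (free_reps n) \<Longrightarrow> x + y \<in> carrier (free_reps n)"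
  using group.is_monoid[OF group_free_reps, THEN monoid.m_closed, of x n y] by (simp add: free_reps_def)

lemma diff_carrier:
  assumes "x \<in> carrier (free_reps n)" "y \<in> carrier (free_reps n)"
  shows "x - y \<in> carrier (free_reps n)"
  using assms keys_diff[of x y] unfolding carrier_free_reps by blast

lemma rep_relations_gens:
  "{frag_of \<rho> - frag_of \<sigma> | \<rho> \<sigma>. is_mat_rep n \<rho> \<and> is_mat_rep n \<sigma> \<and> mat_rep_equiv n \<rho> \<sigma>} \<union>
   {frag_of (mat_rep_sum \<rho> \<sigma>) - frag_of \<rho> - frag_of \<sigma> | \<rho> \<sigma>. is_mat_rep n \<rho> \<and> is_mat_rep n \<sigma>}
   \<subseteq> carrier (free_reps n)"
  by (auto intro!: diff_carrier frag_of_carrier is_mat_rep_sum)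

lemma subgroup_rep_relations: "subgroup (rep_relations n) (free_reps n)"
  unfolding rep_relations_def by (rule group.generate_is_subgroup[OF group_free_reps rep_relations_gens])

lemma normal_rep_relations: "rep_relations n \<lhd> free_reps n"
  by (rule comm_group.subgroup_imp_normal[OF comm_group_free_reps subgroup_rep_relations])

lemma form_class_eq:
  assumes "x - y \<in> rep_relations n" "x \<in> carrier (free_reps n)" "y \<in> carrier (free_reps n)"
  shows "form_class n x = form_class n y"
proof -
  have "x = (x - y) \<otimes>\<^bsub>free_reps n\<^esub> y" by (simp add: free_reps_def)
  then have "x \<in> rep_relations n #>\<^bsub>free_reps n\<^esub> y"
    using assms(1) unfolding r_coset_def by blast
  then show ?thesis
    unfolding form_class_def
    using group.repr_independence[OF group_free_reps _ assms(3) subgroup_rep_relations] by simp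
qed

lemma form_class_equiv:
  assumes "is_mat_rep n \<rho>" "is_mat_rep n \<sigma>" "mat_rep_equiv n \<rho> \<sigma>"
  shows "form_class n (frag_of \<rho>) = form_class n (frag_of \<sigma>)"
proof (rule form_class_eq)
  show "frag_of \<rho> - frag_of \<sigma> \<in> rep_relations n"
    unfolding rep_relations_def by (rule generate.incl) (use assms in blast)
qed (use assms in \<open>auto intro: frag_of_carrier\<close>)

lemma form_class_sum:
  assumes "is_mat_rep n \<rho>" "is_mat_rep n \<sigma>"
  shows "form_class n (frag_of (mat_rep_sum \<rho> \<sigma>)) = form_class n (frag_of \<rho> + frag_of \<sigma>)"
proof (rule form_class_eq)
  have "frag_of (mat_rep_sum \<rho> \<sigma>) - frag_of \<rho> - frag_of \<sigma> \<in> rep_relations n"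
    unfolding rep_relations_def by (rule generate.incl) (use assms in blast)
  then show "frag_of (mat_rep_sum \<rho> \<sigma>) - (frag_of \<rho> + frag_of \<sigma>) \<in> rep_relations n"
    by (simp only: diff_diff_add)
qed (use assms in \<open>auto intro: frag_of_carrier add_carrier is_mat_rep_sum\<close>)

lemma form_class_add:
  assumes "x \<in> carrier (free_reps n)" "y \<in> carrier (free_reps n)"
  shows "form_class n (x + y) = form_class n x \<otimes>\<^bsub>rep_ring n\<^esub> form_class n y"
proof -
  interpret N: normal "rep_relations n" "free_reps n" by (rule normal_rep_relations)
  have "x + y = x \<otimes>\<^bsub>free_reps n\<^esub> y" by (simp add: free_reps_def)
  then show ?thesis
    unfolding form_class_def rep_ring_def using N.rcos_sum[OF assms] by (simp add: FactGroup_def)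
qed

lemma form_class_cmul:
  assumes "x \<in> carrier (free_reps n)"
  shows "form_class n (frag_cmul k x) = form_class n x [^]\<^bsub>rep_ring n\<^esub> k"
proof -
  interpret N: normal "rep_relations n" "free_reps n" by (rule normal_rep_relations)
  have "group (rep_ring n)" unfolding rep_ring_def by (rule N.factorgroup_is_group)
  moreover have "form_class n \<in> hom (free_reps n) (rep_ring n)"
    unfolding form_class_def rep_ring_def by (rule N.r_coset_hom_Mod)
  ultimately interpret H: group_hom "free_reps n" "rep_ring n" "form_class n"
    by (intro group_hom.intro group_hom_axioms.intro group_free_reps)
  have "frag_cmul k x = x [^]\<^bsub>free_reps n\<^esub> k"
    using assms by (simp add: free_reps_def)
  then show ?thesis using H.hom_int_pow[OF assms] by simp
qed

text \<open>The chosen matrix form and \<open>\<rho>\<close> are forms of the same representation,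
  hence equivalent.\<close>

lemma rep_class_form:
  assumes "has_form n \<rho> R"
  shows "rep_class n R = form_class n (frag_of \<rho>)"
proof -
  have eq: "mat_form n R = (SOME \<rho>. has_form n \<rho> R)"
    by (simp add: mat_form_def has_form_def mat_module_def)
  have f: "has_form n (mat_form n R) R" unfolding eq using assms by (rule someI)
  have "rep_iso n (mat_module (mat_form n R)) (mat_module \<rho>)"
    using rep_iso_trans[OF _ rep_iso_sym] f assms unfolding has_form_def by blast
  then have "mat_rep_equiv n (mat_form n R) \<rho>"
    using f assms by (intro mat_rep_equiv_if_iso) (auto simp: has_form_def)
  then show ?thesis
    unfolding rep_class_def form_class_def[symmetric]
    using f assms by (intro form_class_equiv) (auto simp: has_form_def)
qed

lemma rep_class_direct_sum:
  assumes forms: "\<And>\<mu>. \<mu> \<in> set L \<Longrightarrow> has_form n (\<rho> \<mu>) (Ind_trivial n \<mu>)"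
    and iso: "rep_iso n R (direct_sum (map (Ind_trivial n) L))"
  shows "rep_class n R = form_class n (\<Sum>\<mu>\<leftarrow>L. frag_of (\<rho> \<mu>))"
proof -
  have "\<exists>\<sigma>. has_form n \<sigma> (direct_sum (map (Ind_trivial n) L)) \<and>
      form_class n (frag_of \<sigma>) = form_class n (\<Sum>\<mu>\<leftarrow>L. frag_of (\<rho> \<mu>)) \<and>
      (\<Sum>\<mu>\<leftarrow>L. frag_of (\<rho> \<mu>)) \<in> carrier (free_reps n)"
    using forms
  proof (induction L)
    case Nil
    have 0: "has_form n (0, \<lambda>g. 1\<^sub>m 0) (direct_sum [])" by (rule has_form_empty)
    let ?z = "(0, \<lambda>g. 1\<^sub>m 0) :: mat_rep"
    have z: "is_mat_rep n ?z" by (simp add: is_mat_rep_def)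
    \<comment> \<open>The empty direct sum has dimension zero. Its class vanishes because it is
      equal to twice itself.\<close>
    have "mat_rep_equiv n (mat_rep_sum ?z ?z) ?z"
      unfolding mat_rep_equiv_def mat_rep_sum_def invertible_mat_def inverts_mat_def
      by (auto intro!: bexI[of _ "1\<^sub>m 0"] exI[of _ "1\<^sub>m 0"])
    then have "form_class n (frag_of ?z) = form_class n (frag_of ?z + frag_of ?z)"
      using form_class_equiv[OF is_mat_rep_sum[OF z z] z] form_class_sum[OF z z] by simp
    then have "frag_of ?z + frag_of ?z \<in> rep_relations n #>\<^bsub>free_reps n\<^esub> frag_of ?z"
      unfolding form_class_def
      using group.rcos_self[OF group_free_reps add_carrier[OF frag_of_carrier[OF z] frag_of_carrier[OF z]]
          subgroup_rep_relations] by simp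
    then obtain r where "r \<in> rep_relations n" "frag_of ?z + frag_of ?z = r + frag_of ?z"
      unfolding r_coset_def by (auto simp: free_reps_def)
    then have "frag_of ?z - 0 \<in> rep_relations n" by simp
    moreover have "0 \<in> carrier (free_reps n)" by (simp add: carrier_free_reps)
    ultimately have "form_class n (frag_of ?z) = form_class n 0"
      by (intro form_class_eq frag_of_carrier z)
    then show ?case using 0 \<open>0 \<in> carrier (free_reps n)\<close>
      by (intro exI[of _ ?z]) simp
  next
    case (Cons \<mu> L)
    have hyp: "has_form n (\<rho> \<mu>') (Ind_trivial n \<mu>')" if "\<mu>' \<in> set L" for \<mu>'
      by (rule Cons.prems) (simp add: that)
    have m: "has_form n (\<rho> \<mu>) (Ind_trivial n \<mu>)" by (rule Cons.prems) simp
    have "\<exists>\<sigma>. has_form n \<sigma> (direct_sum (map (Ind_trivial n) L)) \<and>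
        form_class n (frag_of \<sigma>) = form_class n (\<Sum>\<mu>\<leftarrow>L. frag_of (\<rho> \<mu>)) \<and>
        (\<Sum>\<mu>\<leftarrow>L. frag_of (\<rho> \<mu>)) \<in> carrier (free_reps n)"
      by (rule Cons.IH) (rule hyp)
    then obtain \<sigma> where \<sigma>: "has_form n \<sigma> (direct_sum (map (Ind_trivial n) L))"
      "form_class n (frag_of \<sigma>) = form_class n (\<Sum>\<mu>\<leftarrow>L. frag_of (\<rho> \<mu>))"
      "(\<Sum>\<mu>\<leftarrow>L. frag_of (\<rho> \<mu>)) \<in> carrier (free_reps n)"
      by (elim exE conjE)
    have f: "has_form n (mat_rep_sum (\<rho> \<mu>) \<sigma>) (direct_sum (map (Ind_trivial n) (\<mu> # L)))"
      unfolding list.map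
      by (rule has_form_direct_sum_Cons[OF m \<sigma>(1)], unfold set_map)
        (elim imageE, simp only: is_rep_Ind_trivial)
    have mr: "is_mat_rep n (\<rho> \<mu>)" "is_mat_rep n \<sigma>" using m \<sigma>(1) by (auto simp: has_form_def)
    note c = frag_of_carrier[OF mr(1)] frag_of_carrier[OF mr(2)]
    have "form_class n (frag_of (mat_rep_sum (\<rho> \<mu>) \<sigma>)) = form_class n (\<Sum>\<mu>\<leftarrow>\<mu> # L. frag_of (\<rho> \<mu>))"
      unfolding form_class_sum[OF mr] form_class_add[OF c] \<sigma>(2)
      by (simp add: form_class_add[OF c(1) \<sigma>(3)])
    then show ?case
      using f add_carrier[OF c(1) \<sigma>(3)] by (intro exI[of _ "mat_rep_sum (\<rho> \<mu>) \<sigma>"]) simp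
  qed
  then obtain \<sigma> where \<sigma>: "has_form n \<sigma> (direct_sum (map (Ind_trivial n) L))"
    "form_class n (frag_of \<sigma>) = form_class n (\<Sum>\<mu>\<leftarrow>L. frag_of (\<rho> \<mu>))" by (elim exE conjE)
  have "rep_iso n (mat_module \<sigma>) R"
    by (rule rep_iso_trans[OF _ rep_iso_sym[OF iso]]) (use \<sigma>(1) in \<open>simp only: has_form_def\<close>)
  then have "has_form n \<sigma> R" using \<sigma>(1) by (simp only: has_form_def)
  then show ?thesis by (simp only: rep_class_form \<sigma>(2))
qed

lemma rep_class_two_types:
  assumes n: "n \<ge> 1"
    and iso: "rep_iso n R (direct_sum (map (Ind_trivial n) (replicate N [n] @ replicate M [n - 1, 1])))"
  shows "rep_class n R = rep_class n (Ind_trivial n [n]) [^]\<^bsub>rep_ring n\<^esub> int N \<otimes>\<^bsub>rep_ring n\<^esub>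
    rep_class n (Ind_trivial n [n - 1, 1]) [^]\<^bsub>rep_ring n\<^esub> int M"
proof -
  define \<rho> :: "nat list \<Rightarrow> mat_rep" where
    "\<rho> \<mu> = (if \<mu> = [n] then (1, \<lambda>g. 1\<^sub>m 1) else (n, perm_matrix n))" for \<mu>
  let ?a = "frag_of (\<rho> [n])" and ?b = "frag_of (\<rho> [n - 1, 1])"
  have f: "has_form n (\<rho> [n]) (Ind_trivial n [n])" "has_form n (\<rho> [n - 1, 1]) (Ind_trivial n [n - 1, 1])"
    using has_form_trivial has_form_point[OF n] by (simp_all add: \<rho>_def)
  have sum: "(\<Sum>\<mu>\<leftarrow>replicate k \<mu>. frag_of (\<rho> \<mu>)) = frag_cmul (int k) (frag_of (\<rho> \<mu>))" for k \<mu>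
    by (induction k) (simp_all add: frag_cmul_distrib algebra_simps)
  have c: "?a \<in> carrier (free_reps n)" "?b \<in> carrier (free_reps n)"
    using f by (auto simp: has_form_def intro: frag_of_carrier)
  have cm: "frag_cmul (int k) x \<in> carrier (free_reps n)" if "x \<in> carrier (free_reps n)" for k x
    using that keys_cmul[of "int k" x] unfolding carrier_free_reps by blast
  have "has_form n (\<rho> \<mu>) (Ind_trivial n \<mu>)" if "\<mu> \<in> set (replicate N [n] @ replicate M [n - 1, 1])" for \<mu>
  proof -
    from that consider "\<mu> = [n]" | "\<mu> = [n - 1, 1]" by auto
    then show ?thesis by cases (simp_all only: f)
  qed
  from rep_class_direct_sum[OF this iso]
  have "rep_class n R = form_class n (frag_cmul (int N) ?a + frag_cmul (int M) ?b)"
    by (simp only: map_append sum_list_append sum)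
  also have "\<dots> = form_class n ?a [^]\<^bsub>rep_ring n\<^esub> int N \<otimes>\<^bsub>rep_ring n\<^esub> form_class n ?b [^]\<^bsub>rep_ring n\<^esub> int M"
    by (simp only: form_class_add[OF cm[OF c(1)] cm[OF c(2)]] form_class_cmul[OF c(1)] form_class_cmul[OF c(2)])
  finally show ?thesis unfolding rep_class_form[OF f(1)] rep_class_form[OF f(2)] .
qed

section \<open>Linearity of the maps in cohomology\<close>

lemma cscale_simps: "cscale c (x + y) = cscale c x + cscale c y" "cscale c 0 = 0"
  "cscale c (cscale d x) = cscale (c * d) x" "cscale 1 x = x" "cscale (-1) x = - x"
  by (auto simp: cscale_def fun_eq_iff algebra_simps)

lemma coboundary_add: "coboundary p X (x + y) = coboundary p X x + coboundary p X y"
  by (auto simp: coboundary_def fun_eq_iff algebra_simps sum.distrib)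

lemma coboundary_cscale: "coboundary p X (cscale c x) = cscale c (coboundary p X x)"
  by (auto simp: coboundary_def cscale_def fun_eq_iff sum_distrib_left algebra_simps)

lemma cochains_add: "x \<in> cochains p X \<Longrightarrow> y \<in> cochains p X \<Longrightarrow> x + y \<in> cochains p X"
  by (auto simp: cochains_def)

lemma cochains_cscale: "x \<in> cochains p X \<Longrightarrow> cscale c x \<in> cochains p X"
  by (auto simp: cochains_def cscale_def)

lemma cochains_0: "0 \<in> cochains p X"
  by (simp add: cochains_def)

lemma coboundary_0: "coboundary p X 0 = 0"
  by (auto simp: coboundary_def fun_eq_iff)

lemma cocycles_add: "x \<in> cocycles p X \<Longrightarrow> y \<in> cocycles p X \<Longrightarrow> x + y \<in> cocycles p X"
  by (auto simp: cocycles_def cochains_add coboundary_add)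

lemma cocycles_cscale: "x \<in> cocycles p X \<Longrightarrow> cscale c x \<in> cocycles p X"
  by (auto simp: cocycles_def cochains_cscale coboundary_cscale cscale_simps)

lemma cocycles_0: "0 \<in> cocycles p X"
  by (simp add: cocycles_def cochains_0 coboundary_0)

lemma coboundaries_0: "0 \<in> coboundaries p X"
  by (cases p) (auto simp: coboundaries_def intro!: image_eqI[of _ _ 0] simp: coboundary_0 cochains_0)

lemma coboundaries_add: "x \<in> coboundaries p X \<Longrightarrow> y \<in> coboundaries p X \<Longrightarrow> x + y \<in> coboundaries p X"
  by (cases p) (auto simp: coboundaries_def cochains_add simp flip: coboundary_add)

lemma coboundaries_cscale: "x \<in> coboundaries p X \<Longrightarrow> cscale c x \<in> coboundaries p X"
  by (cases p) (auto simp: coboundaries_def cochains_cscale cscale_simps simp flip: coboundary_cscale)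

lemma coboundaries_uminus: "x \<in> coboundaries p X \<Longrightarrow> - x \<in> coboundaries p X"
  using coboundaries_cscale[of x p X "-1"] by (simp add: cscale_simps)

lemma mem_coh_class: "y \<in> coh_class p X x \<longleftrightarrow> y - x \<in> coboundaries p X"
  by (auto simp: coh_class_def) (metis add.commute diff_add_cancel)

lemma coh_class_eq_iff: "coh_class p X x = coh_class p X y \<longleftrightarrow> x - y \<in> coboundaries p X"
proof
  have "x \<in> coh_class p X x" by (simp add: mem_coh_class coboundaries_0)
  then show "x - y \<in> coboundaries p X" if "coh_class p X x = coh_class p X y"
    using that by (simp add: mem_coh_class)
next
  assume d: "x - y \<in> coboundaries p X"
  have "z - x \<in> coboundaries p X \<longleftrightarrow> z - y \<in> coboundaries p X" for z
  proof
    assume "z - x \<in> coboundaries p X"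
    from coboundaries_add[OF this d] show "z - y \<in> coboundaries p X" by simp
  next
    assume "z - y \<in> coboundaries p X"
    from coboundaries_add[OF this coboundaries_uminus[OF d]] show "z - x \<in> coboundaries p X" by simp
  qed
  then show "coh_class p X x = coh_class p X y" by (auto simp: set_eq_iff mem_coh_class)
qed

lemma cohomology_simps:
  "carrier (cohomology p X) = coh_class p X ` cocycles p X"
  "\<zero>\<^bsub>cohomology p X\<^esub> = coh_class p X 0"
  by (auto simp: cohomology_def set_eq_iff mem_coh_class)

lemma cohomology_add:
  "coh_class p X x \<oplus>\<^bsub>cohomology p X\<^esub> coh_class p X y = coh_class p X (x + y)"
proof -
  have "z \<in> {a + b | a b. a \<in> coh_class p X x \<and> b \<in> coh_class p X y} \<longleftrightarrow> z \<in> coh_class p X (x + y)" for z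
  proof
    assume "z \<in> {a + b | a b. a \<in> coh_class p X x \<and> b \<in> coh_class p X y}"
    then obtain a b where z: "z = a + b" "a - x \<in> coboundaries p X" "b - y \<in> coboundaries p X"
      by (auto simp: mem_coh_class)
    have "z - (x + y) = (a - x) + (b - y)" by (simp add: z)
    then show "z \<in> coh_class p X (x + y)" using coboundaries_add[OF z(2,3)] by (simp only: mem_coh_class)
  next
    assume "z \<in> coh_class p X (x + y)"
    then have "z - y \<in> coh_class p X x" "y \<in> coh_class p X y"
      by (simp_all add: mem_coh_class coboundaries_0 algebra_simps)
    moreover have "z = (z - y) + y" by simp
    ultimately show "z \<in> {a + b | a b. a \<in> coh_class p X x \<and> b \<in> coh_class p X y}" by blast
  qed
  then show ?thesis by (simp add: cohomology_def set_eq_iff)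
qed

lemma cohomology_smult:
  "c \<odot>\<^bsub>cohomology p X\<^esub> coh_class p X x = coh_class p X (cscale c x)"
proof -
  have "z \<in> {cscale c a + \<beta> | a \<beta>. a \<in> coh_class p X x \<and> \<beta> \<in> coboundaries p X} \<longleftrightarrow>
      z \<in> coh_class p X (cscale c x)" for z
  proof
    assume "z \<in> {cscale c a + \<beta> | a \<beta>. a \<in> coh_class p X x \<and> \<beta> \<in> coboundaries p X}"
    then obtain a \<beta> where z: "z = cscale c a + \<beta>" "a - x \<in> coboundaries p X" "\<beta> \<in> coboundaries p X"
      by (auto simp: mem_coh_class)
    have "z - cscale c x = cscale c (a - x) + \<beta>"
      by (simp add: z(1) cscale_def fun_eq_iff algebra_simps)
    then show "z \<in> coh_class p X (cscale c x)"
      using coboundaries_add[OF coboundaries_cscale[OF z(2)] z(3)] by (simp add: mem_coh_class)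
  next
    assume "z \<in> coh_class p X (cscale c x)"
    moreover have "x \<in> coh_class p X x" by (simp add: mem_coh_class coboundaries_0)
    moreover have "z = cscale c x + (z - cscale c x)" by simp
    ultimately show "z \<in> {cscale c a + \<beta> | a \<beta>. a \<in> coh_class p X x \<and> \<beta> \<in> coboundaries p X}"
      unfolding mem_coh_class by blast
  qed
  then show ?thesis by (simp add: cohomology_def set_eq_iff)
qed

lemma pullback_add:
  "cochain_pullback p X f (x + y) = cochain_pullback p X f x + cochain_pullback p X f y"
  by (auto simp: cochain_pullback_def fun_eq_iff)

lemma pullback_cscale: "cochain_pullback p X f (cscale c x) = cscale c (cochain_pullback p X f x)"
  by (auto simp: cochain_pullback_def cscale_def fun_eq_iff)

lemma coh_pullback_class:
  assumes "\<And>\<beta>. \<beta> \<in> coboundaries p Y \<Longrightarrow> cochain_pullback p X f \<beta> \<in> coboundaries p X"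
  shows "coh_pullback p X f (coh_class p Y x) = coh_class p X (cochain_pullback p X f x)"
proof -
  have "z \<in> coh_pullback p X f (coh_class p Y x) \<longleftrightarrow> z \<in> coh_class p X (cochain_pullback p X f x)" for z
  proof
    assume "z \<in> coh_pullback p X f (coh_class p Y x)"
    then obtain \<beta> \<gamma> where z: "z = cochain_pullback p X f (x + \<beta>) + \<gamma>" "\<beta> \<in> coboundaries p Y" "\<gamma> \<in> coboundaries p X"
      by (auto simp: coh_pullback_def coh_class_def)
    have "z - cochain_pullback p X f x = cochain_pullback p X f \<beta> + \<gamma>"
      by (simp add: z(1) pullback_add)
    then show "z \<in> coh_class p X (cochain_pullback p X f x)"
      using coboundaries_add[OF assms[OF z(2)] z(3)] by (simp add: mem_coh_class)
  next
    assume "z \<in> coh_class p X (cochain_pullback p X f x)"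
    moreover have "x \<in> coh_class p Y x" by (simp add: mem_coh_class coboundaries_0)
    moreover have "z = cochain_pullback p X f x + (z - cochain_pullback p X f x)" by simp
    ultimately show "z \<in> coh_pullback p X f (coh_class p Y x)"
      unfolding coh_pullback_def mem_coh_class by blast
  qed
  then show ?thesis by (simp add: set_eq_iff)
qed

text \<open>A coset determines the subspace it belongs to, so a map of cochains that carries a
  single class into a class must map coboundaries to coboundaries. For the inclusion of a fibre
  such a class is provided by the surjectivity of the map to the cohomology of the fibre.\<close>

lemma pullback_coboundaries_if_class:
  assumes "coh_pullback p X f (coh_class p Y x) \<in> carrier (cohomology p X)"
    and "\<beta> \<in> coboundaries p Y"
  shows "cochain_pullback p X f \<beta> \<in> coboundaries p X"
proof -
  obtain y where y: "coh_pullback p X f (coh_class p Y x) = coh_class p X y"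
    using assms(1) by (auto simp: cohomology_simps)
  have "cochain_pullback p X f (x + b) \<in> coh_pullback p X f (coh_class p Y x)" if "b \<in> coboundaries p Y" for b
    unfolding coh_pullback_def coh_class_def using that coboundaries_0[of p X]
    by (intro CollectI exI[of _ "x + b"] exI[of _ 0]) auto
  from this[OF assms(2)] this[OF coboundaries_0]
  have "cochain_pullback p X f x + cochain_pullback p X f \<beta> - y \<in> coboundaries p X"
    "cochain_pullback p X f x - y \<in> coboundaries p X"
    unfolding y mem_coh_class by (simp_all add: pullback_add)
  from coboundaries_add[OF this(1) coboundaries_uminus[OF this(2)]] show ?thesis by simp
qed

lemma coboundary_pullback:
  assumes f: "continuous_map X Y f"
  shows "coboundary p X (cochain_pullback p X f \<phi>) = cochain_pullback (Suc p) X f (coboundary p Y \<phi>)"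
proof
  fix \<sigma>
  show "coboundary p X (cochain_pullback p X f \<phi>) \<sigma> = cochain_pullback (Suc p) X f (coboundary p Y \<phi>) \<sigma>"
  proof (cases "singular_simplex (Suc p) X \<sigma>")
    case True
    have face: "singular_simplex p X (singular_face (Suc p) k \<sigma>)" if "k \<le> Suc p" for k
      using singular_simplex_singular_face[OF True _ that] by simp
    have "singular_simplex (Suc p) Y (simplex_map (Suc p) f \<sigma>)"
      using True f by (rule singular_simplex_simplex_map)
    moreover have "singular_face (Suc p) k (simplex_map (Suc p) f \<sigma>) = simplex_map p f (singular_face (Suc p) k \<sigma>)"
      if "k \<le> Suc p" for k
      using singular_face_simplex_map[of "Suc p" k f \<sigma>] that
      by (auto simp: singular_face_def simplex_map_def restrict_def fun_eq_iff)
    ultimately show ?thesis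
      using True face by (simp add: coboundary_def cochain_pullback_def)
  qed (simp add: coboundary_def cochain_pullback_def)
qed

lemma pullback_cochain: "cochain_pullback p X f \<phi> \<in> cochains p X"
  by (simp add: cochains_def cochain_pullback_def)

lemma pullback_cocycle:
  assumes "continuous_map X Y f" "\<phi> \<in> cocycles p Y"
  shows "cochain_pullback p X f \<phi> \<in> cocycles p X"
proof -
  have "cochain_pullback (Suc p) X f 0 = 0" by (auto simp: cochain_pullback_def fun_eq_iff)
  then show ?thesis
    using assms by (simp add: cocycles_def pullback_cochain coboundary_pullback)
qed

lemma pullback_coboundary:
  assumes f: "continuous_map X Y f" and "\<beta> \<in> coboundaries p Y"
  shows "cochain_pullback p X f \<beta> \<in> coboundaries p X"
proof (cases p)
  case 0
  then show ?thesis using assms(2) by (auto simp: coboundaries_def cochain_pullback_def fun_eq_iff)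
next
  case (Suc r)
  then obtain \<phi> where \<phi>: "\<beta> = coboundary r Y \<phi>" using assms(2) by (auto simp: coboundaries_def)
  have "cochain_pullback p X f \<beta> = coboundary r X (cochain_pullback r X f \<phi>)"
    unfolding \<phi> Suc by (rule coboundary_pullback[OF f, symmetric])
  then show ?thesis by (simp add: coboundaries_def Suc pullback_cochain)
qed

section \<open>The inclusion of a fixed point is continuous\<close>

lemma quotient_topspace [simp]: "topspace (quotient_topology X f) = f ` topspace X"
proof
  have "openin (quotient_topology X f) (f ` topspace X)"
    unfolding openin_quotient_topology by (auto intro: back_subst[of "openin X", OF openin_topspace])
  then show "f ` topspace X \<subseteq> topspace (quotient_topology X f)" by (rule openin_subset)
  show "topspace (quotient_topology X f) \<subseteq> f ` topspace X"
    using openin_topspace[of "quotient_topology X f"] unfolding openin_quotient_topology by blast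
qed

lemma continuous_map_into_quotient: "continuous_map X (quotient_topology X f) f"
  unfolding continuous_map_def by (auto simp: openin_quotient_topology)

lemma continuous_map_from_quotient:
  assumes "continuous_map X Y (g \<circ> f)"
  shows "continuous_map (quotient_topology X f) Y g"
  unfolding continuous_map_def
proof (intro conjI allI impI)
  show "g \<in> topspace (quotient_topology X f) \<rightarrow> topspace Y"
    using assms by (auto simp: continuous_map_def Pi_iff)
  fix U assume "openin Y U"
  then have "openin X {x \<in> topspace X. (g \<circ> f) x \<in> U}" using assms by (simp add: continuous_map_def)
  moreover have "{x \<in> topspace X. f x \<in> {y \<in> f ` topspace X. g y \<in> U}} = {x \<in> topspace X. (g \<circ> f) x \<in> U}"
    by auto
  ultimately show "openin (quotient_topology X f) {y \<in> topspace (quotient_topology X f). g y \<in> U}"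
    unfolding openin_quotient_topology quotient_topspace by auto
qed

lemma sum_fun_apply: "(\<Sum>i\<in>A. f i) x = (\<Sum>i\<in>A. f i x)"
  for f :: "'a \<Rightarrow> 'b \<Rightarrow> 'c::comm_monoid_add"
  by (induction A rule: infinite_finite_induct) auto

lemma span_basis_vec:
  assumes "finite A"
  shows "cvec.span (basis_vec ` A) = {x. \<forall>i. i \<notin> A \<longrightarrow> x i = 0}"
proof
  have "cvec.subspace {x. \<forall>i. i \<notin> A \<longrightarrow> x i = (0::complex)}"
    by (auto simp: cvec.subspace_def cscale_def)
  then show "cvec.span (basis_vec ` A) \<subseteq> {x. \<forall>i. i \<notin> A \<longrightarrow> x i = 0}"
    by (rule cvec.span_minimal[rotated]) (auto simp: basis_vec_def)
  show "{x. \<forall>i. i \<notin> A \<longrightarrow> x i = 0} \<subseteq> cvec.span (basis_vec ` A)"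
  proof
    fix x :: "nat \<Rightarrow> complex" assume "x \<in> {x. \<forall>i. i \<notin> A \<longrightarrow> x i = 0}"
    then have "x = (\<Sum>i\<in>A. cscale (x i) (basis_vec i))"
      using assms by (auto simp: fun_eq_iff sum_fun_apply cscale_def basis_vec_def if_distrib[of "\<lambda>a. _ * a"] cong: if_cong)
    moreover have "(\<Sum>i\<in>A. cscale (x i) (basis_vec i)) \<in> cvec.span (basis_vec ` A)"
      by (intro cvec.span_sum cvec.span_scale cvec.span_base) auto
    ultimately show "x \<in> cvec.span (basis_vec ` A)" by simp
  qed
qed

lemma inj_basis_vec: "inj basis_vec"
  by (rule injI) (metis basis_vec_def zero_neq_one)

lemma independent_basis_vec: "cvec.independent (basis_vec ` A)"
proof -
  have "\<not> cvec.dependent (basis_vec ` A)"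
  proof
    assume "cvec.dependent (basis_vec ` A)"
    then obtain a where a: "a \<in> A" "basis_vec a \<in> cvec.span (basis_vec ` A - {basis_vec a})"
      unfolding cvec.dependent_def by auto
    have "cvec.subspace {x. x a = (0::complex)}" by (auto simp: cvec.subspace_def cscale_def)
    then have "cvec.span (basis_vec ` A - {basis_vec a}) \<subseteq> {x. x a = 0}"
      by (rule cvec.span_minimal[rotated]) (auto simp: basis_vec_def)
    then show False using a by (auto simp: basis_vec_def)
  qed
  then show ?thesis .
qed

lemma fixed_flag_apply:
  assumes "i \<in> {1..n}"
  shows "fixed_flag n w i = {x. \<forall>j. j \<notin> w ` {1..i} \<longrightarrow> x j = 0}"
proof -
  have "(\<lambda>i. basis_vec (w i)) ` {1..i} = basis_vec ` w ` {1..i}" by auto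
  then show ?thesis using assms by (simp add: fixed_flag_def flag_of_def span_basis_vec)
qed

lemma fixed_flag_in_Flag:
  assumes w: "w \<in> Sn n" and n: "n \<ge> 1"
  shows "fixed_flag n w \<in> Flag n"
proof -
  have n': "n \<in> {1..n}" using n by simp
  have inj: "inj w" and im: "w ` {1..n} = {1..n}" using w by (auto simp: Sn_def permutes_inj permutes_image)
  have sub: "cvec.subspace (fixed_flag n w i)" "cvec.dim (fixed_flag n w i) = i" if "i \<in> {1..n}" for i
  proof -
    have eq: "fixed_flag n w i = cvec.span (basis_vec ` w ` {1..i})"
      using that by (simp add: fixed_flag_apply span_basis_vec)
    show "cvec.subspace (fixed_flag n w i)" unfolding eq by (rule cvec.subspace_span)
    have "cvec.dim (fixed_flag n w i) = card (basis_vec ` w ` {1..i})"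
      unfolding eq by (rule cvec.dim_span_eq_card_independent[OF independent_basis_vec])
    also have "\<dots> = i"
      using inj inj_basis_vec by (simp add: card_image inj_on_subset[OF inj_basis_vec] inj_on_subset[OF inj])
    finally show "cvec.dim (fixed_flag n w i) = i" .
  qed
  have sub2: "fixed_flag n w i \<subseteq> Cn n" if i: "i \<in> {1..n}" for i
  proof -
    have "w ` {1..i} \<subseteq> {1..n}" using im i by (metis image_mono atLeastatMost_subset_iff order_refl atLeastAtMost_iff)
    then show ?thesis unfolding fixed_flag_apply[OF i] Cn_def by blast
  qed
  have "fixed_flag n w n = Cn n"
    unfolding fixed_flag_apply[OF n'] im by (simp add: Cn_def)
  moreover have "fixed_flag n w i \<subseteq> fixed_flag n w j" if "i \<in> {1..n}" "j \<in> {i..n}" for i j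
  proof -
    have j: "j \<in> {1..n}" and ij: "w ` {1..i} \<subseteq> w ` {1..j}" using that by (auto intro!: image_mono)
    show ?thesis unfolding fixed_flag_apply[OF that(1)] fixed_flag_apply[OF j] using ij by blast
  qed
  moreover have "fixed_flag n w \<in> extensional {1..n}"
    by (simp add: fixed_flag_def flag_of_def)
  ultimately show ?thesis
    unfolding Flag_def using sub sub2 by blast
qed

text \<open>Coordinate subspaces are invariant under diagonal matrices, and \<open>V\<^sub>i
  \<subseteq> V\<^bsub>h(i)\<^esub>\<close>.\<close>

lemma fixed_flag_in_hess_variety:
  assumes "w \<in> Sn n" "n \<ge> 1" "hessenberg n h"
  shows "fixed_flag n w \<in> hess_variety n s h"
proof -
  have "(\<lambda>x j. s j * x j) ` fixed_flag n w i \<subseteq> fixed_flag n w (h i)" if i: "i \<in> {1..n}" for i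
  proof -
    have "i \<le> h i" "h i \<le> n" using assms(3) i unfolding hessenberg_def by blast+
    then have hi: "h i \<in> {1..n}" and sub: "w ` {1..i} \<subseteq> w ` {1..h i}" using i by (auto intro!: image_mono)
    show ?thesis
    proof (rule image_subsetI)
      fix x assume "x \<in> fixed_flag n w i"
      then have "x j = 0" if "j \<notin> w ` {1..h i}" for j
        using sub that unfolding fixed_flag_apply[OF i] by blast
      then show "(\<lambda>j. s j * x j) \<in> fixed_flag n w (h i)"
        unfolding fixed_flag_apply[OF hi] by simp
    qed
  qed
  then show ?thesis unfolding hess_variety_def using fixed_flag_in_Flag[OF assms(1,2)] by blast
qed

lemma fixed_flag_in_hess_space:
  assumes w: "w \<in> Sn n" and "n \<ge> 1" "hessenberg n h"
  shows "fixed_flag n w \<in> topspace (hess_space n s h)"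
proof -
  have inj: "inj w" and im: "w ` {1..n} = {1..n}" using w by (auto simp: Sn_def permutes_inj permutes_image)
  define b where "b = (\<lambda>i. if i \<in> {1..n} then basis_vec (w i) else 0)"
  have img: "b ` {1..n} = basis_vec ` w ` {1..n}" by (auto simp: b_def image_iff)
  have "inj_on b {1..n}"
    using injD[OF inj] injD[OF inj_basis_vec] by (auto simp: inj_on_def b_def)
  moreover have "cvec.independent (b ` {1..n})" unfolding img by (rule independent_basis_vec)
  moreover have "b j \<in> Cn n" if "j \<in> {1..n}" for j
  proof -
    have "w j \<in> {1..n}" using im that by blast
    then show ?thesis using that by (auto simp: b_def Cn_def basis_vec_def)
  qed
  ultimately have b: "b \<in> frames n" unfolding frames_def by (auto simp: b_def)
  have "flag_of n b = fixed_flag n w"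
    unfolding flag_of_def fixed_flag_def
  proof (rule restrict_ext)
    fix i assume "i \<in> {1..n}"
    then have "b ` {1..i} = (\<lambda>i. basis_vec (w i)) ` {1..i}" by (intro image_cong) (auto simp: b_def)
    then show "cvec.span (b ` {1..i}) = cvec.span ((\<lambda>i. basis_vec (w i)) ` {1..i})" by simp
  qed
  then have "fixed_flag n w \<in> topspace (flag_topology n)"
    using b unfolding flag_topology_def quotient_topspace by (auto simp: image_iff intro!: bexI[of _ b])
  then show ?thesis
    using fixed_flag_in_hess_variety[OF assms] by (simp add: hess_space_def)
qed

lemma flag_act_fixed_flag:
  assumes "g \<in> torus n"
  shows "flag_act n g (fixed_flag n w) = fixed_flag n w"
proof
  fix i
  have nz: "g j \<noteq> 0" for j using assms by (cases "j \<in> {1..n}") (auto simp: torus_def)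
  show "flag_act n g (fixed_flag n w) i = fixed_flag n w i"
  proof (cases "i \<in> {1..n}")
    case True
    have "x \<in> (\<lambda>x j. g j * x j) ` fixed_flag n w i" if "x \<in> fixed_flag n w i" for x
    proof (rule image_eqI[where x = "\<lambda>j. x j / g j"])
      show "x = (\<lambda>j. g j * (x j / g j))" using nz by (simp add: fun_eq_iff)
      show "(\<lambda>j. x j / g j) \<in> fixed_flag n w i" using that unfolding fixed_flag_apply[OF True] by simp
    qed
    moreover have "(\<lambda>j. g j * x j) \<in> fixed_flag n w i" if "x \<in> fixed_flag n w i" for x
      using that unfolding fixed_flag_apply[OF True] by simp
    ultimately have "(\<lambda>x j. g j * x j) ` fixed_flag n w i = fixed_flag n w i" by blast
    then show ?thesis using True by (simp add: flag_act_def)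
  next
    case False
    have "fixed_flag n w i = undefined" using False by (auto simp: fixed_flag_def flag_of_def)
    then show ?thesis using False by (auto simp: flag_act_def)
  qed
qed

text \<open>Since the torus fixes the flag, pairing a point of \<open>ET\<close> with this flag is
  compatible with the passage to orbits.\<close>

lemma continuous_fixed_point_inclusion:
  assumes w: "w \<in> Sn n" and "n \<ge> 1" "hessenberg n h"
  shows "continuous_map (BT n) (hess_borel n s h) (fixed_point_inclusion n w)"
proof -
  let ?X = "prod_topology (top_of_set (ET n)) (discrete_topology (UNIV :: unit set))"
  let ?Y = "prod_topology (top_of_set (ET n)) (hess_space n s h)"
  let ?F = "fixed_flag n w"
  have "continuous_map ?X ?Y (\<lambda>p. (fst p, ?F))"
    using fixed_flag_in_hess_space[OF assms]
    by (intro continuous_map_pairedI continuous_map_fst) (simp add: continuous_map_const)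
  then have "continuous_map ?X (hess_borel n s h) (borel_orbit n (flag_act n) \<circ> (\<lambda>p. (fst p, ?F)))"
    unfolding hess_borel_def borel_construction_def
    by (rule continuous_map_compose) (rule continuous_map_into_quotient)
  moreover have "borel_orbit n (flag_act n) (fst p, ?F) =
      (fixed_point_inclusion n w \<circ> borel_orbit n (\<lambda>g x. x)) p" for p :: "(nat \<Rightarrow> nat \<Rightarrow> complex) \<times> unit"
  proof -
    have "borel_orbit n (flag_act n) (fst p, ?F) = {(ET_act g (fst p), ?F) | g. g \<in> torus n}"
      unfolding borel_orbit_def using flag_act_fixed_flag by auto
    also have "\<dots> = (fixed_point_inclusion n w \<circ> borel_orbit n (\<lambda>g x. x)) p"
      by (cases p) (auto simp: borel_orbit_def fixed_point_inclusion_def image_iff)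
    finally show ?thesis .
  qed
  ultimately have "continuous_map ?X (hess_borel n s h) (fixed_point_inclusion n w \<circ> borel_orbit n (\<lambda>g x. x))"
    by (simp add: comp_def)
  then show ?thesis
    unfolding BT_def borel_construction_def by (rule continuous_map_from_quotient)
qed

section \<open>Substitution and degree in the polynomial ring\<close>

lemma poly_mapping_eq_sum_single:
  "f = (\<Sum>m\<in>Poly_Mapping.keys f. Poly_Mapping.single m (Poly_Mapping.lookup f m))"
proof (rule poly_mapping_eqI)
  fix k
  show "Poly_Mapping.lookup f k =
    Poly_Mapping.lookup (\<Sum>m\<in>Poly_Mapping.keys f. Poly_Mapping.single m (Poly_Mapping.lookup f m)) k"
    by (simp add: lookup_sum lookup_single when_def in_keys_iff)
qed

lemma cpoly_induct [case_names zero single add]: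
  fixes f :: cpoly
  assumes "P 0" "\<And>m c. P (Poly_Mapping.single m c)" "\<And>f g. P f \<Longrightarrow> P g \<Longrightarrow> P (f + g)"
  shows "P f"
proof -
  have "P (\<Sum>m\<in>S. Poly_Mapping.single m (Poly_Mapping.lookup f m))" if "finite S" for S
    using that by (induction S) (auto intro: assms)
  then show ?thesis
    by (subst poly_mapping_eq_sum_single) simp
qed

definition mono_subst :: "(nat \<Rightarrow> cpoly) \<Rightarrow> (nat \<Rightarrow>\<^sub>0 nat) \<Rightarrow> cpoly" where
  "mono_subst \<tau> m = (\<Prod>i\<in>Poly_Mapping.keys m. \<tau> i ^ Poly_Mapping.lookup m i)"

text \<open>The ring homomorphism that maps \<open>t\<^sub>i\<close> to \<open>\<tau> i\<close>.
  Permuting variables, identifying two of them and deleting the superfluous ones are instances,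
  and so all of them commute with the formation of \<open>taut\<close> below.\<close>

definition subst :: "(nat \<Rightarrow> cpoly) \<Rightarrow> cpoly \<Rightarrow> cpoly" where
  "subst \<tau> f = (\<Sum>m\<in>Poly_Mapping.keys f.
     Poly_Mapping.single 0 (Poly_Mapping.lookup f m) * mono_subst \<tau> m)"

lemma perm_poly_eq_subst: "perm_poly v = subst (\<lambda>i. tvar (v i))"
  by (simp add: fun_eq_iff perm_poly_def subst_def mono_subst_def)

lemma mono_subst_superset:
  assumes "finite S" "Poly_Mapping.keys m \<subseteq> S"
  shows "mono_subst \<tau> m = (\<Prod>i\<in>S. \<tau> i ^ Poly_Mapping.lookup m i)"
  unfolding mono_subst_def using assms
  by (intro prod.mono_neutral_left) (auto simp: in_keys_iff)

lemma mono_subst_add: "mono_subst \<tau> (m + m') = mono_subst \<tau> m * mono_subst \<tau> m'"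
proof -
  let ?S = "Poly_Mapping.keys m \<union> Poly_Mapping.keys m'"
  have "mono_subst \<tau> (m + m') = (\<Prod>i\<in>?S. \<tau> i ^ Poly_Mapping.lookup (m + m') i)"
    by (rule mono_subst_superset) (auto simp: Poly_Mapping.keys_add)
  also have "\<dots> = mono_subst \<tau> m * mono_subst \<tau> m'"
    by (subst (1 2) mono_subst_superset[of ?S]) (auto simp: lookup_add power_add prod.distrib)
  finally show ?thesis .
qed

lemma mono_subst_0 [simp]: "mono_subst \<tau> 0 = 1"
  by (simp add: mono_subst_def)

lemma subst_superset:
  assumes "finite S" "Poly_Mapping.keys f \<subseteq> S"
  shows "subst \<tau> f = (\<Sum>m\<in>S. Poly_Mapping.single 0 (Poly_Mapping.lookup f m) * mono_subst \<tau> m)"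
  unfolding subst_def using assms
  by (intro sum.mono_neutral_left) (auto simp: in_keys_iff)

lemma subst_0 [simp]: "subst \<tau> 0 = 0"
  by (simp add: subst_def)

lemma subst_add: "subst \<tau> (f + g) = subst \<tau> f + subst \<tau> g"
proof -
  let ?S = "Poly_Mapping.keys f \<union> Poly_Mapping.keys g"
  have "subst \<tau> (f + g) =
      (\<Sum>m\<in>?S. Poly_Mapping.single 0 (Poly_Mapping.lookup (f + g) m) * mono_subst \<tau> m)"
    by (rule subst_superset) (auto simp: Poly_Mapping.keys_add)
  also have "\<dots> = subst \<tau> f + subst \<tau> g"
    by (subst (1 2) subst_superset[of ?S])
      (auto simp: lookup_add single_add ring_distribs sum.distrib)
  finally show ?thesis .
qed

lemma subst_single:
  "subst \<tau> (Poly_Mapping.single m c) = Poly_Mapping.single 0 c * mono_subst \<tau> m"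
  by (subst subst_superset[of "{m}"]) auto

lemma subst_mult: "subst \<tau> (f * g) = subst \<tau> f * subst \<tau> g"
proof (induction f rule: cpoly_induct)
  case (single m c)
  show ?case
  proof (induction g rule: cpoly_induct)
    case (single m' c')
    have "Poly_Mapping.single 0 (c * c') = (Poly_Mapping.single 0 c * Poly_Mapping.single 0 c' :: cpoly)"
      by (simp add: mult_single)
    then show ?case
      by (simp add: mult_single subst_single mono_subst_add)
  qed (simp_all add: subst_add ring_distribs)
qed (simp_all add: subst_add ring_distribs)

lemma subst_const [simp]: "subst \<tau> (Poly_Mapping.single 0 c) = Poly_Mapping.single 0 c"
  by (simp add: subst_single)

lemma subst_1 [simp]: "subst \<tau> 1 = 1"
  using subst_const[of \<tau> 1] by simp

lemma subst_tvar [simp]: "subst \<tau> (tvar i) = \<tau> i"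
  by (simp add: tvar_def subst_single mono_subst_def)

lemma subst_uminus: "subst \<tau> (- f) = - subst \<tau> f"
  using subst_add[of \<tau> f "- f"] by (simp add: eq_neg_iff_add_eq_0 add.commute)

lemma subst_diff: "subst \<tau> (f - g) = subst \<tau> f - subst \<tau> g"
  using subst_add[of \<tau> f "- g"] by (simp add: subst_uminus)

lemma subst_sum: "subst \<tau> (sum f A) = (\<Sum>a\<in>A. subst \<tau> (f a))"
  by (induction A rule: infinite_finite_induct) (auto simp: subst_add)

lemma subst_prod: "subst \<tau> (prod f A) = (\<Prod>a\<in>A. subst \<tau> (f a))"
  by (induction A rule: infinite_finite_induct) (auto simp: subst_mult)

lemma subst_power: "subst \<tau> (f ^ k) = subst \<tau> f ^ k"
  by (induction k) (auto simp: subst_mult)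

lemmas subst_hom = subst_add subst_mult subst_diff subst_uminus subst_sum subst_prod subst_power

lemma mono_subst_tvar: "mono_subst tvar m = Poly_Mapping.single m 1"
proof -
  have pow: "tvar i ^ k = Poly_Mapping.single (Poly_Mapping.single i k) 1" for i k
    by (induction k) (auto simp: tvar_def mult_single simp flip: single_add)
  have "(\<Prod>i\<in>S. tvar i ^ Poly_Mapping.lookup m i) =
      Poly_Mapping.single (\<Sum>i\<in>S. Poly_Mapping.single i (Poly_Mapping.lookup m i)) 1" if "finite S" for S
    using that by (induction S) (auto simp: pow mult_single)
  then show ?thesis
    by (simp add: mono_subst_def flip: poly_mapping_eq_sum_single)
qed

lemma subst_id [simp]: "subst tvar f = f"
  by (induction f rule: cpoly_induct) (auto simp: subst_add subst_single mono_subst_tvar mult_single)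

lemma dvd_diff_mult:
  fixes a b a' b' d :: "'a::comm_ring_1"
  assumes "d dvd a - a'" "d dvd b - b'"
  shows "d dvd a * b - a' * b'"
proof -
  have "a * b - a' * b' = (a - a') * b + a' * (b - b')" by (simp add: algebra_simps)
  with assms show ?thesis by simp
qed

lemma dvd_diff_prod:
  fixes f g :: "'b \<Rightarrow> 'a::comm_ring_1"
  assumes "\<And>i. i \<in> A \<Longrightarrow> d dvd f i - g i"
  shows "d dvd prod f A - prod g A"
  using assms by (induction A rule: infinite_finite_induct) (auto intro: dvd_diff_mult)

lemma dvd_diff_power:
  fixes a b :: "'a::comm_ring_1"
  shows "d dvd a - b \<Longrightarrow> d dvd a ^ k - b ^ k"
  by (induction k) (auto intro: dvd_diff_mult)

lemma subst_cong_dvd: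
  assumes "\<And>i. d dvd \<tau> i - \<tau>' i"
  shows "d dvd subst \<tau> f - subst \<tau>' f"
proof (induction f rule: cpoly_induct)
  case (single m c)
  have "d dvd (\<Prod>i\<in>Poly_Mapping.keys m. \<tau> i ^ Poly_Mapping.lookup m i) -
      (\<Prod>i\<in>Poly_Mapping.keys m. \<tau>' i ^ Poly_Mapping.lookup m i)"
    by (intro dvd_diff_prod dvd_diff_power assms)
  then show ?case
    by (auto simp: subst_single mono_subst_def simp flip: right_diff_distrib)
next
  case (add f g)
  then show ?case
    by (simp add: subst_add add_diff_add)
qed auto

text \<open>Setting \<open>t\<^sub>k := t\<^sub>l\<close> is a ring homomorphism with the kernel
  generated by \<open>t\<^sub>k - t\<^sub>l\<close>. It turns the divisibility conditions into
  equations over a domain in which all other variables stay distinct.\<close>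

definition identify :: "nat \<Rightarrow> nat \<Rightarrow> nat \<Rightarrow> cpoly" where
  "identify k l = tvar(k := tvar l)"

lemma dvd_iff_identify: "tvar k - tvar l dvd f \<longleftrightarrow> subst (identify k l) f = 0"
proof
  assume "tvar k - tvar l dvd f"
  then show "subst (identify k l) f = 0"
    by (auto simp: identify_def subst_hom elim!: dvdE)
next
  have "tvar k - tvar l dvd subst tvar f - subst (identify k l) f"
    by (rule subst_cong_dvd) (auto simp: identify_def)
  then show "tvar k - tvar l dvd f" if "subst (identify k l) f = 0"
    using that by simp
qed

lemma tvar_eq_iff [simp]: "tvar i = tvar j \<longleftrightarrow> i = j"
  by (metis inj_single injD tvar_def zero_neq_one lookup_single_eq lookup_single_not_eq one_neq_zero)

text \<open>Setting the other variables to zero is a retraction onto \<open>\<complex>[t\<^sub>1,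
  \<dots>, t\<^sub>n]\<close>. It serves to replace coefficients found among all polynomials by
  coefficients in these variables.\<close>

definition drop_vars :: "nat \<Rightarrow> cpoly \<Rightarrow> cpoly" where
  "drop_vars n = subst (\<lambda>i. if i \<in> {1..n} then tvar i else 0)"

lemma polys_0 [simp]: "0 \<in> polys n"
  by (simp add: polys_def)

lemma polys_const [simp]: "Poly_Mapping.single 0 c \<in> polys n"
  by (simp add: polys_def)

lemma polys_1 [simp]: "1 \<in> polys n"
  using polys_const[of 1 n] by simp

lemma polys_tvar [simp]: "tvar i \<in> polys n \<longleftrightarrow> i \<in> {1..n}"
  by (simp add: polys_def tvar_def)

lemma polys_add: "f \<in> polys n \<Longrightarrow> g \<in> polys n \<Longrightarrow> f + g \<in> polys n"
  using Poly_Mapping.keys_add[of f g] unfolding polys_def by blast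

lemma polys_uminus: "f \<in> polys n \<Longrightarrow> - f \<in> polys n"
  by (simp add: polys_def in_keys_iff)

lemma polys_diff: "f \<in> polys n \<Longrightarrow> g \<in> polys n \<Longrightarrow> f - g \<in> polys n"
  using polys_add[OF _ polys_uminus, of f n g] by simp

lemma polys_mult:
  assumes "f \<in> polys n" "g \<in> polys n"
  shows "f * g \<in> polys n"
  unfolding polys_def
proof safe
  fix m i assume m: "m \<in> Poly_Mapping.keys (f * g)" and i: "i \<in> Poly_Mapping.keys m"
  obtain a b where "m = a + b" "a \<in> Poly_Mapping.keys f" "b \<in> Poly_Mapping.keys g"
    using keys_mult[of f g] m by blast
  then show "i \<in> {1..n}"
    using assms i Poly_Mapping.keys_add[of a b] unfolding polys_def by blast
qed

lemma polys_sum: "(\<And>a. a \<in> A \<Longrightarrow> f a \<in> polys n) \<Longrightarrow> sum f A \<in> polys n"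
  by (induction A rule: infinite_finite_induct) (auto intro: polys_add)

lemma polys_prod: "(\<And>a. a \<in> A \<Longrightarrow> f a \<in> polys n) \<Longrightarrow> prod f A \<in> polys n"
  by (induction A rule: infinite_finite_induct) (auto intro: polys_mult)

lemma polys_power: "f \<in> polys n \<Longrightarrow> f ^ k \<in> polys n"
  by (induction k) (auto intro: polys_mult)

lemmas polys_intros = polys_add polys_uminus polys_diff polys_mult polys_sum polys_prod polys_power

lemma polys_keysD:
  "f \<in> polys n \<Longrightarrow> m \<in> Poly_Mapping.keys f \<Longrightarrow> i \<in> Poly_Mapping.keys m \<Longrightarrow> i \<in> {1..n}"
  unfolding polys_def by blast

lemma subst_in_polys:
  assumes "f \<in> polys n" "\<And>i. i \<in> {1..n} \<Longrightarrow> \<tau> i \<in> polys n"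
  shows "subst \<tau> f \<in> polys n"
  unfolding subst_def mono_subst_def
  by (intro polys_intros polys_const assms(2)) (rule polys_keysD[OF assms(1)])

lemma drop_vars_in_polys: "drop_vars n f \<in> polys n"
  unfolding drop_vars_def subst_def mono_subst_def
  by (intro polys_intros polys_const) auto

lemma subst_cong_polys:
  assumes "f \<in> polys n" "\<And>i. i \<in> {1..n} \<Longrightarrow> \<tau> i = \<tau>' i"
  shows "subst \<tau> f = subst \<tau>' f"
  unfolding subst_def mono_subst_def
  by (intro sum.cong arg_cong2[where f = "(*)"] arg_cong2[where f = "(^)"] prod.cong refl assms(2))
    (rule polys_keysD[OF assms(1)])

lemma drop_vars_id: "f \<in> polys n \<Longrightarrow> drop_vars n f = f"
  unfolding drop_vars_def by (subst subst_cong_polys[where \<tau>' = tvar]) auto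

text \<open>Apply the retraction to a quotient in the larger ring.\<close>

lemma polys_dvdE:
  assumes "d dvd f" "d \<in> polys n" "f \<in> polys n"
  obtains q where "q \<in> polys n" "f = d * q"
proof -
  obtain q where "f = d * q" using assms by (elim dvdE)
  then have "drop_vars n f = drop_vars n d * drop_vars n q"
    by (simp add: drop_vars_def subst_hom)
  then have "f = d * drop_vars n q"
    using assms by (simp add: drop_vars_id)
  then show ?thesis using that drop_vars_in_polys by blast
qed

definition total_degree :: "(nat \<Rightarrow>\<^sub>0 nat) \<Rightarrow> nat" where
  "total_degree m = (\<Sum>i\<in>Poly_Mapping.keys m. Poly_Mapping.lookup m i)"

lemma total_degree_superset:
  assumes "finite S" "Poly_Mapping.keys m \<subseteq> S"
  shows "total_degree m = (\<Sum>i\<in>S. Poly_Mapping.lookup m i)"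
  unfolding total_degree_def using assms
  by (intro sum.mono_neutral_left) (auto simp: in_keys_iff)

lemma total_degree_add: "total_degree (m + m') = total_degree m + total_degree m'"
proof -
  let ?S = "Poly_Mapping.keys m \<union> Poly_Mapping.keys m'"
  have "total_degree (m + m') = (\<Sum>i\<in>?S. Poly_Mapping.lookup (m + m') i)"
    by (rule total_degree_superset) (auto simp: Poly_Mapping.keys_add)
  also have "\<dots> = total_degree m + total_degree m'"
    by (subst (1 2) total_degree_superset[of ?S]) (auto simp: lookup_add sum.distrib)
  finally show ?thesis .
qed

lemma total_degree_eq_0 [simp]: "total_degree m = 0 \<longleftrightarrow> m = 0"
  by (auto simp: total_degree_def in_keys_iff intro!: poly_mapping_eqI)

definition homog :: "nat \<Rightarrow> cpoly \<Rightarrow> bool" where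
  "homog k f \<longleftrightarrow> (\<forall>m. Poly_Mapping.lookup f m \<noteq> 0 \<longrightarrow> total_degree m = k)"

lemma homog_polys_iff: "f \<in> homog_polys n k \<longleftrightarrow> f \<in> polys n \<and> homog k f"
  by (auto simp: homog_polys_def homog_def total_degree_def in_keys_iff)

lemma homog_0 [simp]: "homog k 0"
  by (simp add: homog_def)

lemma homog_add: "homog k f \<Longrightarrow> homog k g \<Longrightarrow> homog k (f + g)"
  unfolding homog_def by (metis lookup_add add.right_neutral)

lemma homog_uminus: "homog k f \<Longrightarrow> homog k (- f)"
  by (simp add: homog_def)

lemma homog_diff: "homog k f \<Longrightarrow> homog k g \<Longrightarrow> homog k (f - g)"
  using homog_add[OF _ homog_uminus, of k f g] by simp

lemma homog_single: "total_degree m = k \<Longrightarrow> homog k (Poly_Mapping.single m c)"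
  by (auto simp: homog_def lookup_single when_def split: if_splits)

lemma homog_const: "homog 0 (Poly_Mapping.single 0 c)"
  by (rule homog_single) simp

lemma homog_1: "homog 0 1"
  using homog_const[of 1] by simp

lemma homog_tvar: "homog 1 (tvar i)"
  unfolding tvar_def by (rule homog_single) (simp add: total_degree_def)

lemma homog_mult:
  assumes "homog k f" "homog l g"
  shows "homog (k + l) (f * g)"
  unfolding homog_def
proof safe
  fix m assume "Poly_Mapping.lookup (f * g) m \<noteq> 0"
  then obtain a b where "m = a + b" "a \<in> Poly_Mapping.keys f" "b \<in> Poly_Mapping.keys g"
    using keys_mult[of f g] by (auto simp: in_keys_iff)
  then show "total_degree m = k + l"
    using assms by (auto simp: total_degree_add homog_def in_keys_iff)
qed

lemma homog_sum: "(\<And>a. a \<in> A \<Longrightarrow> homog k (f a)) \<Longrightarrow> homog k (sum f A)"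
  by (induction A rule: infinite_finite_induct) (auto intro: homog_add)

lemma homog_prod: "(\<And>a. a \<in> A \<Longrightarrow> homog (k a) (f a)) \<Longrightarrow> homog (sum k A) (prod f A)"
  by (induction A rule: infinite_finite_induct) (auto intro: homog_mult homog_1)

lemma homog_power: "homog k f \<Longrightarrow> homog (k * j) (f ^ j)"
proof (induction j)
  case (Suc j)
  then show ?case using homog_mult[of k f "k * j" "f ^ j"] by simp
qed (simp add: homog_1)

lemma homog_subst_tvar:
  assumes "homog k f"
  shows "homog k (subst (\<lambda>i. tvar (v i)) f)"
  unfolding subst_def
proof (rule homog_sum)
  fix m assume "m \<in> Poly_Mapping.keys f"
  then have m: "total_degree m = k"
    using assms by (auto simp: homog_def in_keys_iff)
  have "homog (\<Sum>i\<in>Poly_Mapping.keys m. 1 * Poly_Mapping.lookup m i)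
      (mono_subst (\<lambda>i. tvar (v i)) m)"
    unfolding mono_subst_def by (intro homog_prod homog_power homog_tvar)
  then have "homog k (mono_subst (\<lambda>i. tvar (v i)) m)"
    by (simp add: m flip: total_degree_def)
  then show "homog k (Poly_Mapping.single 0 (Poly_Mapping.lookup f m) * mono_subst (\<lambda>i. tvar (v i)) m)"
    using homog_mult[OF homog_const] by fastforce
qed

definition component :: "nat \<Rightarrow> cpoly \<Rightarrow> cpoly" where
  "component k f = (\<Sum>m | m \<in> Poly_Mapping.keys f \<and> total_degree m = k.
     Poly_Mapping.single m (Poly_Mapping.lookup f m))"

lemma lookup_component:
  "Poly_Mapping.lookup (component k f) m = (if total_degree m = k then Poly_Mapping.lookup f m else 0)"
  by (simp add: component_def lookup_sum lookup_single when_def in_keys_iff sum.delta)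

lemma component_0 [simp]: "component k 0 = 0"
  by (simp add: component_def)

lemma component_add: "component k (f + g) = component k f + component k g"
  by (rule poly_mapping_eqI) (simp add: lookup_component lookup_add)

lemma component_sum: "component k (sum f A) = (\<Sum>a\<in>A. component k (f a))"
  by (induction A rule: infinite_finite_induct) (auto simp: component_add)

lemma component_homog: "homog k f \<Longrightarrow> component l f = (if k = l then f else 0)"
  by (rule poly_mapping_eqI) (auto simp: homog_def lookup_component)

lemma component_in_polys: "f \<in> polys n \<Longrightarrow> component k f \<in> polys n"
  by (auto simp: polys_def in_keys_iff lookup_component split: if_splits)

lemma component_mult_homog:
  assumes "homog e g"
  shows "component d (f * g) = (if e \<le> d then component (d - e) f * g else 0)"
proof (induction f rule: cpoly_induct)
  case (single m c)
  have s: "homog (total_degree m) (Poly_Mapping.single m c)" by (rule homog_single) simp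
  show ?case
    using homog_mult[OF s assms] s by (auto simp: component_homog)
qed (auto simp: component_add ring_distribs)

section \<open>Interpolation in one variable\<close>

text \<open>Induction on the set of nodes. For a new node \<open>l\<close> the values are \<open>P
  k = P l + (t\<^sub>k - t\<^sub>l) R k\<close>, and the divided differences \<open>R\<close>
  satisfy the divisibility conditions again, because \<open>t\<^sub>k - t\<^sub>l\<close> is not a
  zero divisor modulo \<open>t\<^sub>k - t\<^bsub>k'\<^esub>\<close>.\<close>

lemma newton_interpolation:
  fixes P :: "nat \<Rightarrow> cpoly"
  assumes "finite A" "\<And>k l. k \<in> A \<Longrightarrow> l \<in> A \<Longrightarrow> tvar k - tvar l dvd P k - P l"
  shows "\<exists>Q. \<forall>k\<in>A. P k = (\<Sum>i<card A. Q i * tvar k ^ i)"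
  using assms
proof (induction A arbitrary: P rule: finite_induct)
  case (insert l A)
  have "\<exists>R. P k = P l + (tvar k - tvar l) * R" if "k \<in> A" for k
  proof -
    have "tvar k - tvar l dvd P k - P l" using insert.prems that by simp
    then obtain r where "P k - P l = (tvar k - tvar l) * r" by (rule dvdE)
    then have "P k = P l + (tvar k - tvar l) * r" by (metis add.commute diff_add_cancel)
    then show ?thesis ..
  qed
  then obtain R where R: "\<And>k. k \<in> A \<Longrightarrow> P k = P l + (tvar k - tvar l) * R k"
    by metis
  have "tvar k - tvar k' dvd R k - R k'" if "k \<in> A" "k' \<in> A" for k k'
  proof (cases "k = k'")
    case False
    let ?s = "subst (identify k k')"
    have "?s (P k - P k') = 0"
      using insert.prems[of k k'] that by (simp add: dvd_iff_identify)
    moreover have "?s (P k - P k') = (?s (tvar k) - ?s (tvar l)) * ?s (R k) - (?s (tvar k') - ?s (tvar l)) * ?s (R k')"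
      unfolding R[OF that(1)] R[OF that(2)] by (simp only: subst_hom) simp
    ultimately have "(tvar k' - tvar l) * (?s (R k) - ?s (R k')) = 0"
      using that insert.hyps False by (cases "l = k") (auto simp: identify_def right_diff_distrib)
    moreover have "k' \<noteq> l" using that insert.hyps by auto
    ultimately show ?thesis by (simp add: dvd_iff_identify subst_diff)
  qed simp
  then obtain Q where Q: "\<And>k. k \<in> A \<Longrightarrow> R k = (\<Sum>i<card A. Q i * tvar k ^ i)"
    using insert.IH[of R] by blast
  \<comment> \<open>The coefficients of \<open>P l + (X - t\<^sub>l) \<Sum>\<^sub>i Q i
    X\<^sup>i\<close> as a polynomial in \<open>X\<close>.\<close>
  define Q' where "Q' i = (if i = 0 then P l - tvar l * (if card A = 0 then 0 else Q 0)
      else Q (i - 1) - tvar l * (if i < card A then Q i else 0))" for i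
  have shift: "(\<Sum>i<Suc m. (if i = 0 then C - a * (if m = 0 then 0 else q 0)
        else q (i - 1) - a * (if i < m then q i else 0)) * x ^ i)
      = C + (x - a) * (\<Sum>i<m. q i * x ^ i)" for m and C a x :: cpoly and q
  proof -
    have 1: "(\<Sum>i<m. q i * x ^ i) = (\<Sum>i<Suc m. (if i < m then q i else 0) * x ^ i)"
      by simp
    have "(\<Sum>i<Suc m. (if i = 0 then C - a * (if m = 0 then 0 else q 0)
        else q (i - 1) - a * (if i < m then q i else 0)) * x ^ i)
      = (\<Sum>i<Suc m. (if i = 0 then C else q (i - 1)) * x ^ i - a * ((if i < m then q i else 0) * x ^ i))"
      by (rule sum.cong) (auto simp: algebra_simps)
    also have "\<dots> = (\<Sum>i<Suc m. (if i = 0 then C else q (i - 1)) * x ^ i) - a * (\<Sum>i<m. q i * x ^ i)"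
      unfolding 1 by (simp only: sum_subtractf sum_distrib_left)
    also have "(\<Sum>i<Suc m. (if i = 0 then C else q (i - 1)) * x ^ i) = C + x * (\<Sum>i<m. q i * x ^ i)"
      unfolding sum.lessThan_Suc_shift by (simp add: sum_distrib_left algebra_simps)
    finally show ?thesis by (simp add: algebra_simps)
  qed
  have "P k = (\<Sum>i<card (insert l A). Q' i * tvar k ^ i)" if "k \<in> insert l A" for k
  proof -
    have "(\<Sum>i<card (insert l A). Q' i * tvar k ^ i) = P l + (tvar k - tvar l) * (\<Sum>i<card A. Q i * tvar k ^ i)"
      unfolding Q'_def card_insert_disjoint[OF insert.hyps]
      by (rule shift[of "P l" "tvar l" "card A" Q "tvar k"])
    also have "\<dots> = P k"
    proof (cases "k = l")
      case False
      then have "k \<in> A" using that by simp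
      then show ?thesis using R[of k] Q[of k] by simp
    qed simp
    finally show ?thesis ..
  qed
  then show ?case by blast
qed simp

text \<open>A nonzero polynomial of degree less than \<open>d\<close> has fewer than
  \<open>d\<close> roots.\<close>

lemma powers_independent:
  fixes \<tau> :: "'b \<Rightarrow> 'a::idom"
  assumes "finite A" "inj_on \<tau> A" "\<And>k. k \<in> A \<Longrightarrow> (\<Sum>i<d. q i * \<tau> k ^ i) = 0" "d \<le> card A" "i < d"
  shows "q i = 0"
proof -
  define p where "p = (\<Sum>i<d. monom (q i) i)"
  have coeff: "coeff p j = (if j < d then q j else 0)" for j
    by (simp add: p_def coeff_sum)
  have "p = 0"
  proof (rule ccontr)
    assume "p \<noteq> 0"
    have "\<tau> ` A \<subseteq> {x. poly p x = 0}"
      using assms(3) by (auto simp: p_def poly_sum poly_monom)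
    then have "card (\<tau> ` A) \<le> card {x. poly p x = 0}"
      using \<open>p \<noteq> 0\<close> by (intro card_mono poly_roots_finite)
    also have "\<dots> \<le> degree p" using \<open>p \<noteq> 0\<close> by (rule card_poly_roots_bound)
    also have "degree p < d"
      using \<open>p \<noteq> 0\<close> by (metis coeff leading_coeff_neq_0)
    finally show False using assms by (simp add: card_image)
  qed
  then show ?thesis using coeff[of i] \<open>i < d\<close> by simp
qed

text \<open>Let \<open>R = \<Prod>(X - \<tau> l)\<close> and let \<open>S\<close> be the quotient
  of \<open>R - R(y)\<close> by \<open>X - y\<close>, which is monic of degree \<open>d\<close>.
  As \<open>R\<close> vanishes at \<open>\<tau> k\<close>, evaluation at \<open>\<tau> k\<close>
  gives \<open>S(\<tau> k) = R(y) / (y - \<tau> k)\<close>, which is the product without the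
  factor for \<open>k\<close>. The point is that the coefficients of \<open>S\<close> are the same
  for all \<open>k\<close>.\<close>

lemma omitted_product_expansion:
  fixes \<tau> :: "'b \<Rightarrow> 'a::idom"
  assumes "finite A" "card A = Suc d" "y \<notin> \<tau> ` A"
  shows "\<exists>s. \<forall>k\<in>A. (\<Prod>l\<in>A - {k}. y - \<tau> l) = \<tau> k ^ d + (\<Sum>i<d. s i * \<tau> k ^ i)"
proof -
  define R where "R = (\<Prod>l\<in>A. [:- \<tau> l, 1:])"
  define S where "S = synthetic_div R y"
  have deg: "degree R = Suc d"
    unfolding R_def using assms by (subst degree_prod_eq_sum_degree) auto
  have lead: "coeff R (Suc d) = 1"
    using lead_coeff_prod[of "\<lambda>l. [:- \<tau> l, 1:]" A] unfolding deg[symmetric] R_def by simp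
  have dS: "degree S = d"
    by (simp add: S_def degree_synthetic_div deg)
  have eq: "[:- y, 1:] * S + [:poly R y:] = R"
    unfolding S_def by (rule synthetic_div_correct')
  have "coeff R (Suc d) = coeff S d - y * coeff S (Suc d)"
    by (subst eq[symmetric]) simp
  then have lS: "coeff S d = 1"
    using lead dS by (simp add: coeff_eq_0)
  have "(\<Prod>l\<in>A - {k}. y - \<tau> l) = \<tau> k ^ d + (\<Sum>i<d. coeff S i * \<tau> k ^ i)" if "k \<in> A" for k
  proof -
    have "poly R (\<tau> k) = 0"
      using that assms by (auto simp: R_def poly_prod)
    then have "(\<tau> k - y) * poly S (\<tau> k) + poly R y = 0"
      by (subst (asm) eq[symmetric]) (simp add: algebra_simps)
    moreover have "poly R y = (y - \<tau> k) * (\<Prod>l\<in>A - {k}. y - \<tau> l)"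
      using that assms by (simp add: R_def poly_prod prod.remove[of A k] left_diff_distrib)
    ultimately have "(y - \<tau> k) * ((\<Prod>l\<in>A - {k}. y - \<tau> l) - poly S (\<tau> k)) = 0"
      by (simp add: algebra_simps)
    moreover have "y - \<tau> k \<noteq> 0" using that assms by auto
    ultimately have "(\<Prod>l\<in>A - {k}. y - \<tau> l) = poly S (\<tau> k)" by simp
    also have "\<dots> = (\<Sum>i\<le>d. coeff S i * \<tau> k ^ i)"
      by (simp add: poly_altdef dS)
    finally show ?thesis
      by (simp add: lS add.commute flip: lessThan_Suc_atMost)
  qed
  then show ?thesis by blast
qed

text \<open>The powers of \<open>\<tau> k\<close> below \<open>card A\<close>, where in case
  \<open>B\<close> the highest one is replaced by the product that omits \<open>k\<close>. If
  \<open>y\<close> is not among the values of \<open>\<tau>\<close>, this product is monic of the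
  same degree in \<open>\<tau> k\<close>, so the change of basis is unitriangular.\<close>

definition level_fun :: "bool \<Rightarrow> 'b set \<Rightarrow> 'a::idom \<Rightarrow> ('b \<Rightarrow> 'a) \<Rightarrow> nat \<Rightarrow> 'b \<Rightarrow> 'a" where
  "level_fun B A y \<tau> i k =
     (if B \<and> Suc i = card A then \<Prod>l\<in>A - {k}. y - \<tau> l else \<tau> k ^ i)"

lemma level_fun_change_basis:
  fixes \<tau> :: "'b \<Rightarrow> 'a::idom"
  assumes "finite A" "\<not> B \<or> y \<notin> \<tau> ` A"
  shows "\<exists>s. \<forall>q. \<forall>k\<in>A. (\<Sum>i<card A. q i * level_fun B A y \<tau> i k) =
       (\<Sum>i<card A. (if Suc i = card A then q i else q i + q (card A - 1) * s i) * \<tau> k ^ i)"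
proof (cases "B \<and> card A > 0")
  case True
  then obtain d where d: "card A = Suc d" by (cases "card A") auto
  have "y \<notin> \<tau> ` A" using assms(2) True by simp
  from omitted_product_expansion[OF assms(1) d this]
  obtain s where s: "\<forall>k\<in>A. (\<Prod>l\<in>A - {k}. y - \<tau> l) = \<tau> k ^ d + (\<Sum>i<d. s i * \<tau> k ^ i)"
    by (rule exE)
  have "(\<Sum>i<card A. q i * level_fun B A y \<tau> i k) =
      (\<Sum>i<card A. (if Suc i = card A then q i else q i + q (card A - 1) * s i) * \<tau> k ^ i)"
    if "k \<in> A" for q k
  proof -
    have "(\<Sum>i<card A. q i * level_fun B A y \<tau> i k) =
        (\<Sum>i<d. q i * \<tau> k ^ i) + q d * (\<tau> k ^ d + (\<Sum>i<d. s i * \<tau> k ^ i))"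
      using True by (simp add: d level_fun_def s that)
    also have "\<dots> = (\<Sum>i<d. (q i + q d * s i) * \<tau> k ^ i) + q d * \<tau> k ^ d"
      by (simp add: distrib_right distrib_left sum.distrib sum_distrib_left mult.assoc)
    finally show ?thesis by (simp add: d)
  qed
  then show ?thesis by (intro exI[of _ s] allI ballI)
next
  case False
  then have "level_fun B A y \<tau> i k = \<tau> k ^ i" if "i < card A" for i k
    using that by (auto simp: level_fun_def)
  then show ?thesis
    by (intro exI[of _ "\<lambda>_. 0"] allI ballI sum.cong refl) simp
qed

lemma level_fun_independent:
  fixes \<tau> :: "'b \<Rightarrow> 'a::idom"
  assumes "finite A" "inj_on \<tau> A" "\<not> B \<or> y \<notin> \<tau> ` A"
    and zero: "\<And>k. k \<in> A \<Longrightarrow> (\<Sum>i<card A. q i * level_fun B A y \<tau> i k) = 0" and "i < card A"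
  shows "q i = 0"
proof -
  obtain s where s: "\<forall>q. \<forall>k\<in>A. (\<Sum>i<card A. q i * level_fun B A y \<tau> i k) =
       (\<Sum>i<card A. (if Suc i = card A then q i else q i + q (card A - 1) * s i) * \<tau> k ^ i)"
    using level_fun_change_basis[OF assms(1,3)] by (rule exE)
  have z: "(\<Sum>i<card A. (if Suc i = card A then q i else q i + q (card A - 1) * s i) * \<tau> k ^ i) = 0"
    if "k \<in> A" for k
    using s[THEN spec, THEN bspec, OF that, of q] zero[OF that] by (rule trans[OF sym])
  have *: "(if Suc i = card A then q i else q i + q (card A - 1) * s i) = 0" if "i < card A" for i
    by (rule powers_independent[OF assms(1,2) _ order_refl that]) (rule z)
  have "q (card A - 1) = 0" using *[of "card A - 1"] \<open>i < card A\<close> by auto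
  then show ?thesis using *[of i] \<open>i < card A\<close> by (auto split: if_splits)
qed

lemma level_fun_interpolation:
  fixes P :: "nat \<Rightarrow> cpoly"
  assumes "finite A" "\<not> B \<or> u \<notin> A"
    and "\<And>k l. k \<in> A \<Longrightarrow> l \<in> A \<Longrightarrow> tvar k - tvar l dvd P k - P l"
  shows "\<exists>Q. \<forall>k\<in>A. P k = (\<Sum>i<card A. Q i * level_fun B A (tvar u) tvar i k)"
proof -
  obtain Q where Q: "\<forall>k\<in>A. P k = (\<Sum>i<card A. Q i * tvar k ^ i)"
    using newton_interpolation[OF assms(1,3)] by (rule exE)
  have "\<not> B \<or> tvar u \<notin> tvar ` A" using assms by auto
  from level_fun_change_basis[OF assms(1) this]
  obtain s where s: "\<forall>q. \<forall>k\<in>A. (\<Sum>i<card A. q i * level_fun B A (tvar u) tvar i k) =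
       (\<Sum>i<card A. (if Suc i = card A then q i else q i + q (card A - 1) * s i) * tvar k ^ i)"
    by (rule exE)
  define Q' where "Q' i = (if Suc i = card A then Q i else Q i - Q (card A - 1) * s i)" for i
  have "P k = (\<Sum>i<card A. Q' i * level_fun B A (tvar u) tvar i k)" if "k \<in> A" for k
  proof -
    have "(\<Sum>i<card A. Q' i * level_fun B A (tvar u) tvar i k) =
       (\<Sum>i<card A. (if Suc i = card A then Q' i else Q' i + Q' (card A - 1) * s i) * tvar k ^ i)"
      by (rule s[THEN spec, THEN bspec, OF that])
    also have "\<dots> = (\<Sum>i<card A. Q i * tvar k ^ i)"
      by (intro sum.cong refl) (auto simp: Q'_def)
    finally show ?thesis using Q that by simp
  qed
  then show ?thesis by (intro exI[of _ Q'] ballI)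
qed

section \<open>Monomials in the tautological classes\<close>

text \<open>For \<open>p > a\<close> the exponent \<open>p - 2\<close>, which is the largest one
  at position \<open>p\<close>, stands for a product instead of the power
  \<open>x\<^sub>p\<^bsup>p-2\<^esup>\<close>. The product vanishes as soon as
  \<open>x\<^sub>1\<close> coincides with one of \<open>x\<^sub>2, \<dots>,
  x\<^bsub>p-1\<^esub>\<close>. The variables range over an arbitrary ring so that they can be
  specialised.\<close>

definition level_factor :: "nat \<Rightarrow> nat \<Rightarrow> nat \<Rightarrow> (nat \<Rightarrow> 'a::comm_ring_1) \<Rightarrow> 'a" where
  "level_factor a p i x = (if a < p \<and> Suc (Suc i) = p then \<Prod>q=2..<p. x 1 - x q else x p ^ i)"

definition taut :: "nat \<Rightarrow> nat \<Rightarrow> (nat \<Rightarrow> nat) \<Rightarrow> (nat \<Rightarrow> 'a::comm_ring_1) \<Rightarrow> 'a" where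
  "taut a m c x = (\<Prod>p=2..m. level_factor a p (c p) x)"

text \<open>The exponents of the staircase monomials of Artin, which form a basis of the
  cohomology of a flag variety; the positions start from \<open>2\<close>.\<close>

definition all_exps :: "nat \<Rightarrow> (nat \<Rightarrow> nat) set" where
  "all_exps m = (\<Pi>\<^sub>E p\<in>{2..m}. {..<p - 1})"

text \<open>The exponents for which no power is replaced, so that \<open>taut\<close> is an honest
  monomial.\<close>

definition low_exps :: "nat \<Rightarrow> nat \<Rightarrow> (nat \<Rightarrow> nat) set" where
  "low_exps a m = (\<Pi>\<^sub>E p\<in>{2..m}. {..<(if a < p then p - 2 else p - 1)})"

lemma finite_all_exps [simp]: "finite (all_exps m)"
  unfolding all_exps_def by (intro finite_PiE) auto

lemma low_exps_subset: "low_exps a m \<subseteq> all_exps m"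
  unfolding all_exps_def low_exps_def by (intro PiE_mono) auto

lemma finite_low_exps [simp]: "finite (low_exps a m)"
  by (rule finite_subset[OF low_exps_subset]) simp

lemma sum_PiE_Suc:
  fixes g :: "(nat \<Rightarrow> nat) \<Rightarrow> 'a::comm_monoid_add"
  assumes "m \<ge> 1"
  shows "(\<Sum>c\<in>(\<Pi>\<^sub>E p\<in>{2..Suc m}. C p). g c) =
    (\<Sum>c\<in>(\<Pi>\<^sub>E p\<in>{2..m}. C p). \<Sum>i\<in>C (Suc m). g (c(Suc m := i)))"
proof -
  have "{2..Suc m} = insert (Suc m) {2..m}" using assms by auto
  then have eq: "(\<Pi>\<^sub>E p\<in>{2..Suc m}. C p) = (\<lambda>(i, c). c(Suc m := i)) ` (C (Suc m) \<times> (\<Pi>\<^sub>E p\<in>{2..m}. C p))"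
    by (simp only: PiE_insert_eq)
  have "inj_on (\<lambda>(i, c). c(Suc m := i)) (C (Suc m) \<times> (\<Pi>\<^sub>E p\<in>{2..m}. C p))"
    by (rule inj_combinator) simp
  then have "(\<Sum>c\<in>(\<Pi>\<^sub>E p\<in>{2..Suc m}. C p). g c) =
      (\<Sum>ic\<in>C (Suc m) \<times> (\<Pi>\<^sub>E p\<in>{2..m}. C p). g (case ic of (i, c) \<Rightarrow> c(Suc m := i)))"
    unfolding eq by (subst sum.reindex) (simp_all only: o_def)
  also have "\<dots> = (\<Sum>(i, c)\<in>C (Suc m) \<times> (\<Pi>\<^sub>E p\<in>{2..m}. C p). g (c(Suc m := i)))"
    by (rule sum.cong) auto
  also have "\<dots> = (\<Sum>i\<in>C (Suc m). \<Sum>c\<in>(\<Pi>\<^sub>E p\<in>{2..m}. C p). g (c(Suc m := i)))"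
    by (rule sum.cartesian_product[symmetric])
  also have "\<dots> = (\<Sum>c\<in>(\<Pi>\<^sub>E p\<in>{2..m}. C p). \<Sum>i\<in>C (Suc m). g (c(Suc m := i)))"
    by (rule sum.swap)
  finally show ?thesis .
qed

lemma taut_Suc:
  assumes "m \<ge> 1"
  shows "taut a (Suc m) (c(Suc m := i)) x = taut a m c x * level_factor a (Suc m) i x"
proof -
  have "(\<Prod>p=2..m. level_factor a p ((c(Suc m := i)) p) x) = taut a m c x"
    unfolding taut_def by (intro prod.cong) auto
  then show ?thesis using assms by (simp add: taut_def)
qed

lemma subst_taut: "subst \<tau> (taut a m c x) = taut a m c (\<lambda>i. subst \<tau> (x i))"
  by (simp add: taut_def level_factor_def subst_hom if_distrib[of "subst \<tau>"] cong: if_cong)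

text \<open>The permutations that rearrange the values of \<open>\<sigma>\<close> at the positions
  \<open>2, \<dots>, p\<close> only. They are the fixed points in a fibre of the map from the flag
  variety to a partial flag variety; for \<open>p = n\<close> the only condition is on the value
  at \<open>1\<close>.\<close>

definition fibre :: "nat \<Rightarrow> (nat \<Rightarrow> nat) \<Rightarrow> nat \<Rightarrow> (nat \<Rightarrow> nat) set" where
  "fibre n \<sigma> p = {w \<in> Sn n. \<forall>q. q \<notin> {2..p} \<longrightarrow> w q = \<sigma> q}"

lemma self_in_fibre: "\<sigma> \<in> Sn n \<Longrightarrow> \<sigma> \<in> fibre n \<sigma> p"
  by (simp add: fibre_def)

lemma fibre_image:
  assumes "\<sigma> \<in> Sn n" "w \<in> fibre n \<sigma> p"
  shows "w ` {2..p} = \<sigma> ` {2..p}"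
proof -
  have "bij w" "bij \<sigma>" using assms by (auto simp: fibre_def Sn_def permutes_bij)
  then have "w ` {2..p} = - w ` (- {2..p})" "\<sigma> ` {2..p} = - \<sigma> ` (- {2..p})"
    by (simp_all add: bij_image_Compl_eq)
  moreover have "w ` (- {2..p}) = \<sigma> ` (- {2..p})"
    using assms by (intro image_cong) (auto simp: fibre_def)
  ultimately show ?thesis by simp
qed

lemma fibre_1: "\<sigma> \<in> Sn n \<Longrightarrow> fibre n \<sigma> 1 = {\<sigma>}"
  by (auto simp: fibre_def)

text \<open>Inductions on \<open>p\<close> rest on this: the permutations in a fibre with a given
  value \<open>k\<close> at the last free position form a fibre for the preceding
  \<open>p\<close>.\<close>

lemma fibre_step:
  assumes "\<sigma> \<in> Sn n" "1 \<le> p" "Suc p \<le> n" "k \<in> \<sigma> ` {2..Suc p}"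
  obtains \<sigma>' where "\<sigma>' \<in> Sn n" "\<sigma>' 1 = \<sigma> 1" "\<sigma>' ` {2..p} = \<sigma> ` {2..Suc p} - {k}" "\<sigma>' (Suc p) = k"
    "fibre n \<sigma>' p = {w \<in> fibre n \<sigma> (Suc p). w (Suc p) = k}"
proof -
  from assms obtain q where q: "q \<in> {2..Suc p}" "\<sigma> q = k" by auto
  define \<sigma>' where "\<sigma>' = \<sigma> \<circ> Transposition.transpose q (Suc p)"
  have S: "\<sigma>' \<in> Sn n"
    unfolding \<sigma>'_def using assms q by (intro Sn_comp Sn_transpose) auto
  have F: "\<sigma>' \<in> fibre n \<sigma> (Suc p)" and k: "\<sigma>' (Suc p) = k"
    using S q assms by (auto simp: fibre_def \<sigma>'_def Transposition.transpose_def)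
  have "{2..Suc p} = insert (Suc p) {2..p}" using assms by auto
  then have "insert k (\<sigma>' ` {2..p}) = \<sigma> ` {2..Suc p}"
    using fibre_image[OF assms(1) F] k by simp
  moreover have "k \<notin> \<sigma>' ` {2..p}"
    using k injD[OF Sn_inj[OF S]] by fastforce
  ultimately have im: "\<sigma>' ` {2..p} = \<sigma> ` {2..Suc p} - {k}" by auto
  have "fibre n \<sigma>' p = {w \<in> fibre n \<sigma> (Suc p). w (Suc p) = k}"
  proof safe
    fix w assume w: "w \<in> fibre n \<sigma>' p"
    then show "w (Suc p) = k" using k by (auto simp: fibre_def)
    show "w \<in> fibre n \<sigma> (Suc p)"
      using w F by (auto simp: fibre_def)
  next
    fix w assume w: "w \<in> fibre n \<sigma> (Suc p)" "k = w (Suc p)"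
    have "w r = \<sigma>' r" if "r \<notin> {2..p}" for r
    proof (cases "r = Suc p")
      case True then show ?thesis using w k by simp
    next
      case False
      with that have "r \<notin> {2..Suc p}" by auto
      then show ?thesis using w F by (simp add: fibre_def)
    qed
    then show "w \<in> fibre n \<sigma>' p" using w by (simp add: fibre_def)
  qed
  moreover have "\<sigma>' 1 = \<sigma> 1" using F by (auto simp: fibre_def)
  ultimately show ?thesis using that S im k by blast
qed

lemma card_image_interval: "\<sigma> \<in> Sn n \<Longrightarrow> card (\<sigma> ` {2..Suc p}) = p"
  using card_image[OF inj_on_subset[OF Sn_inj], of \<sigma> n "{2..Suc p}"] by simp

text \<open>The values of \<open>w\<close> at \<open>2, \<dots>, p\<close> are those of
  \<open>\<sigma>\<close> at \<open>2, \<dots>, p + 1\<close> except for \<open>w (p + 1)\<close>.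
  Thus the last factor of \<open>taut\<close> depends on \<open>w\<close> only through \<open>k =
  w (p + 1)\<close>.\<close>

lemma level_factor_eq_level_fun:
  assumes "\<sigma> \<in> Sn n" "w \<in> fibre n \<sigma> (Suc p)" "1 \<le> p"
  shows "level_factor a (Suc p) i (\<lambda>q. \<tau> (w q)) =
    level_fun (a < Suc p) (\<sigma> ` {2..Suc p}) (\<tau> (\<sigma> 1)) \<tau> i (w (Suc p))"
proof -
  have im: "\<sigma> ` {2..Suc p} = w ` {2..Suc p}" using fibre_image[OF assms(1,2)] by simp
  have inj: "inj w" using assms(2) by (auto simp: fibre_def intro: Sn_inj)
  have "{2..Suc p} - {Suc p} = {2..<Suc p}" by auto
  then have A: "\<sigma> ` {2..Suc p} - {w (Suc p)} = w ` {2..<Suc p}"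
    unfolding im using image_set_diff[OF inj, of "{2..Suc p}" "{Suc p}"] by simp
  have "w 1 = \<sigma> 1" using assms by (auto simp: fibre_def)
  moreover have "card (\<sigma> ` {2..Suc p}) = p" by (rule card_image_interval[OF assms(1)])
  ultimately show ?thesis
    using inj unfolding level_factor_def level_fun_def A
    by (subst prod.reindex) (auto intro: inj_on_subset)
qed

lemma taut_sum_Suc:
  fixes \<tau> :: "nat \<Rightarrow> 'a::idom"
  assumes "\<sigma> \<in> Sn n" "w \<in> fibre n \<sigma> (Suc p)" "1 \<le> p"
  shows "(\<Sum>c\<in>all_exps (Suc p). P c * taut a (Suc p) c (\<lambda>i. \<tau> (w i))) =
    (\<Sum>c\<in>all_exps p. (\<Sum>i<p. P (c(Suc p := i)) *
       level_fun (a < Suc p) (\<sigma> ` {2..Suc p}) (\<tau> (\<sigma> 1)) \<tau> i (w (Suc p))) * taut a p c (\<lambda>i. \<tau> (w i)))"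
  unfolding all_exps_def sum_PiE_Suc[OF assms(3)] taut_Suc[OF assms(3)] sum_distrib_right
    level_factor_eq_level_fun[OF assms, where \<tau> = \<tau>]
  by (intro sum.cong) (simp_all only: diff_Suc_1 mult.assoc mult.commute[of "taut _ _ _ _"])

text \<open>Induction on \<open>p\<close>. Fix the value \<open>k\<close> at the last position.
  The sum is then a combination of the elements for \<open>p - 1\<close>, so its coefficients
  vanish for each \<open>k\<close>; as functions of \<open>k\<close> they are combinations of the
  level functions, which are independent.

  The generality in \<open>\<tau>\<close> is used to apply the result after two variables have
  been identified, provided that the values \<open>\<tau>\<close> takes on the relevant points
  stay distinct.\<close>

lemma taut_independent:
  fixes \<tau> :: "nat \<Rightarrow> 'a::idom"
  assumes "\<sigma> \<in> Sn n" "1 \<le> p" "p \<le> n" "inj_on \<tau> (\<sigma> ` {2..p})"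
    and "p \<le> a \<or> \<tau> (\<sigma> 1) \<notin> \<tau> ` \<sigma> ` {2..p}"
    and "\<And>w. w \<in> fibre n \<sigma> p \<Longrightarrow> (\<Sum>c\<in>all_exps p. P c * taut a p c (\<lambda>i. \<tau> (w i))) = 0"
    and "c \<in> all_exps p"
  shows "P c = 0"
  using assms(2,3) assms(1) assms(4-)
proof (induction p arbitrary: \<sigma> P c rule: dec_induct)
  case base
  have "\<sigma> \<in> fibre n \<sigma> 1" using base.prems by (intro self_in_fibre)
  from base.prems(5)[OF this] have "P (\<lambda>_. undefined) = 0"
    by (simp add: all_exps_def taut_def)
  then show ?case using base.prems(6) by (simp add: all_exps_def)
next
  case (step p)
  define A where "A = \<sigma> ` {2..Suc p}"
  have cA: "card A = p" unfolding A_def by (rule card_image_interval) fact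
  let ?F = "level_fun (a < Suc p) A (\<tau> (\<sigma> 1)) \<tau>"
  have inner: "(\<Sum>i<p. P (c'(Suc p := i)) * ?F i k) = 0" if "c' \<in> all_exps p" and k: "k \<in> A" for c' k
  proof -
    obtain \<sigma>' where "\<sigma>' \<in> Sn n" "\<sigma>' 1 = \<sigma> 1" "\<sigma>' ` {2..p} = \<sigma> ` {2..Suc p} - {k}" "\<sigma>' (Suc p) = k"
      "fibre n \<sigma>' p = {w \<in> fibre n \<sigma> (Suc p). w (Suc p) = k}"
      by (rule fibre_step[OF step.prems(2) step.hyps(1) step.prems(1) k[unfolded A_def]])
    note \<sigma>' = this(1,2) this(3)[folded A_def] this(5)
    show ?thesis
    proof (rule step.IH[OF _ \<sigma>'(1) _ _ _ that(1)])
      show "p \<le> n" using step.prems by simp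
      show "inj_on \<tau> (\<sigma>' ` {2..p})"
        unfolding \<sigma>' using step.prems(3) unfolding A_def[symmetric] by (rule inj_on_subset) auto
      show "p \<le> a \<or> \<tau> (\<sigma>' 1) \<notin> \<tau> ` \<sigma>' ` {2..p}"
        unfolding \<sigma>' using step.prems(4) unfolding A_def[symmetric] by auto
    next
      fix w assume "w \<in> fibre n \<sigma>' p"
      then have w: "w \<in> fibre n \<sigma> (Suc p)" "w (Suc p) = k" unfolding \<sigma>' by auto
      have "0 = (\<Sum>c\<in>all_exps (Suc p). P c * taut a (Suc p) c (\<lambda>i. \<tau> (w i)))"
        using step.prems(5)[OF w(1)] by simp
      also have "\<dots> = (\<Sum>c\<in>all_exps p. (\<Sum>i<p. P (c(Suc p := i)) * ?F i k) * taut a p c (\<lambda>i. \<tau> (w i)))"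
        unfolding A_def w(2)[symmetric] by (rule taut_sum_Suc[OF step.prems(2) w(1) step.hyps(1)])
      finally show "(\<Sum>c\<in>all_exps p. (\<Sum>i<p. P (c(Suc p := i)) * ?F i k) * taut a p c (\<lambda>i. \<tau> (w i))) = 0"
        by simp
    qed
  qed
  have "{2..Suc p} = insert (Suc p) {2..p}" using step.hyps by auto
  then have "all_exps (Suc p) = (\<lambda>(i, c). c(Suc p := i)) ` ({..<p} \<times> all_exps p)"
    by (simp add: all_exps_def PiE_insert_eq)
  then obtain c' i where c: "c = c'(Suc p := i)" "c' \<in> all_exps p" "i < p"
    using step.prems(6) by auto
  show ?case unfolding c
  proof (rule level_fun_independent[where A = A and \<tau> = \<tau> and B = "a < Suc p" and y = "\<tau> (\<sigma> 1)"
        and i = i and q = "\<lambda>i. P (c'(Suc p := i))"])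
    show "finite A" "inj_on \<tau> A" "\<not> a < Suc p \<or> \<tau> (\<sigma> 1) \<notin> \<tau> ` A"
      using step.prems unfolding A_def by auto
    show "(\<Sum>i<card A. P (c'(Suc p := i)) * ?F i k) = 0" if "k \<in> A" for k
      unfolding cA by (rule inner[OF c(2) that])
    show "i < card A" unfolding cA by (rule c(3))
  qed
qed

lemma low_sum_Suc:
  assumes "1 \<le> p" "a \<le> p"
  shows "(\<Sum>c\<in>low_exps a (Suc p). P c * taut a (Suc p) c x) =
    (\<Sum>c\<in>low_exps a p. (\<Sum>i<p - 1. P (c(Suc p := i)) * x (Suc p) ^ i) * taut a p c x)"
proof -
  have "level_factor a (Suc p) i x = x (Suc p) ^ i" if "i < p - 1" for i
    using that by (auto simp: level_factor_def)
  then have "(\<Sum>i<p - 1. P (c(Suc p := i)) * taut a (Suc p) (c(Suc p := i)) x) =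
      (\<Sum>i<p - 1. P (c(Suc p := i)) * x (Suc p) ^ i) * taut a p c x" for c
    unfolding taut_Suc[OF assms(1)] sum_distrib_right
    by (intro sum.cong refl) (simp add: mult_ac)
  moreover have "(if a < Suc p then Suc p - 2 else Suc p - 1) = p - 1"
    using assms by simp
  ultimately show ?thesis
    unfolding low_exps_def sum_PiE_Suc[OF assms(1)] by (intro sum.cong refl) (simp only:)
qed

text \<open>The low monomials are independent already on those \<open>w\<close> for which
  \<open>l\<close> is among the values at \<open>2, \<dots>, a\<close>; there are as many of these
  permutations as low exponents, namely \<open>(a - 1) (p - 2)!\<close>. The induction starts with
  \<open>p = a\<close>, where the condition on \<open>l\<close> holds throughout the fibre and all
  exponents are low. In the step from \<open>p\<close> to \<open>p + 1\<close>, the value at the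
  position \<open>p + 1\<close> ranges over the \<open>p - 1\<close> points other than
  \<open>l\<close>, and the exponent at this position is less than \<open>p - 1\<close>.\<close>

lemma low_taut_independent:
  fixes \<tau> :: "nat \<Rightarrow> 'a::idom"
  assumes "\<sigma> \<in> Sn n" "1 \<le> a" "a \<le> p" "p \<le> n" "inj_on \<tau> (\<sigma> ` {2..p})" "l \<in> \<sigma> ` {2..p}"
    and "\<And>w. w \<in> fibre n \<sigma> p \<Longrightarrow> l \<in> w ` {2..a} \<Longrightarrow> (\<Sum>c\<in>low_exps a p. P c * taut a p c (\<lambda>i. \<tau> (w i))) = 0"
    and "c \<in> low_exps a p"
  shows "P c = 0"
  using assms(3,4) assms(1) assms(5-)
proof (induction p arbitrary: \<sigma> P c rule: dec_induct)
  case base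
  have E: "low_exps a a = all_exps a"
    unfolding low_exps_def all_exps_def by (intro PiE_cong) auto
  show ?case
  proof (rule taut_independent[of \<sigma> n a \<tau> a P c, OF base.prems(2) assms(2) base.prems(1,3)])
    fix w assume w: "w \<in> fibre n \<sigma> a"
    then have "l \<in> w ` {2..a}" using base.prems(4) fibre_image[OF base.prems(2)] by simp
    then show "(\<Sum>c\<in>all_exps a. P c * taut a a c (\<lambda>i. \<tau> (w i))) = 0"
      unfolding E[symmetric] by (rule base.prems(5)[OF w])
  next
    show "c \<in> all_exps a" using base.prems(6) by (simp only: E)
  qed simp
next
  case (step p)
  define A where "A = \<sigma> ` {2..Suc p}"
  have cA: "card A = p" unfolding A_def by (rule card_image_interval) fact
  have p1: "1 \<le> p" using assms(2) step.hyps by simp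
  have inner: "(\<Sum>i<p - 1. P (c'(Suc p := i)) * \<tau> k ^ i) = 0" if "c' \<in> low_exps a p" and k: "k \<in> A - {l}" for c' k
  proof -
    obtain \<sigma>' where "\<sigma>' \<in> Sn n" "\<sigma>' 1 = \<sigma> 1" "\<sigma>' ` {2..p} = \<sigma> ` {2..Suc p} - {k}" "\<sigma>' (Suc p) = k"
      "fibre n \<sigma>' p = {w \<in> fibre n \<sigma> (Suc p). w (Suc p) = k}"
      by (rule fibre_step[OF step.prems(2) p1 step.prems(1) k[THEN DiffD1, unfolded A_def]])
    note \<sigma>' = this(1,2) this(3)[folded A_def] this(5)
    show ?thesis
    proof (rule step.IH[OF _ \<sigma>'(1) _ _ _ that(1)])
      show "p \<le> n" using step.prems by simp
      show "inj_on \<tau> (\<sigma>' ` {2..p})"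
        unfolding \<sigma>' using step.prems(3) unfolding A_def[symmetric] by (rule inj_on_subset) auto
      show "l \<in> \<sigma>' ` {2..p}"
        unfolding \<sigma>' using step.prems(4) k unfolding A_def[symmetric] by auto
    next
      fix w assume "w \<in> fibre n \<sigma>' p" and l: "l \<in> w ` {2..a}"
      then have w: "w \<in> fibre n \<sigma> (Suc p)" "w (Suc p) = k" unfolding \<sigma>' by auto
      have "0 = (\<Sum>c\<in>low_exps a (Suc p). P c * taut a (Suc p) c (\<lambda>i. \<tau> (w i)))"
        using step.prems(5)[OF w(1) l] by simp
      also have "\<dots> = (\<Sum>c\<in>low_exps a p. (\<Sum>i<p - 1. P (c(Suc p := i)) * \<tau> k ^ i) * taut a p c (\<lambda>i. \<tau> (w i)))"
        unfolding w(2)[symmetric] by (rule low_sum_Suc[OF p1 step.hyps(1)])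
      finally show "(\<Sum>c\<in>low_exps a p. (\<Sum>i<p - 1. P (c(Suc p := i)) * \<tau> k ^ i) * taut a p c (\<lambda>i. \<tau> (w i))) = 0"
        by simp
    qed
  qed
  have "{2..Suc p} = insert (Suc p) {2..p}" using p1 by auto
  then have "low_exps a (Suc p) = (\<lambda>(i, c). c(Suc p := i)) ` ({..<p - 1} \<times> low_exps a p)"
    using step.hyps by (simp add: low_exps_def PiE_insert_eq)
  then obtain c' i where c: "c = c'(Suc p := i)" "c' \<in> low_exps a p" "i < p - 1"
    using step.prems(6) by auto
  show ?case unfolding c
  proof (rule powers_independent[where A = "A - {l}" and \<tau> = \<tau> and d = "p - 1" and i = i and q = "\<lambda>i. P (c'(Suc p := i))"])
    show "finite (A - {l})" "inj_on \<tau> (A - {l})"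
      using step.prems unfolding A_def by (auto intro: inj_on_subset)
    show "p - 1 \<le> card (A - {l})" using step.prems(4) cA unfolding A_def by simp
    show "(\<Sum>i<p - 1. P (c'(Suc p := i)) * \<tau> k ^ i) = 0" if "k \<in> A - {l}" for k
      by (rule inner[OF c(2) that])
  qed (rule c(3))
qed

text \<open>Induction on \<open>p\<close>. On the permutations with value \<open>k\<close> at the
  last position, \<open>f\<close> has coefficients \<open>P k c\<close> by induction. Let
  \<open>l\<close> be another value. If \<open>t\<^sub>k\<close> and \<open>t\<^sub>l\<close> are
  identified then neither \<open>f\<close> nor the elements \<open>taut\<close> change when
  \<open>k\<close> and \<open>l\<close> trade places, so \<open>P k c\<close> and \<open>P l
  c\<close> become equal by independence. Hence \<open>t\<^sub>k - t\<^sub>l\<close> divides their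
  difference, and interpolation expresses \<open>P k c\<close> through the level functions of
  \<open>k\<close>.\<close>

lemma taut_spanning:
  fixes f :: "(nat \<Rightarrow> nat) \<Rightarrow> cpoly"
  assumes "\<sigma> \<in> Sn n" "1 \<le> p" "p \<le> n"
    and "\<And>w i j. w \<in> fibre n \<sigma> p \<Longrightarrow> i \<in> {2..p} \<Longrightarrow> j \<in> {2..p} \<Longrightarrow> i \<noteq> j \<Longrightarrow>
      tvar (w i) - tvar (w j) dvd f w - f (w \<circ> Transposition.transpose i j)"
  shows "\<exists>P. \<forall>w\<in>fibre n \<sigma> p. f w = (\<Sum>c\<in>all_exps p. P c * taut a p c (\<lambda>i. tvar (w i)))"
  using assms(2,3) assms(1) assms(4-)
proof (induction p arbitrary: \<sigma> rule: dec_induct)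
  case base
  then show ?case
    by (intro exI[of _ "\<lambda>_. f \<sigma>"]) (auto simp: fibre_1[unfolded One_nat_def] all_exps_def taut_def)
next
  case (step p)
  define A where "A = \<sigma> ` {2..Suc p}"
  have cA: "card A = p" unfolding A_def by (rule card_image_interval) fact
  have u: "\<sigma> 1 \<notin> A" using step.prems(2) unfolding A_def by (auto dest!: Sn_inj injD)
  have "\<forall>k\<in>A. \<exists>\<sigma>'. \<sigma>' \<in> Sn n \<and> \<sigma>' 1 = \<sigma> 1 \<and> \<sigma>' ` {2..p} = A - {k} \<and>
      fibre n \<sigma>' p = {w \<in> fibre n \<sigma> (Suc p). w (Suc p) = k}"
  proof
    fix k assume k: "k \<in> A"
    obtain \<sigma>' where "\<sigma>' \<in> Sn n" "\<sigma>' 1 = \<sigma> 1" "\<sigma>' ` {2..p} = \<sigma> ` {2..Suc p} - {k}" "\<sigma>' (Suc p) = k"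
      "fibre n \<sigma>' p = {w \<in> fibre n \<sigma> (Suc p). w (Suc p) = k}"
      by (rule fibre_step[OF step.prems(2) step.hyps(1) step.prems(1) k[unfolded A_def]])
    note \<sigma>' = this(1,2) this(3)[folded A_def] this(5)
    then show "\<exists>\<sigma>'. \<sigma>' \<in> Sn n \<and> \<sigma>' 1 = \<sigma> 1 \<and> \<sigma>' ` {2..p} = A - {k} \<and>
      fibre n \<sigma>' p = {w \<in> fibre n \<sigma> (Suc p). w (Suc p) = k}"
      by (intro exI[of _ \<sigma>'] conjI)
  qed
  from bchoice[OF this]
  obtain \<sigma>s where "\<forall>k\<in>A. \<sigma>s k \<in> Sn n \<and> \<sigma>s k 1 = \<sigma> 1 \<and> \<sigma>s k ` {2..p} = A - {k} \<and>
      fibre n (\<sigma>s k) p = {w \<in> fibre n \<sigma> (Suc p). w (Suc p) = k}"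
    by (rule exE)
  then have \<sigma>s: "\<And>k. k \<in> A \<Longrightarrow> \<sigma>s k \<in> Sn n" "\<And>k. k \<in> A \<Longrightarrow> \<sigma>s k 1 = \<sigma> 1"
    "\<And>k. k \<in> A \<Longrightarrow> \<sigma>s k ` {2..p} = A - {k}"
    "\<And>k. k \<in> A \<Longrightarrow> fibre n (\<sigma>s k) p = {w \<in> fibre n \<sigma> (Suc p). w (Suc p) = k}"
    by simp_all
  have "\<forall>k\<in>A. \<exists>P. \<forall>w\<in>fibre n (\<sigma>s k) p. f w = (\<Sum>c\<in>all_exps p. P c * taut a p c (\<lambda>i. tvar (w i)))"
  proof
    fix k assume k: "k \<in> A"
    show "\<exists>P. \<forall>w\<in>fibre n (\<sigma>s k) p. f w = (\<Sum>c\<in>all_exps p. P c * taut a p c (\<lambda>i. tvar (w i)))"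
    proof (rule step.IH[OF _ \<sigma>s(1)[OF k]])
      fix w i j assume "w \<in> fibre n (\<sigma>s k) p" "i \<in> {2..p}" "j \<in> {2..p}" "i \<noteq> j"
      then show "tvar (w i) - tvar (w j) dvd f w - f (w \<circ> Transposition.transpose i j)"
        using \<sigma>s(4)[OF k] by (intro step.prems(3)) auto
    qed (use step.prems in simp)
  qed
  from bchoice[OF this]
  obtain P where "\<forall>k\<in>A. \<forall>w\<in>fibre n (\<sigma>s k) p. f w = (\<Sum>c\<in>all_exps p. P k c * taut a p c (\<lambda>i. tvar (w i)))"
    by (rule exE)
  note P = this[rule_format]
  have compat: "tvar k - tvar l dvd P k c - P l c" if k: "k \<in> A" and l: "l \<in> A" and c: "c \<in> all_exps p" for k l c
  proof (cases "k = l")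
    case False
    let ?\<tau> = "identify k l"
    have "subst ?\<tau> (P k c - P l c) = 0"
    proof (rule taut_independent[of "\<sigma>s k" n p ?\<tau> a, OF \<sigma>s(1)[OF k] \<open>1 \<le> p\<close> _ _ _ _ c])
      show "p \<le> n" using step.prems by simp
      show "inj_on ?\<tau> (\<sigma>s k ` {2..p})"
        using \<sigma>s(3)[OF k] by (auto simp: inj_on_def identify_def)
      show "p \<le> a \<or> ?\<tau> (\<sigma>s k 1) \<notin> ?\<tau> ` \<sigma>s k ` {2..p}"
        using \<sigma>s(3)[OF k] \<sigma>s(2)[OF k] u k by (auto simp: identify_def)
    next
      fix w assume w: "w \<in> fibre n (\<sigma>s k) p"
      then have w1: "w \<in> fibre n \<sigma> (Suc p)" "w (Suc p) = k" using \<sigma>s(4)[OF k] by auto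
      have "l \<in> w ` {2..p}" using fibre_image[OF \<sigma>s(1)[OF k] w] \<sigma>s(3)[OF k] l False by auto
      then obtain i where i: "i \<in> {2..p}" "w i = l" by auto
      \<comment> \<open>The partner of \<open>w\<close> in the part of the fibre that belongs to
        \<open>l\<close>.\<close>
      define w' where "w' = w \<circ> Transposition.transpose i (Suc p)"
      have "w' \<in> Sn n"
        unfolding w'_def using w1 i step.prems by (intro Sn_comp Sn_transpose) (auto simp: fibre_def)
      moreover have "w' (Suc p) = l" using i by (simp add: w'_def)
      moreover have "w' q = \<sigma> q" if "q \<notin> {2..Suc p}" for q
        using that w1 i by (auto simp: w'_def fibre_def Transposition.transpose_def)
      ultimately have "w' \<in> fibre n \<sigma> (Suc p)" "w' (Suc p) = l" by (simp_all add: fibre_def)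
      then have w': "w' \<in> fibre n (\<sigma>s l) p" using \<sigma>s(4)[OF l] by auto
      have "tvar (w (Suc p)) - tvar (w i) dvd f w - f (w \<circ> Transposition.transpose (Suc p) i)"
        by (rule step.prems(3)[OF w1(1)]) (use i step.hyps in auto)
      then have "tvar k - tvar l dvd f w - f w'"
        unfolding w'_def w1(2) i(2) by (simp only: transpose_commute)
      then have "subst ?\<tau> (f w) = subst ?\<tau> (f w')"
        by (simp add: dvd_iff_identify subst_diff)
      moreover have eq: "(\<lambda>q. ?\<tau> (w' q)) = (\<lambda>q. ?\<tau> (w q))"
        using i w1 by (auto simp: fun_eq_iff w'_def Transposition.transpose_def identify_def)
      ultimately show "(\<Sum>c\<in>all_exps p. subst ?\<tau> (P k c - P l c) * taut a p c (\<lambda>i. ?\<tau> (w i))) = 0"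
        unfolding P[OF k w] P[OF l w'] subst_sum subst_mult subst_taut subst_tvar eq subst_diff
        by (simp only: left_diff_distrib sum_subtractf diff_self)
    qed
    then show ?thesis by (simp add: dvd_iff_identify)
  qed simp
  let ?F = "level_fun (a < Suc p) A (tvar (\<sigma> 1)) tvar"
  have "\<forall>c\<in>all_exps p. \<exists>Q. \<forall>k\<in>A. P k c = (\<Sum>i<card A. Q i * ?F i k)"
  proof
    fix c assume c: "c \<in> all_exps p"
    show "\<exists>Q. \<forall>k\<in>A. P k c = (\<Sum>i<card A. Q i * ?F i k)"
    proof (rule level_fun_interpolation)
      show "finite A" by (simp add: A_def)
      show "\<not> a < Suc p \<or> \<sigma> 1 \<notin> A" using u by simp
    qed (rule compat[OF _ _ c])
  qed
  from bchoice[OF this]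
  obtain Q where "\<forall>c\<in>all_exps p. \<forall>k\<in>A. P k c = (\<Sum>i<card A. Q c i * ?F i k)"
    by (rule exE)
  note Q = this[unfolded cA, rule_format]
  define R where "R c = Q (restrict c {2..p}) (c (Suc p))" for c
  have R: "R (c(Suc p := i)) = Q c i" if "c \<in> all_exps p" for c i
  proof -
    have "restrict (c(Suc p := i)) {2..p} = c"
    proof
      show "restrict (c(Suc p := i)) {2..p} x = c x" for x
        using PiE_arb[OF that[unfolded all_exps_def], of x] by (simp add: restrict_def)
    qed
    then show ?thesis by (simp add: R_def)
  qed
  have "f w = (\<Sum>c\<in>all_exps (Suc p). R c * taut a (Suc p) c (\<lambda>i. tvar (w i)))"
    if w: "w \<in> fibre n \<sigma> (Suc p)" for w
  proof -
    define k where "k = w (Suc p)"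
    have k: "k \<in> A" unfolding k_def A_def fibre_image[OF step.prems(2) w, symmetric] using step.hyps by auto
    have "w \<in> fibre n (\<sigma>s k) p" using \<sigma>s(4)[OF k] w by (simp add: k_def)
    then have "f w = (\<Sum>c\<in>all_exps p. P k c * taut a p c (\<lambda>i. tvar (w i)))" by (rule P[OF k])
    also have "\<dots> = (\<Sum>c\<in>all_exps p. (\<Sum>i<p. R (c(Suc p := i)) * ?F i k) * taut a p c (\<lambda>i. tvar (w i)))"
      by (intro sum.cong refl) (simp only: R Q[OF _ k])
    also have "\<dots> = (\<Sum>c\<in>all_exps (Suc p). R c * taut a (Suc p) c (\<lambda>i. tvar (w i)))"
      unfolding A_def k_def by (rule taut_sum_Suc[OF step.prems(2) w step.hyps(1), symmetric])
    finally show ?thesis .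
  qed
  then show ?case by (intro exI[of _ R] ballI)
qed

section \<open>A basis of the equivariant cohomology\<close>

text \<open>A quotient by \<open>t\<^sub>k - t\<^sub>l\<close> of a polynomial in
  \<open>t\<^sub>1, \<dots>, t\<^sub>n\<close> can be taken in the same variables, so the
  conditions are plain divisibilities.\<close>

lemma GKM_iff:
  "\<alpha> \<in> GKM n h \<longleftrightarrow> \<alpha> \<in> Sn n \<rightarrow>\<^sub>E polys n \<and>
     (\<forall>w\<in>Sn n. \<forall>i j. 1 \<le> j \<and> j < i \<and> i \<le> n \<and> i \<le> h j \<longrightarrow>
        tvar (w i) - tvar (w j) dvd \<alpha> w - \<alpha> (w \<circ> Transposition.transpose j i))"
  (is "_ \<longleftrightarrow> ?R")
proof
  assume "\<alpha> \<in> GKM n h"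
  then have \<alpha>: "\<alpha> \<in> Sn n \<rightarrow>\<^sub>E polys n"
    and eq: "\<And>w i j. w \<in> Sn n \<Longrightarrow> 1 \<le> j \<and> j < i \<and> i \<le> n \<and> i \<le> h j \<Longrightarrow>
      \<exists>f\<in>polys n. \<alpha> w - \<alpha> (w \<circ> Transposition.transpose j i) = (tvar (w i) - tvar (w j)) * f"
    unfolding GKM_def by simp_all
  show ?R
  proof (intro conjI \<alpha> ballI allI impI)
    fix w i j assume "w \<in> Sn n" "1 \<le> j \<and> j < i \<and> i \<le> n \<and> i \<le> h j"
    from eq[OF this] show "tvar (w i) - tvar (w j) dvd \<alpha> w - \<alpha> (w \<circ> Transposition.transpose j i)"
      by (elim bexE) (rule dvdI)
  qed
next
  assume R: ?R
  have "\<exists>f\<in>polys n. \<alpha> w - \<alpha> (w \<circ> Transposition.transpose j i) = (tvar (w i) - tvar (w j)) * f"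
    if w: "w \<in> Sn n" and ij: "1 \<le> j" "j < i" "i \<le> n" "i \<le> h j" for w i j
  proof -
    have i: "i \<in> {1..n}" and j: "j \<in> {1..n}" using ij by auto
    have "w \<circ> Transposition.transpose j i \<in> Sn n"
      by (rule Sn_comp[OF w Sn_transpose[OF j i]])
    then have f: "\<alpha> w - \<alpha> (w \<circ> Transposition.transpose j i) \<in> polys n"
      using R w by (intro polys_diff) auto
    have d: "tvar (w i) - tvar (w j) \<in> polys n"
      using Sn_mem[OF w i] Sn_mem[OF w j] by (intro polys_diff) simp_all
    have "tvar (w i) - tvar (w j) dvd \<alpha> w - \<alpha> (w \<circ> Transposition.transpose j i)"
      using R w ij by blast
    then show ?thesis using d f by (rule polys_dvdE) blast
  qed
  then show "\<alpha> \<in> GKM n h" using R unfolding GKM_def by blast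
qed

lemma GKM_polys: "\<alpha> \<in> GKM n h \<Longrightarrow> w \<in> Sn n \<Longrightarrow> \<alpha> w \<in> polys n"
  unfolding GKM_def by auto

lemma GKM_dvd:
  "\<alpha> \<in> GKM n h \<Longrightarrow> w \<in> Sn n \<Longrightarrow> 1 \<le> j \<Longrightarrow> j < i \<Longrightarrow> i \<le> n \<Longrightarrow> i \<le> h j \<Longrightarrow>
    tvar (w i) - tvar (w j) dvd \<alpha> w - \<alpha> (w \<circ> Transposition.transpose j i)"
  unfolding GKM_iff by blast

lemma Sn_swap: "w \<in> Sn n \<Longrightarrow> 1 \<le> j \<Longrightarrow> j < i \<Longrightarrow> i \<le> n \<Longrightarrow> w \<circ> Transposition.transpose j i \<in> Sn n"
  by (intro Sn_comp Sn_transpose) auto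

lemma GKM_I:
  assumes "\<And>w. w \<in> Sn n \<Longrightarrow> f w \<in> polys n"
    and "\<And>w j i. w \<in> Sn n \<Longrightarrow> 1 \<le> j \<Longrightarrow> j < i \<Longrightarrow> i \<le> n \<Longrightarrow> i \<le> h j \<Longrightarrow>
      tvar (w i) - tvar (w j) dvd f w - f (w \<circ> Transposition.transpose j i)"
  shows "(\<lambda>w\<in>Sn n. f w) \<in> GKM n h"
  unfolding GKM_iff
proof (intro conjI ballI allI impI)
  fix w i j assume w: "w \<in> Sn n" and ij: "1 \<le> j \<and> j < i \<and> i \<le> n \<and> i \<le> h j"
  then have "w \<circ> Transposition.transpose j i \<in> Sn n" by (intro Sn_swap) auto
  then show "tvar (w i) - tvar (w j) dvd
      (\<lambda>w\<in>Sn n. f w) w - (\<lambda>w\<in>Sn n. f w) (w \<circ> Transposition.transpose j i)"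
    using assms(2)[OF w, of j i] w ij by simp
qed (use assms(1) in auto)

lemma GKM_add:
  assumes "\<alpha> \<in> GKM n h" "\<beta> \<in> GKM n h"
  shows "(\<lambda>w\<in>Sn n. \<alpha> w + \<beta> w) \<in> GKM n h"
proof (rule GKM_I)
  fix w j i assume *: "w \<in> Sn n" "1 \<le> j" "j < i" "i \<le> n" "i \<le> h j"
  show "tvar (w i) - tvar (w j) dvd \<alpha> w + \<beta> w -
      (\<alpha> (w \<circ> Transposition.transpose j i) + \<beta> (w \<circ> Transposition.transpose j i))"
    unfolding add_diff_add by (intro dvd_add GKM_dvd[OF assms(1) *] GKM_dvd[OF assms(2) *])
qed (intro polys_add GKM_polys[OF assms(1)] GKM_polys[OF assms(2)])

lemma GKM_mult:
  assumes "\<alpha> \<in> GKM n h" "\<beta> \<in> GKM n h"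
  shows "(\<lambda>w\<in>Sn n. \<alpha> w * \<beta> w) \<in> GKM n h"
proof (rule GKM_I)
  fix w j i assume *: "w \<in> Sn n" "1 \<le> j" "j < i" "i \<le> n" "i \<le> h j"
  show "tvar (w i) - tvar (w j) dvd \<alpha> w * \<beta> w -
      \<alpha> (w \<circ> Transposition.transpose j i) * \<beta> (w \<circ> Transposition.transpose j i)"
    by (intro dvd_diff_mult GKM_dvd[OF assms(1) *] GKM_dvd[OF assms(2) *])
qed (intro polys_mult GKM_polys[OF assms(1)] GKM_polys[OF assms(2)])

lemma GKM_const: "f \<in> polys n \<Longrightarrow> (\<lambda>w\<in>Sn n. f) \<in> GKM n h"
  by (rule GKM_I) simp_all

lemma GKM_scale:
  assumes "f \<in> polys n" "\<alpha> \<in> GKM n h"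
  shows "(\<lambda>w\<in>Sn n. f * \<alpha> w) \<in> GKM n h"
proof -
  have "(\<lambda>w\<in>Sn n. f * \<alpha> w) = (\<lambda>w\<in>Sn n. (\<lambda>w\<in>Sn n. f) w * \<alpha> w)"
    by (rule restrict_ext) simp
  then show ?thesis by (simp only: GKM_mult[OF GKM_const[OF assms(1)] assms(2)])
qed

lemma GKM_sum:
  assumes "\<And>a. a \<in> A \<Longrightarrow> \<alpha> a \<in> GKM n h"
  shows "(\<lambda>w\<in>Sn n. \<Sum>a\<in>A. \<alpha> a w) \<in> GKM n h"
proof (rule GKM_I)
  fix w j i assume *: "w \<in> Sn n" "1 \<le> j" "j < i" "i \<le> n" "i \<le> h j"
  show "tvar (w i) - tvar (w j) dvd (\<Sum>a\<in>A. \<alpha> a w) -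
      (\<Sum>a\<in>A. \<alpha> a (w \<circ> Transposition.transpose j i))"
    unfolding sum_subtractf[symmetric] by (intro dvd_sum GKM_dvd[OF assms *])
qed (intro polys_sum GKM_polys[OF assms])

lemma dvd_diff_taut:
  fixes x y :: "nat \<Rightarrow> 'a::comm_ring_1"
  assumes "\<And>i. d dvd x i - y i"
  shows "d dvd taut a m c x - taut a m c y"
proof -
  have "d dvd x 1 - x q - (y 1 - y q)" for q
    using dvd_diff[OF assms[of 1] assms[of q]] by (simp add: algebra_simps)
  then show ?thesis
    unfolding taut_def level_factor_def
    by (intro dvd_diff_prod) (auto intro: dvd_diff_prod dvd_diff_power assms)
qed

lemma dvd_diff_transposed:
  "tvar (w i) - tvar (w j) dvd tvar (w q) - tvar ((w \<circ> Transposition.transpose j i) q)"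
proof -
  have "tvar (w i) - tvar (w j) dvd tvar (w j) - tvar (w i)"
    by (subst minus_dvd_iff[symmetric]) simp
  then show ?thesis by (simp add: Transposition.transpose_def)
qed

text \<open>Some \<open>p > a\<close> has the top exponent, and the product that replaces the
  power of \<open>x\<^sub>p\<close> contains the factor \<open>x\<^sub>1 - x\<^sub>i\<close>.\<close>

lemma high_taut_dvd:
  fixes x :: "nat \<Rightarrow> 'a::comm_ring_1"
  assumes "c \<in> all_exps m - low_exps a m" "i \<in> {2..a}"
  shows "x 1 - x i dvd taut a m c x"
proof -
  have c: "c \<in> all_exps m" "c \<notin> low_exps a m" using assms(1) by auto
  then obtain p where p: "p \<in> {2..m}" "c p \<notin> {..<(if a < p then p - 2 else p - 1)}"
    unfolding all_exps_def low_exps_def PiE_iff by blast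
  have "c p < p - 1" using c(1) p(1) unfolding all_exps_def PiE_iff by blast
  then have ap: "a < p" "Suc (Suc (c p)) = p" using p(2) by (auto split: if_splits)
  have "x 1 - x i dvd (\<Prod>q=2..<p. x 1 - x q)"
    using ap assms(2) by (intro dvd_prodI) auto
  also have "\<dots> = level_factor a p (c p) x"
    using ap by (simp add: level_factor_def)
  also have "\<dots> dvd taut a m c x"
    unfolding taut_def using p(1) by (intro dvd_prodI) auto
  finally show ?thesis .
qed

lemma polys_taut:
  assumes "\<And>i. i \<in> {1..m} \<Longrightarrow> x i \<in> polys n"
  shows "taut a m c x \<in> polys n"
  unfolding taut_def level_factor_def
proof (intro polys_prod)
  fix p assume p: "p \<in> {2..m}"
  have "x 1 \<in> polys n" "x p \<in> polys n" using assms[of 1] assms[of p] p by auto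
  then show "(if a < p \<and> Suc (Suc (c p)) = p then \<Prod>q = 2..<p. x 1 - x q else x p ^ c p) \<in> polys n"
    using p by (auto intro!: polys_prod polys_diff polys_power assms)
qed

definition exp_sum :: "nat \<Rightarrow> (nat \<Rightarrow> nat) \<Rightarrow> nat" where
  "exp_sum m c = (\<Sum>p=2..m. c p)"

lemma homog_taut: "homog (exp_sum m c) (taut a m c (\<lambda>i. tvar (w i)))"
  unfolding exp_sum_def taut_def
proof (rule homog_prod)
  fix p
  have "homog (\<Sum>q=2..<p. 1) (\<Prod>q=2..<p. tvar (w 1) - tvar (w q))"
    by (intro homog_prod homog_diff homog_tvar)
  moreover have "homog (1 * c p) (tvar (w p) ^ c p)"
    by (intro homog_power homog_tvar)
  moreover have "p - 2 = c p" if "Suc (Suc (c p)) = p" using that by simp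
  ultimately show "homog (c p) (level_factor a p (c p) (\<lambda>i. tvar (w i)))"
    by (auto simp: level_factor_def)
qed

type_synonym basis_index = "nat \<times> (nat \<Rightarrow> nat) + nat \<times> (nat \<Rightarrow> nat)"

text \<open>The left summand indexes the invariant elements and the right summand those that the
  group permutes through \<open>k\<close>.\<close>

definition basis_indices :: "nat \<Rightarrow> nat \<Rightarrow> basis_index set" where
  "basis_indices a n = ({..<n} \<times> low_exps a n) <+> ({1..n} \<times> (all_exps n - low_exps a n))"

fun basis_elem :: "nat \<Rightarrow> nat \<Rightarrow> basis_index \<Rightarrow> (nat \<Rightarrow> nat) \<Rightarrow> cpoly" where
  "basis_elem a n (Inl (d, c)) = (\<lambda>w\<in>Sn n. tvar (w 1) ^ d * taut a n c (\<lambda>i. tvar (w i)))"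
| "basis_elem a n (Inr (k, c)) = (\<lambda>w\<in>Sn n. if w 1 = k then taut a n c (\<lambda>i. tvar (w i)) else 0)"

fun basis_degree :: "nat \<Rightarrow> basis_index \<Rightarrow> nat" where
  "basis_degree n (Inl (d, c)) = d + exp_sum n c"
| "basis_degree n (Inr (k, c)) = exp_sum n c"

lemma finite_basis_indices [simp]: "finite (basis_indices a n)"
  by (simp add: basis_indices_def)

lemma homog_basis_elem: "w \<in> Sn n \<Longrightarrow> homog (basis_degree n b) (basis_elem a n b w)"
proof (cases "(a, n, b)" rule: basis_elem.cases)
  case (1 a' n' d c)
  assume "w \<in> Sn n"
  moreover have "homog (1 * d + exp_sum n c) (tvar (w 1) ^ d * taut a n c (\<lambda>i. tvar (w i)))"
    by (intro homog_mult homog_power homog_tvar homog_taut)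
  ultimately show ?thesis using 1 by simp
qed (auto simp: homog_taut)

lemma taut_in_GKM: "(\<lambda>w\<in>Sn n. taut a n c (\<lambda>i. tvar (w i))) \<in> GKM n h"
proof (rule GKM_I)
  fix w assume "w \<in> Sn n"
  then show "taut a n c (\<lambda>i. tvar (w i)) \<in> polys n"
    using Sn_mem by (intro polys_taut) simp
qed (intro dvd_diff_taut dvd_diff_transposed)

text \<open>The cut to \<open>w 1 = k\<close> affects the conditions for the transpositions of
  \<open>1\<close> and \<open>i \<le> h 1\<close> only. In these the elements at both
  \<open>w\<close> and its neighbour are divisible by \<open>t\<^bsub>w(i)\<^esub> -
  t\<^bsub>w(1)\<^esub>\<close> on their own.\<close>

lemma high_taut_in_GKM:
  assumes "c \<in> all_exps n - low_exps (h 1) n"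
  shows "(\<lambda>w\<in>Sn n. if w 1 = k then taut (h 1) n c (\<lambda>i. tvar (w i)) else 0) \<in> GKM n h"
proof (rule GKM_I)
  fix w assume w: "w \<in> Sn n"
  then show "(if w 1 = k then taut (h 1) n c (\<lambda>i. tvar (w i)) else 0) \<in> polys n"
    using Sn_mem by (auto intro!: polys_taut)
next
  fix w j i assume w: "w \<in> Sn n" and ij: "1 \<le> j" "j < i" "i \<le> n" "i \<le> h j"
  let ?w = "w \<circ> Transposition.transpose j i"
  let ?t = "\<lambda>w. taut (h 1) n c (\<lambda>i. tvar (w i))"
  have eq: "tvar (w i) - tvar (w j) dvd ?t w - ?t ?w"
    by (intro dvd_diff_taut dvd_diff_transposed)
  show "tvar (w i) - tvar (w j) dvd
      (if w 1 = k then ?t w else 0) - (if ?w 1 = k then ?t ?w else 0)"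
  proof (cases "j = 1")
    case False
    then have "?w 1 = w 1" using ij by (simp add: Transposition.transpose_def)
    then show ?thesis using eq by simp
  next
    case True
    then have "tvar (w 1) - tvar (w i) dvd ?t w"
      using high_taut_dvd[OF assms, of i "\<lambda>i. tvar (w i)"] ij by simp
    then have 1: "tvar (w i) - tvar (w j) dvd ?t w"
      using True by (metis minus_diff_eq minus_dvd_iff)
    then have 2: "tvar (w i) - tvar (w j) dvd ?t ?w"
      using eq by (metis dvd_diff_right_iff)
    show ?thesis using 1 2 by (auto simp: dvd_diff)
  qed
qed

lemma basis_elem_in_GKM:
  assumes "b \<in> basis_indices (h 1) n" "n \<ge> 1"
  shows "basis_elem (h 1) n b \<in> GKM n h"
proof (cases b)
  case (Inl dc)
  obtain d c where b: "b = Inl (d, c)" using Inl by (cases dc) auto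
  let ?t = "\<lambda>w\<in>Sn n. taut (h 1) n c (\<lambda>i. tvar (w i))"
  have x: "(\<lambda>w\<in>Sn n. tvar (w 1) ^ d) \<in> GKM n h"
  proof (rule GKM_I)
    fix w assume "w \<in> Sn n"
    then show "tvar (w 1) ^ d \<in> polys n"
      using Sn_mem[of w n 1] assms(2) by (intro polys_power) simp
  qed (intro dvd_diff_power dvd_diff_transposed)
  have "basis_elem (h 1) n b = (\<lambda>w\<in>Sn n. (\<lambda>w\<in>Sn n. tvar (w 1) ^ d) w * ?t w)"
    unfolding b basis_elem.simps by (rule restrict_ext) simp
  then show ?thesis by (simp only: GKM_mult[OF x taut_in_GKM])
next
  case (Inr kc)
  obtain k c where b: "b = Inr (k, c)" using Inr by (cases kc) auto
  then have "c \<in> all_exps n - low_exps (h 1) n" using assms(1) by (auto simp: basis_indices_def)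
  then show ?thesis unfolding b basis_elem.simps by (rule high_taut_in_GKM)
qed

lemma high_taut_zero:
  fixes x :: "nat \<Rightarrow> 'a::comm_ring_1"
  assumes "c \<in> all_exps m - low_exps a m" "i \<in> {2..a}" "x 1 = x i"
  shows "taut a m c x = 0"
  using high_taut_dvd[OF assms(1,2), of x] assms(3) by simp

locale first_row_hessenberg =
  fixes n :: nat and h :: "nat \<Rightarrow> nat"
  assumes n_pos: "1 \<le> n" and h1: "1 \<le> h 1" "h 1 \<le> n" and h_top: "\<forall>j\<in>{2..n}. h j = n"
begin

abbreviation "B \<equiv> basis_indices (h 1) n"
abbreviation "bas \<equiv> basis_elem (h 1) n"
abbreviation "tau c w \<equiv> taut (h 1) n c (\<lambda>i. tvar (w i))"

definition start :: "nat \<Rightarrow> nat \<Rightarrow> nat" where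
  "start k = Transposition.transpose 1 k"

lemma start: "k \<in> {1..n} \<Longrightarrow> start k \<in> Sn n" "start k 1 = k"
  using n_pos by (auto simp: start_def intro!: Sn_transpose)

lemma fibre_start: "k \<in> {1..n} \<Longrightarrow> fibre n (start k) n = {w \<in> Sn n. w 1 = k}"
proof (intro equalityI subsetI)
  fix w assume k: "k \<in> {1..n}" and w: "w \<in> {w \<in> Sn n. w 1 = k}"
  have "w q = start k q" if "q \<notin> {2..n}" for q
  proof (cases "q = 1")
    case False
    then have "q \<notin> {1..n}" using that by auto
    then show ?thesis
      using w start(1)[OF k] by (auto simp: Sn_def permutes_def)
  qed (use w start(2) in auto)
  then show "w \<in> fibre n (start k) n" using w by (simp add: fibre_def)
next
  fix w assume "w \<in> fibre n (start k) n"
  then show "w \<in> {w \<in> Sn n. w 1 = k}" using start(2)[of k] by (auto simp: fibre_def)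
qed

lemma start_image: "k \<in> {1..n} \<Longrightarrow> start k ` {2..n} = {1..n} - {k}"
proof -
  assume k: "k \<in> {1..n}"
  have "{2..n} = {1..n} - {1}" by auto
  then show ?thesis
    using image_set_diff[OF Sn_inj[OF start(1)[OF k]], of "{1..n}" "{1}"]
      Sn_image[OF start(1)[OF k]] start(2)[of k] by simp
qed

lemma sum_basis:
  "(\<Sum>b\<in>B. f b) = (\<Sum>c\<in>low_exps (h 1) n. \<Sum>d<n. f (Inl (d, c))) +
     (\<Sum>k=1..n. \<Sum>c\<in>all_exps n - low_exps (h 1) n. f (Inr (k, c)))"
proof -
  have "(\<Sum>b\<in>B. f b) = (\<Sum>(d, c)\<in>{..<n} \<times> low_exps (h 1) n. f (Inl (d, c))) +
      (\<Sum>(k, c)\<in>{1..n} \<times> (all_exps n - low_exps (h 1) n). f (Inr (k, c)))"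
    unfolding basis_indices_def by (subst sum.Plus) (simp_all add: o_def case_prod_beta')
  also have "(\<Sum>(d, c)\<in>{..<n} \<times> low_exps (h 1) n. f (Inl (d, c))) =
      (\<Sum>c\<in>low_exps (h 1) n. \<Sum>d<n. f (Inl (d, c)))"
    unfolding sum.cartesian_product[symmetric] by (rule sum.swap)
  finally show ?thesis by (simp only: sum.cartesian_product)
qed

text \<open>Where \<open>w 1 = k\<close>, a combination of basis elements is a combination of the
  elements \<open>taut\<close>, in which the coefficient of a low exponent is a polynomial in
  \<open>t\<^sub>k\<close> and that of a high exponent is an arbitrary function of
  \<open>k\<close>.\<close>

lemma sum_basis_elem:
  assumes w: "w \<in> Sn n"
  shows "(\<Sum>b\<in>B. P b * bas b w) =
    (\<Sum>c\<in>all_exps n. (if c \<in> low_exps (h 1) n then \<Sum>d<n. P (Inl (d, c)) * tvar (w 1) ^ d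
       else P (Inr (w 1, c))) * tau c w)"
proof -
  let ?L = "low_exps (h 1) n" and ?A = "all_exps n"
  have w1: "w 1 \<in> {1..n}" using Sn_mem[OF w, of 1] n_pos by simp
  have "(\<Sum>b\<in>B. P b * bas b w) =
      (\<Sum>c\<in>?L. (\<Sum>d<n. P (Inl (d, c)) * tvar (w 1) ^ d) * tau c w) +
      (\<Sum>k=1..n. \<Sum>c\<in>?A - ?L. if w 1 = k then P (Inr (k, c)) * tau c w else 0)"
    unfolding sum_basis using w
    by (intro arg_cong2[where f = "(+)"] sum.cong refl) (simp_all add: sum_distrib_right mult.assoc)
  also have "(\<Sum>k=1..n. \<Sum>c\<in>?A - ?L. if w 1 = k then P (Inr (k, c)) * tau c w else 0) =
      (\<Sum>c\<in>?A - ?L. \<Sum>k=1..n. if w 1 = k then P (Inr (k, c)) * tau c w else 0)"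
    by (rule sum.swap)
  also have "\<dots> = (\<Sum>c\<in>?A - ?L. P (Inr (w 1, c)) * tau c w)"
    using w1 by (intro sum.cong refl) (simp add: sum.delta')
  also have "(\<Sum>c\<in>?L. (\<Sum>d<n. P (Inl (d, c)) * tvar (w 1) ^ d) * tau c w) + \<dots> =
      (\<Sum>c\<in>?L. (if c \<in> ?L then \<Sum>d<n. P (Inl (d, c)) * tvar (w 1) ^ d else P (Inr (w 1, c))) * tau c w) +
      (\<Sum>c\<in>?A - ?L. (if c \<in> ?L then \<Sum>d<n. P (Inl (d, c)) * tvar (w 1) ^ d else P (Inr (w 1, c))) * tau c w)"
    by (intro arg_cong2[where f = "(+)"] sum.cong refl) simp_all
  also have "\<dots> = (\<Sum>c\<in>?A. (if c \<in> ?L then \<Sum>d<n. P (Inl (d, c)) * tvar (w 1) ^ d else P (Inr (w 1, c))) * tau c w)"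
    by (subst add.commute, rule sum.subset_diff[symmetric]) (simp_all add: low_exps_subset)
  finally show ?thesis .
qed

text \<open>For each \<open>k\<close> the coefficients of the elements \<open>taut\<close> vanish.
  For low exponents they are the values of a polynomial of degree less than \<open>n\<close> at
  the \<open>n\<close> points \<open>t\<^sub>k\<close>.\<close>

lemma basis_independent:
  assumes zero: "\<And>w. w \<in> Sn n \<Longrightarrow> (\<Sum>b\<in>B. P b * bas b w) = 0" and b: "b \<in> B"
  shows "P b = 0"
proof -
  define C where "C k c = (if c \<in> low_exps (h 1) n then \<Sum>d<n. P (Inl (d, c)) * tvar k ^ d
       else P (Inr (k, c)))" for k c
  have C0: "C k c = 0" if k: "k \<in> {1..n}" and c: "c \<in> all_exps n" for k c
  proof (rule taut_independent[of "start k" n n tvar "h 1" "C k" c, OF start(1)[OF k] n_pos order_refl _ _ _ c])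
    show "inj_on tvar (start k ` {2..n})" by (simp add: inj_on_def)
    show "n \<le> h 1 \<or> tvar (start k 1) \<notin> tvar ` start k ` {2..n}"
      unfolding start_image[OF k] start(2) by auto
  next
    fix w assume "w \<in> fibre n (start k) n"
    then have w: "w \<in> Sn n" "w 1 = k" by (simp_all add: fibre_start[OF k])
    have "(\<Sum>c\<in>all_exps n. C (w 1) c * tau c w) = 0"
      unfolding C_def sum_basis_elem[OF w(1), symmetric] by (rule zero[OF w(1)])
    then show "(\<Sum>c\<in>all_exps n. C k c * tau c w) = 0" by (simp only: w(2))
  qed
  show ?thesis
  proof (cases b)
    case (Inl dc)
    obtain d c where dc: "b = Inl (d, c)" using Inl by (cases dc) auto
    then have d: "d < n" and c: "c \<in> low_exps (h 1) n" using b by (auto simp: basis_indices_def)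
    have "(\<lambda>d. P (Inl (d, c))) d = 0"
    proof (rule powers_independent[where A = "{1..n}" and \<tau> = tvar and d = n and q = "\<lambda>d. P (Inl (d, c))" and i = d])
      fix k assume k: "k \<in> {1..n}"
      have "C k c = 0" by (rule C0[OF k subsetD[OF low_exps_subset c]])
      then show "(\<Sum>d<n. P (Inl (d, c)) * tvar k ^ d) = 0" using c by (simp only: C_def if_True)
    qed (use d in \<open>simp_all add: inj_on_def\<close>)
    then show ?thesis using dc by simp
  next
    case (Inr kc)
    obtain k c where kc: "b = Inr (k, c)" using Inr by (cases kc) auto
    then have k: "k \<in> {1..n}" and c: "c \<in> all_exps n" "c \<notin> low_exps (h 1) n"
      using b by (auto simp: basis_indices_def)
    show ?thesis using C0[OF k c(1)] c(2) by (simp add: C_def kc)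
  qed
qed

text \<open>A member \<open>\<alpha>\<close> has coefficients \<open>P k c\<close> on each set
  \<open>{w. w 1 = k}\<close>, since the conditions among the positions \<open>2, \<dots>,
  n\<close> are complete. Those of high exponents can be prescribed for each \<open>k\<close>; it
  remains to see that those of low exponents are polynomials in \<open>t\<^sub>k\<close> of degree
  less than \<open>n\<close>, that is, to verify the hypothesis of interpolation.\<close>

lemma basis_spanning:
  assumes \<alpha>: "\<alpha> \<in> GKM n h"
  shows "\<exists>P. (\<forall>b. P b \<in> polys n) \<and> (\<forall>w\<in>Sn n. \<alpha> w = (\<Sum>b\<in>B. P b * bas b w))"
proof -
  let ?L = "low_exps (h 1) n" and ?A = "all_exps n"
  have dvd: "tvar (w i) - tvar (w j) dvd \<alpha> w - \<alpha> (w \<circ> Transposition.transpose i j)"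
    if w: "w \<in> Sn n" and ij: "i \<in> {1..n}" "j \<in> {1..n}" "i \<noteq> j"
      and adm: "2 \<le> i \<and> 2 \<le> j \<or> i \<le> h 1 \<and> j \<le> h 1" for w i j
  proof -
    have *: "tvar (w q) - tvar (w p) dvd \<alpha> w - \<alpha> (w \<circ> Transposition.transpose p q)"
      if "p \<in> {1..n}" "q \<in> {1..n}" "p < q" "2 \<le> p \<or> q \<le> h 1" for p q
    proof (rule GKM_dvd[OF \<alpha> w])
      show "q \<le> h p"
        using that h_top by (cases "p = 1") auto
    qed (use that in auto)
    show ?thesis
    proof (cases "j < i")
      case True
      then show ?thesis
        using *[of j i] ij adm by (subst transpose_commute) auto
    next
      case False
      then have "tvar (w j) - tvar (w i) dvd \<alpha> w - \<alpha> (w \<circ> Transposition.transpose i j)"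
        using ij adm by (intro *) auto
      then show ?thesis by (metis minus_diff_eq minus_dvd_iff)
    qed
  qed
  have "\<forall>k\<in>{1..n}. \<exists>P. \<forall>w\<in>fibre n (start k) n. \<alpha> w = (\<Sum>c\<in>?A. P c * tau c w)"
  proof
    fix k assume k: "k \<in> {1..n}"
    show "\<exists>P. \<forall>w\<in>fibre n (start k) n. \<alpha> w = (\<Sum>c\<in>?A. P c * tau c w)"
    proof (rule taut_spanning[OF start(1)[OF k] n_pos order_refl])
      fix w i j assume "w \<in> fibre n (start k) n" "i \<in> {2..n}" "j \<in> {2..n}" "i \<noteq> j"
      then show "tvar (w i) - tvar (w j) dvd \<alpha> w - \<alpha> (w \<circ> Transposition.transpose i j)"
        by (intro dvd) (auto simp: fibre_def)
    qed
  qed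
  from bchoice[OF this]
  obtain P where "\<forall>k\<in>{1..n}. \<forall>w\<in>fibre n (start k) n. \<alpha> w = (\<Sum>c\<in>?A. P k c * tau c w)"
    by (rule exE)
  then have P: "\<alpha> w = (\<Sum>c\<in>?A. P (w 1) c * tau c w)" if "w \<in> Sn n" for w
    using that Sn_mem[OF that, of 1] n_pos fibre_start by simp
  have compat: "tvar k - tvar l dvd P k c - P l c"
    if k: "k \<in> {1..n}" and l: "l \<in> {1..n}" and c: "c \<in> ?L" for k l c
  proof (cases "k = l")
    case False
    let ?\<tau> = "identify k l"
    have "subst ?\<tau> (P k c - P l c) = 0"
    proof (rule low_taut_independent[of "start k" n "h 1" n ?\<tau> l "\<lambda>c. subst ?\<tau> (P k c - P l c)" c,
          OF start(1)[OF k] h1 order_refl])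
      show "inj_on ?\<tau> (start k ` {2..n})"
        unfolding start_image[OF k] by (auto simp: inj_on_def identify_def)
      show "l \<in> start k ` {2..n}"
        unfolding start_image[OF k] using l False by simp
      show "c \<in> ?L" by (rule c)
    next
      fix w assume "w \<in> fibre n (start k) n" and "l \<in> w ` {2..h 1}"
      then obtain i where w: "w \<in> Sn n" "w 1 = k" and i: "i \<in> {2..h 1}" "w i = l"
        by (auto simp: fibre_start[OF k])
      define w' where "w' = w \<circ> Transposition.transpose 1 i"
      have w': "w' \<in> Sn n"
        unfolding w'_def using w i h1 by (intro Sn_comp Sn_transpose) auto
      have w'1: "w' 1 = l" using i by (simp add: w'_def)
      have "tvar (w 1) - tvar (w i) dvd \<alpha> w - \<alpha> w'"
        unfolding w'_def using i h1 by (intro dvd w) auto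
      then have sub: "subst ?\<tau> (\<alpha> w) = subst ?\<tau> (\<alpha> w')"
        unfolding w(2) i(2) by (simp add: dvd_iff_identify subst_diff)
      have eq: "(\<lambda>q. ?\<tau> (w' q)) = (\<lambda>q. ?\<tau> (w q))"
        using i w by (auto simp: fun_eq_iff w'_def Transposition.transpose_def identify_def)
      let ?T = "\<lambda>c. taut (h 1) n c (\<lambda>i. ?\<tau> (w i))"
      have "(\<Sum>c\<in>?L. subst ?\<tau> (P k c - P l c) * ?T c) =
          (\<Sum>c\<in>?A. subst ?\<tau> (P k c - P l c) * ?T c)"
      proof (rule sum.mono_neutral_left)
        \<comment> \<open>Identifying \<open>t\<^sub>k\<close> and \<open>t\<^sub>l\<close> makes
          \<open>x\<^sub>1\<close> and \<open>x\<^sub>i\<close> equal at \<open>w\<close>, and a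
          high element contains the factor \<open>x\<^sub>1 - x\<^sub>i\<close>.\<close>
        show "\<forall>c\<in>?A - ?L. subst ?\<tau> (P k c - P l c) * ?T c = 0"
        proof
          fix c assume c: "c \<in> ?A - ?L"
          have "?\<tau> (w 1) = ?\<tau> (w i)" unfolding w(2) i(2) by (simp add: identify_def)
          from high_taut_zero[OF c i(1) this]
          show "subst ?\<tau> (P k c - P l c) * ?T c = 0" by simp
        qed
      qed (simp_all add: low_exps_subset)
      also have "\<dots> = subst ?\<tau> (\<alpha> w) - subst ?\<tau> (\<alpha> w')"
        unfolding P[OF w(1)] P[OF w'] w(2) w'1 subst_sum subst_mult subst_taut subst_tvar eq subst_diff
        by (simp only: left_diff_distrib sum_subtractf)
      also have "\<dots> = 0" using sub by simp
      finally show "(\<Sum>c\<in>?L. subst ?\<tau> (P k c - P l c) * ?T c) = 0" .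
    qed
    then show ?thesis by (simp add: dvd_iff_identify)
  qed simp
  have "\<forall>c\<in>?L. \<exists>Q. \<forall>k\<in>{1..n}. P k c = (\<Sum>d<card {1..n}. Q d * tvar k ^ d)"
    by (intro ballI newton_interpolation compat) simp
  from bchoice[OF this]
  obtain Q where "\<forall>c\<in>?L. \<forall>k\<in>{1..n}. P k c = (\<Sum>d<card {1..n}. Q c d * tvar k ^ d)"
    by (rule exE)
  then have Q: "\<forall>c\<in>?L. \<forall>k\<in>{1..n}. P k c = (\<Sum>d<n. Q c d * tvar k ^ d)" by simp
  define R where "R b = drop_vars n (case b of Inl (d, c) \<Rightarrow> Q c d | Inr (k, c) \<Rightarrow> P k c)" for b
  have "\<alpha> w = (\<Sum>b\<in>B. R b * bas b w)" if w: "w \<in> Sn n" for w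
  proof -
    have w1: "w 1 \<in> {1..n}" using Sn_mem[OF w, of 1] n_pos by simp
    have dt: "drop_vars n (tau c w) = tau c w" for c
      by (rule drop_vars_id, rule polys_taut) (use Sn_mem[OF w] in simp)
    have d1: "drop_vars n (tvar (w 1)) = tvar (w 1)"
      using w1 by (intro drop_vars_id) simp
    \<comment> \<open>The coefficients found so far may involve other variables, which are now
      deleted.\<close>
    have "\<alpha> w = drop_vars n (\<alpha> w)"
      using GKM_polys[OF \<alpha> w] by (simp add: drop_vars_id)
    also have "\<dots> = (\<Sum>c\<in>?A. drop_vars n (P (w 1) c) * tau c w)"
      using dt unfolding P[OF w] drop_vars_def subst_sum subst_mult by (simp only:)
    also have "\<dots> = (\<Sum>c\<in>?A. (if c \<in> ?L then \<Sum>d<n. R (Inl (d, c)) * tvar (w 1) ^ d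
        else R (Inr (w 1, c))) * tau c w)"
    proof (intro sum.cong refl arg_cong2[where f = "(*)"])
      fix c
      have "drop_vars n (\<Sum>d<n. Q c d * tvar (w 1) ^ d) = (\<Sum>d<n. drop_vars n (Q c d) * tvar (w 1) ^ d)"
        using d1 unfolding drop_vars_def subst_sum subst_mult subst_power by (simp only:)
      then show "drop_vars n (P (w 1) c) =
          (if c \<in> ?L then \<Sum>d<n. R (Inl (d, c)) * tvar (w 1) ^ d else R (Inr (w 1, c)))"
        using Q w1 by (simp add: R_def)
    qed
    finally show ?thesis unfolding sum_basis_elem[OF w] .
  qed
  moreover have "R b \<in> polys n" for b by (simp add: R_def drop_vars_in_polys)
  ultimately show ?thesis by (intro exI[of _ R] conjI allI ballI)
qed

end

section \<open>Reduction modulo the ideal generated by the variables\<close>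

abbreviation const :: "complex \<Rightarrow> cpoly" where
  "const c \<equiv> Poly_Mapping.single 0 c"

lemma polys_decompose:
  assumes "f \<in> polys n"
  obtains g where "\<forall>i. g i \<in> polys n" "f = const (Poly_Mapping.lookup f 0) + (\<Sum>i=1..n. tvar i * g i)"
proof -
  have "\<exists>g. drop_vars n f = const (Poly_Mapping.lookup f 0) + (\<Sum>i=1..n. tvar i * g i)"
  proof (induction f rule: cpoly_induct)
    case zero
    show ?case by (intro exI[of _ "\<lambda>_. 0"]) (simp add: drop_vars_def)
  next
    case (single m c)
    let ?\<tau> = "\<lambda>i. if i \<in> {1..n} then tvar i else 0"
    show ?case
    proof (cases "m = 0")
      case True
      then show ?thesis by (intro exI[of _ "\<lambda>_. 0"]) (simp add: drop_vars_def)
    next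
      case False
      then obtain i where i: "i \<in> Poly_Mapping.keys m"
        using poly_mapping_eqI[of m 0] by (auto simp: in_keys_iff)
      then have "?\<tau> i dvd ?\<tau> i ^ Poly_Mapping.lookup m i"
        by (intro dvd_power) (simp add: in_keys_iff)
      also have "\<dots> dvd mono_subst ?\<tau> m"
        unfolding mono_subst_def using i by (intro dvd_prodI) auto
      finally have "?\<tau> i dvd drop_vars n (Poly_Mapping.single m c)"
        unfolding drop_vars_def subst_single by (rule dvd_mult)
      then obtain q where q: "drop_vars n (Poly_Mapping.single m c) = ?\<tau> i * q"
        by (rule dvdE)
      have "(\<Sum>j=1..n. tvar j * (if j = i then q else 0)) = ?\<tau> i * q"
        by (simp add: if_distrib[of "\<lambda>x. tvar _ * x"] sum.delta cong: if_cong)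
      then show ?thesis
        using False by (intro exI[of _ "\<lambda>j. if j = i then q else 0"])
          (simp only: q lookup_single when_def if_False single_zero add_0_left)
    qed
  next
    case (add f f')
    then obtain g g' where "drop_vars n f = const (Poly_Mapping.lookup f 0) + (\<Sum>i=1..n. tvar i * g i)"
      "drop_vars n f' = const (Poly_Mapping.lookup f' 0) + (\<Sum>i=1..n. tvar i * g' i)" by blast
    then show ?case
      by (intro exI[of _ "\<lambda>i. g i + g' i"])
        (simp add: drop_vars_def subst_add lookup_add single_add distrib_left sum.distrib)
  qed
  then obtain g where g: "f = const (Poly_Mapping.lookup f 0) + (\<Sum>i=1..n. tvar i * g i)"
    using drop_vars_id[OF assms] by auto
  have t: "subst (\<lambda>i. if i \<in> {1..n} then tvar i else 0) (tvar i) = tvar i" if "i \<in> {1..n}" for i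
    using that by simp
  have "drop_vars n f = const (Poly_Mapping.lookup f 0) + (\<Sum>i=1..n. tvar i * drop_vars n (g i))"
    by (subst g) (simp only: drop_vars_def subst_add subst_sum subst_mult subst_const t cong: sum.cong)
  then show ?thesis
    using that[of "\<lambda>i. drop_vars n (g i)"] drop_vars_id[OF assms] drop_vars_in_polys by simp
qed

lemma ideal_add:
  assumes "\<gamma> \<in> GKM_t_ideal n h" "\<delta> \<in> GKM_t_ideal n h"
  shows "(\<lambda>w\<in>Sn n. \<gamma> w + \<delta> w) \<in> GKM_t_ideal n h"
proof -
  obtain \<beta> \<beta>' where \<beta>: "\<gamma> = (\<lambda>w\<in>Sn n. \<Sum>i=1..n. tvar i * \<beta> i w)" "\<forall>i\<in>{1..n}. \<beta> i \<in> GKM n h"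
    and \<beta>': "\<delta> = (\<lambda>w\<in>Sn n. \<Sum>i=1..n. tvar i * \<beta>' i w)" "\<forall>i\<in>{1..n}. \<beta>' i \<in> GKM n h"
    using assms unfolding GKM_t_ideal_def by auto
  have "(\<lambda>w\<in>Sn n. \<gamma> w + \<delta> w) = (\<lambda>w\<in>Sn n. \<Sum>i=1..n. tvar i * (\<lambda>w\<in>Sn n. \<beta> i w + \<beta>' i w) w)"
    by (rule restrict_ext) (simp add: \<beta>(1) \<beta>'(1) distrib_left sum.distrib)
  moreover have "\<forall>i\<in>{1..n}. (\<lambda>w\<in>Sn n. \<beta> i w + \<beta>' i w) \<in> GKM n h"
    using \<beta>(2) \<beta>'(2) by (intro ballI GKM_add) simp_all
  ultimately show ?thesis unfolding GKM_t_ideal_def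
    by (intro CollectI exI[of _ "\<lambda>i. \<lambda>w\<in>Sn n. \<beta> i w + \<beta>' i w"] conjI)
qed

lemma ideal_scale:
  assumes "f \<in> polys n" "Poly_Mapping.lookup f 0 = 0" "\<gamma> \<in> GKM n h"
  shows "(\<lambda>w\<in>Sn n. f * \<gamma> w) \<in> GKM_t_ideal n h"
proof -
  obtain g where g: "\<forall>i. g i \<in> polys n" and "f = const (Poly_Mapping.lookup f 0) + (\<Sum>i=1..n. tvar i * g i)"
    by (rule polys_decompose[OF assms(1)])
  then have f: "f = (\<Sum>i=1..n. tvar i * g i)" using assms(2) by simp
  have "(\<lambda>w\<in>Sn n. f * \<gamma> w) = (\<lambda>w\<in>Sn n. \<Sum>i=1..n. tvar i * (\<lambda>w\<in>Sn n. g i * \<gamma> w) w)"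
    by (rule restrict_ext) (simp add: f sum_distrib_right mult.assoc)
  moreover have "\<forall>i\<in>{1..n}. (\<lambda>w\<in>Sn n. g i * \<gamma> w) \<in> GKM n h"
    using g assms(3) by (intro ballI GKM_scale) simp_all
  ultimately show ?thesis unfolding GKM_t_ideal_def
    by (intro CollectI exI[of _ "\<lambda>i. \<lambda>w\<in>Sn n. g i * \<gamma> w"] conjI)
qed

lemma zero_in_ideal: "(\<lambda>w\<in>Sn n. 0) \<in> GKM_t_ideal n h"
  using ideal_scale[of 0 n "\<lambda>w\<in>Sn n. 0" h] GKM_const[of 0 n h] by simp

lemma ideal_sum:
  assumes "\<And>a. a \<in> A \<Longrightarrow> (\<lambda>w\<in>Sn n. \<gamma> a w) \<in> GKM_t_ideal n h"
  shows "(\<lambda>w\<in>Sn n. \<Sum>a\<in>A. \<gamma> a w) \<in> GKM_t_ideal n h"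
  using assms
proof (induction A rule: infinite_finite_induct)
  case (insert a A)
  have "(\<lambda>w\<in>Sn n. \<Sum>a\<in>insert a A. \<gamma> a w) =
      (\<lambda>w\<in>Sn n. (\<lambda>w\<in>Sn n. \<gamma> a w) w + (\<lambda>w\<in>Sn n. \<Sum>a\<in>A. \<gamma> a w) w)"
    using insert.hyps by (intro restrict_ext) simp
  also have "\<dots> \<in> GKM_t_ideal n h"
    using insert.prems insert.IH by (intro ideal_add) simp_all
  finally show ?case .
qed (simp_all add: zero_in_ideal)

lemma dot_action_GKM:
  assumes v: "v \<in> Sn n" and "\<alpha> \<in> GKM n h"
  shows "dot_action n v \<alpha> \<in> GKM n h"
  unfolding dot_action_def
proof (rule GKM_I)
  have bij: "bij v" using v by (simp add: Sn_def permutes_bij)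
  fix w assume w: "w \<in> Sn n"
  have iw: "Hilbert_Choice.inv v \<circ> w \<in> Sn n" by (intro Sn_comp Sn_inv v w)
  show "perm_poly v (\<alpha> (Hilbert_Choice.inv v \<circ> w)) \<in> polys n"
    unfolding perm_poly_eq_subst using Sn_mem[OF v]
    by (intro subst_in_polys GKM_polys[OF assms(2) iw]) simp
  fix j i assume ij: "1 \<le> j" "j < i" "i \<le> n" "i \<le> h j"
  let ?u = "Hilbert_Choice.inv v \<circ> w"
  let ?s = "subst (\<lambda>i. tvar (v i))"
  have "tvar (?u i) - tvar (?u j) dvd \<alpha> ?u - \<alpha> (?u \<circ> Transposition.transpose j i)"
    by (rule GKM_dvd[OF assms(2) iw ij])
  then have "?s (tvar (?u i) - tvar (?u j)) dvd ?s (\<alpha> ?u - \<alpha> (?u \<circ> Transposition.transpose j i))"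
    unfolding dvd_def by (auto simp: subst_mult)
  then show "tvar (w i) - tvar (w j) dvd perm_poly v (\<alpha> ?u) -
      perm_poly v (\<alpha> (Hilbert_Choice.inv v \<circ> (w \<circ> Transposition.transpose j i)))"
    using bij by (simp add: perm_poly_eq_subst subst_diff bij_is_surj surj_f_inv_f o_assoc)
qed

lemma dot_action_GKM_degree:
  assumes v: "v \<in> Sn n" and "\<alpha> \<in> GKM_degree n h k"
  shows "dot_action n v \<alpha> \<in> GKM_degree n h k"
proof -
  have \<alpha>: "\<alpha> \<in> GKM n h" "\<And>w. w \<in> Sn n \<Longrightarrow> homog k (\<alpha> w)"
    using assms(2) by (auto simp: GKM_degree_def homog_polys_iff)
  have *: "dot_action n v \<alpha> \<in> GKM n h" by (rule dot_action_GKM[OF v \<alpha>(1)])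
  have "dot_action n v \<alpha> w \<in> homog_polys n k" if w: "w \<in> Sn n" for w
    using GKM_polys[OF * w] w
    by (auto simp: homog_polys_iff dot_action_def perm_poly_eq_subst intro!: homog_subst_tvar \<alpha>(2)
        Sn_comp Sn_inv v)
  then have "dot_action n v \<alpha> \<in> Sn n \<rightarrow>\<^sub>E homog_polys n k"
    by (intro PiE_I) (auto simp: dot_action_def)
  then show ?thesis using * by (simp add: GKM_degree_def)
qed

lemma dot_action_ideal:
  assumes v: "v \<in> Sn n" and "\<gamma> \<in> GKM_t_ideal n h"
  shows "dot_action n v \<gamma> \<in> GKM_t_ideal n h"
proof -
  obtain \<beta> where \<gamma>: "\<gamma> = (\<lambda>w\<in>Sn n. \<Sum>i=1..n. tvar i * \<beta> i w)" and \<beta>: "\<forall>i\<in>{1..n}. \<beta> i \<in> GKM n h"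
    using assms(2) unfolding GKM_t_ideal_def by auto
  let ?v' = "Hilbert_Choice.inv v"
  have vp: "v permutes {1..n}" using v by (simp add: Sn_def)
  have "dot_action n v \<gamma> = (\<lambda>w\<in>Sn n. \<Sum>i=1..n. tvar i * dot_action n v (\<beta> (?v' i)) w)"
    unfolding dot_action_def
  proof (rule restrict_ext)
    fix w assume w: "w \<in> Sn n"
    have iw: "?v' \<circ> w \<in> Sn n" by (intro Sn_comp Sn_inv v w)
    have "perm_poly v (\<gamma> (?v' \<circ> w)) = (\<Sum>i=1..n. tvar (v i) * perm_poly v (\<beta> i (?v' \<circ> w)))"
      using iw by (simp add: \<gamma> perm_poly_eq_subst subst_hom)
    also have "\<dots> = (\<Sum>i=1..n. tvar (v i) * perm_poly v (\<beta> (?v' (v i)) (?v' \<circ> w)))"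
      using vp by (simp add: permutes_inverses)
    also have "\<dots> = (\<Sum>i=1..n. tvar i * perm_poly v (\<beta> (?v' i) (?v' \<circ> w)))"
      by (rule sum.permute[OF vp, unfolded o_def, symmetric])
    also have "\<dots> = (\<Sum>i=1..n. tvar i * (\<lambda>w\<in>Sn n. perm_poly v (\<beta> (?v' i) (?v' \<circ> w))) w)"
      using w by simp
    finally show "perm_poly v (\<gamma> (?v' \<circ> w)) = \<dots>" .
  qed
  moreover have "\<forall>i\<in>{1..n}. dot_action n v (\<beta> (?v' i)) \<in> GKM n h"
    using \<beta> Sn_mem[OF Sn_inv[OF v]] by (intro ballI dot_action_GKM[OF v]) blast
  ultimately show ?thesis unfolding GKM_t_ideal_def
    by (intro CollectI exI[of _ "\<lambda>i. dot_action n v (\<beta> (?v' i))"] conjI)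
qed

lemma basis_degree_perm [simp]: "basis_degree n (basis_perm v b) = basis_degree n b"
  by (cases b) auto

text \<open>The permutation \<open>v\<close> maps
  \<open>t\<^bsub>v\<^sup>-\<^sup>1w(i)\<^esub>\<close> to \<open>t\<^bsub>w(i)\<^esub>\<close>,
  so it fixes every function of \<open>x\<^sub>1, \<dots>, x\<^sub>n\<close>, while the condition
  \<open>(v\<^sup>-\<^sup>1w)(1) = k\<close> becomes \<open>w(1) = v(k)\<close>.\<close>

lemma perm_poly_basis_elem:
  assumes v: "v \<in> Sn n" and w: "w \<in> Sn n"
  shows "perm_poly v (basis_elem a n b (Hilbert_Choice.inv v \<circ> w)) = basis_elem a n (basis_perm v b) w"
proof -
  have iw: "Hilbert_Choice.inv v \<circ> w \<in> Sn n" by (intro Sn_comp Sn_inv v w)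
  have inv: "v (Hilbert_Choice.inv v i) = i" "(Hilbert_Choice.inv v i = k) = (i = v k)" for i k
    using v by (auto simp: Sn_def permutes_inverses)
  show ?thesis
    using iw w by (cases b) (auto simp: perm_poly_eq_subst subst_mult subst_power subst_taut inv)
qed

context first_row_hessenberg
begin

definition Bdeg :: "nat \<Rightarrow> basis_index set" where
  "Bdeg k = {b \<in> B. basis_degree n b = k}"

definition lincomb :: "nat \<Rightarrow> (basis_index \<Rightarrow> complex) \<Rightarrow> (nat \<Rightarrow> nat) \<Rightarrow> cpoly" where
  "lincomb k \<kappa> = (\<lambda>w\<in>Sn n. \<Sum>b\<in>Bdeg k. const (\<kappa> b) * bas b w)"

lemma finite_Bdeg [simp]: "finite (Bdeg k)"
  by (simp add: Bdeg_def)

lemma lincomb_in_GKM_degree: "lincomb k \<kappa> \<in> GKM_degree n h k"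
proof -
  have b: "bas b \<in> GKM n h" if "b \<in> Bdeg k" for b
    using that n_pos by (intro basis_elem_in_GKM) (auto simp: Bdeg_def)
  have "lincomb k \<kappa> = (\<lambda>w\<in>Sn n. \<Sum>b\<in>Bdeg k. (\<lambda>w\<in>Sn n. const (\<kappa> b) * bas b w) w)"
    unfolding lincomb_def by (rule restrict_ext) simp
  also have "\<dots> \<in> GKM n h"
    by (intro GKM_sum GKM_scale b polys_const)
  finally have G: "lincomb k \<kappa> \<in> GKM n h" .
  have "lincomb k \<kappa> w \<in> homog_polys n k" if w: "w \<in> Sn n" for w
  proof -
    have "homog (0 + basis_degree n b) (const (\<kappa> b) * bas b w)" for b
      by (intro homog_mult homog_const homog_basis_elem w)
    then have "homog k (lincomb k \<kappa> w)"
      using w by (auto simp: lincomb_def Bdeg_def intro!: homog_sum)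
    then show ?thesis using GKM_polys[OF G w] by (simp add: homog_polys_iff)
  qed
  then have "lincomb k \<kappa> \<in> Sn n \<rightarrow>\<^sub>E homog_polys n k"
    by (intro PiE_I) (auto simp: lincomb_def)
  then show ?thesis using G by (simp add: GKM_degree_def)
qed

text \<open>In the part of degree \<open>k\<close> the coefficient of a basis element
  \<open>b\<close> is homogeneous of degree \<open>k - deg b\<close>. If this is positive then the
  term lies in the ideal. What remains are the constant coefficients of the elements of degree
  \<open>k\<close>.\<close>

lemma spanning_mod_ideal:
  assumes "\<alpha> \<in> GKM_degree n h k"
  shows "\<exists>\<kappa>. (\<lambda>w\<in>Sn n. \<alpha> w - lincomb k \<kappa> w) \<in> GKM_t_ideal n h"
proof -
  have \<alpha>: "\<alpha> \<in> GKM n h" "\<And>w. w \<in> Sn n \<Longrightarrow> homog k (\<alpha> w)"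
    using assms by (auto simp: GKM_degree_def homog_polys_iff)
  obtain P where P: "\<forall>b. P b \<in> polys n" "\<forall>w\<in>Sn n. \<alpha> w = (\<Sum>b\<in>B. P b * bas b w)"
    using basis_spanning[OF \<alpha>(1)] by (elim exE conjE)
  define R where "R b = (if basis_degree n b \<le> k then component (k - basis_degree n b) (P b) else 0)" for b
  define \<kappa> where "\<kappa> b = Poly_Mapping.lookup (R b) 0" for b
  have tz: "(total_degree 0 = d) = (d = 0)" for d using total_degree_eq_0[of 0] by auto
  have R: "\<alpha> w = (\<Sum>b\<in>B. R b * bas b w)" if w: "w \<in> Sn n" for w
  proof -
    have "\<alpha> w = component k (\<alpha> w)"
      using \<alpha>(2)[OF w] by (simp add: component_homog)
    also have "\<dots> = (\<Sum>b\<in>B. component k (P b * bas b w))"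
      using P(2) w by (simp only: component_sum)
    also have "\<dots> = (\<Sum>b\<in>B. R b * bas b w)"
      by (intro sum.cong refl) (simp add: component_mult_homog[OF homog_basis_elem[OF w]] R_def)
    finally show ?thesis .
  qed
  have Rp: "R b \<in> polys n" for b using P(1) by (simp add: R_def component_in_polys)
  have \<kappa>0: "\<kappa> b = 0" if "b \<in> B - Bdeg k" for b
    using that by (auto simp: \<kappa>_def R_def Bdeg_def lookup_component tz)
  have "\<alpha> w - lincomb k \<kappa> w = (\<Sum>b\<in>B. (R b - const (\<kappa> b)) * bas b w)" if w: "w \<in> Sn n" for w
  proof -
    have "lincomb k \<kappa> w = (\<Sum>b\<in>Bdeg k. const (\<kappa> b) * bas b w)"
      using w by (simp add: lincomb_def)
    also have "\<dots> = (\<Sum>b\<in>B. const (\<kappa> b) * bas b w)"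
      by (rule sum.mono_neutral_left) (use \<kappa>0 in \<open>auto simp: Bdeg_def\<close>)
    finally show ?thesis
      unfolding R[OF w] by (simp only: left_diff_distrib sum_subtractf)
  qed
  then have "(\<lambda>w\<in>Sn n. \<alpha> w - lincomb k \<kappa> w) = (\<lambda>w\<in>Sn n. \<Sum>b\<in>B. (R b - const (\<kappa> b)) * bas b w)"
    by (rule restrict_ext)
  also have "\<dots> \<in> GKM_t_ideal n h"
  proof (intro ideal_sum ideal_scale)
    fix b assume "b \<in> B"
    then show "bas b \<in> GKM n h" using n_pos by (intro basis_elem_in_GKM)
    show "R b - const (\<kappa> b) \<in> polys n" by (intro polys_diff Rp polys_const)
    show "Poly_Mapping.lookup (R b - const (\<kappa> b)) 0 = 0" by (simp add: lookup_minus \<kappa>_def)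
  qed
  finally show ?thesis by (rule exI[of _ \<kappa>])
qed

text \<open>Expand an element of the ideal in the basis: its coefficients have the form
  \<open>\<Sum>\<^sub>i t\<^sub>i P i b\<close>. By independence over the polynomials they are the
  constants \<open>\<kappa> b\<close>, which are therefore zero, as setting all variables to zero
  shows.\<close>

lemma independent_mod_ideal:
  assumes "lincomb k \<kappa> \<in> GKM_t_ideal n h" "b \<in> Bdeg k"
  shows "\<kappa> b = 0"
proof -
  obtain \<beta> where \<gamma>: "lincomb k \<kappa> = (\<lambda>w\<in>Sn n. \<Sum>i=1..n. tvar i * \<beta> i w)"
    and \<beta>: "\<forall>i\<in>{1..n}. \<beta> i \<in> GKM n h"
    using assms(1) unfolding GKM_t_ideal_def by auto
  have "\<forall>i\<in>{1..n}. \<exists>P. \<forall>w\<in>Sn n. \<beta> i w = (\<Sum>b\<in>B. P b * bas b w)"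
    using \<beta> basis_spanning by blast
  from bchoice[OF this]
  obtain P where P: "\<forall>i\<in>{1..n}. \<forall>w\<in>Sn n. \<beta> i w = (\<Sum>b\<in>B. P i b * bas b w)" by (rule exE)
  define Q where "Q b = (if b \<in> Bdeg k then const (\<kappa> b) else 0) - (\<Sum>i=1..n. tvar i * P i b)" for b
  have "Q b = 0"
  proof (rule basis_independent[of Q])
    show "b \<in> B" using assms(2) by (simp add: Bdeg_def)
    fix w assume w: "w \<in> Sn n"
    have "(\<Sum>b\<in>B. (if b \<in> Bdeg k then const (\<kappa> b) else 0) * bas b w) = lincomb k \<kappa> w"
      unfolding lincomb_def using w
      by (simp, intro sum.mono_neutral_cong_right) (auto simp: Bdeg_def)
    also have "\<dots> = (\<Sum>i=1..n. tvar i * (\<Sum>b\<in>B. P i b * bas b w))"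
      unfolding \<gamma> using P w by simp
    also have "\<dots> = (\<Sum>i=1..n. \<Sum>b\<in>B. tvar i * P i b * bas b w)"
      by (simp add: sum_distrib_left mult.assoc)
    also have "\<dots> = (\<Sum>b\<in>B. \<Sum>i=1..n. tvar i * P i b * bas b w)"
      by (rule sum.swap)
    finally show "(\<Sum>b\<in>B. Q b * bas b w) = 0"
      by (simp add: Q_def left_diff_distrib sum_subtractf sum_distrib_right)
  qed
  then have "subst (\<lambda>_. 0) (Q b) = 0" by simp
  then have "const (\<kappa> b) = 0"
    using assms(2) by (simp add: Q_def subst_hom)
  then show ?thesis by (metis lookup_single_eq lookup_zero)
qed

lemma basis_perm_bij:
  assumes v: "v \<in> Sn n"
  shows "bij_betw (basis_perm v) (Bdeg k) (Bdeg k)"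
proof -
  have "basis_perm u b \<in> Bdeg k" if "u \<in> Sn n" "b \<in> Bdeg k" for u b
    using that Sn_mem[OF that(1)] unfolding Bdeg_def basis_indices_def
    by (cases b) auto
  moreover have "basis_perm v (basis_perm (Hilbert_Choice.inv v) b) = b"
    "basis_perm (Hilbert_Choice.inv v) (basis_perm v b) = b" for b
    using v by (simp_all add: basis_perm_comp basis_perm_id Sn_def permutes_inv_o)
  ultimately show ?thesis
    using v Sn_inv[OF v] by (intro bij_betwI[where g = "basis_perm (Hilbert_Choice.inv v)"]) auto
qed

lemma dot_action_lincomb:
  assumes v: "v \<in> Sn n"
  shows "dot_action n v (lincomb k \<kappa>) = lincomb k (\<lambda>b. \<kappa> (basis_perm (Hilbert_Choice.inv v) b))"
  unfolding dot_action_def lincomb_def[of _ "\<lambda>b. \<kappa> (basis_perm (Hilbert_Choice.inv v) b)"]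
proof (rule restrict_ext)
  fix w assume w: "w \<in> Sn n"
  have iw: "Hilbert_Choice.inv v \<circ> w \<in> Sn n" by (intro Sn_comp Sn_inv v w)
  have "perm_poly v (lincomb k \<kappa> (Hilbert_Choice.inv v \<circ> w)) =
      (\<Sum>b\<in>Bdeg k. const (\<kappa> b) * perm_poly v (bas b (Hilbert_Choice.inv v \<circ> w)))"
    using iw by (simp add: lincomb_def perm_poly_eq_subst subst_hom)
  also have "\<dots> = (\<Sum>b\<in>Bdeg k. const (\<kappa> (basis_perm (Hilbert_Choice.inv v) (basis_perm v b))) *
      bas (basis_perm v b) w)"
    using v by (simp add: perm_poly_basis_elem[OF v w] basis_perm_comp basis_perm_id Sn_def permutes_inv_o)
  also have "\<dots> = (\<Sum>b\<in>Bdeg k. const (\<kappa> (basis_perm (Hilbert_Choice.inv v) b)) * bas b w)"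
    by (rule sum.reindex_bij_betw[OF basis_perm_bij[OF v]])
  finally show "perm_poly v (lincomb k \<kappa> (Hilbert_Choice.inv v \<circ> w)) = \<dots>" .
qed

end

section \<open>Counting the basis by degree\<close>

lemma q_number_eq: "q_number j = (\<Sum>i<j. qvar ^ i)"
proof -
  have "(1 - qvar) * (\<Sum>i<j. qvar ^ i) = 1 - qvar ^ j"
    by (rule one_diff_power_eq[symmetric])
  moreover have "1 - qvar \<noteq> (0 :: int poly)" by (simp add: one_pCons)
  ultimately show ?thesis
    unfolding q_number_def by (metis nonzero_mult_div_cancel_left)
qed

lemma q_number_add: "q_number (i + j) = q_number i + qvar ^ i * q_number j"
proof (induction j)
  case (Suc j)
  then show ?case by (simp add: q_number_eq power_add algebra_simps)
qed (simp add: q_number_eq)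

lemma degree_generating_function:
  assumes "\<And>p. p \<in> {2..m} \<Longrightarrow> C p = {..<r p}"
  shows "(\<Sum>c\<in>(\<Pi>\<^sub>E p\<in>{2..m}. C p). qvar ^ exp_sum m c) = (\<Prod>p=2..m. q_number (r p))"
proof -
  have "(\<Prod>p=2..m. q_number (r p)) = (\<Prod>p=2..m. \<Sum>i\<in>C p. qvar ^ i)"
    using assms by (intro prod.cong) (simp_all add: q_number_eq)
  also have "\<dots> = (\<Sum>c\<in>(\<Pi>\<^sub>E p\<in>{2..m}. C p). \<Prod>p=2..m. qvar ^ c p)"
    by (rule prod_sum_PiE) (simp_all add: assms)
  finally show ?thesis by (simp add: exp_sum_def power_sum)
qed

lemma coeff_degree_sum:
  assumes "finite A"
  shows "coeff (\<Sum>a\<in>A. qvar ^ f a) k = int (card {a \<in> A. f a = k})"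
proof -
  have q: "qvar ^ i = monom 1 i" for i :: nat by (simp add: monom_altdef)
  have "coeff (\<Sum>a\<in>A. qvar ^ f a) k = (\<Sum>a\<in>A. if f a = k then 1 else 0)"
    by (simp add: coeff_sum q)
  also have "\<dots> = int (card {a \<in> A. f a = k})"
    using assms by (simp add: sum.If_cases Int_def)
  finally show ?thesis .
qed

lemma sum_all_exps:
  assumes "n \<ge> 2"
  shows "(\<Sum>c\<in>all_exps n. qvar ^ exp_sum n c) = q_number (n - 1) * (\<Prod>j=1..n - 2. q_number j)"
proof -
  have "(\<Sum>c\<in>all_exps n. qvar ^ exp_sum n c) = (\<Prod>p=2..n. q_number (p - 1))"
    unfolding all_exps_def by (rule degree_generating_function) simp
  also have "\<dots> = q_number (n - 1) * (\<Prod>j=1..n - 2. q_number j)"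
    using assms
  proof (induction n rule: dec_induct)
    case (step m)
    have "{2..Suc m} = insert (Suc m) {2..m}" "{1..Suc m - 2} = insert (m - 1) {1..m - 2}"
      using step.hyps by auto
    moreover have "m - 1 \<notin> {1..m - 2}" using step.hyps by auto
    ultimately show ?case using step.IH by simp
  qed simp
  finally show ?thesis .
qed

text \<open>The positions up to \<open>a\<close> contribute \<open>[1] \<cdots> [a-1]\<close> and
  the later ones \<open>[a-1] \<cdots> [n-2]\<close>. For \<open>a = 1\<close> there are no low
  exponents, since position \<open>2\<close> admits none.\<close>

lemma sum_low_exps:
  assumes "n \<ge> 2" "1 \<le> a" "a \<le> n"
  shows "(\<Sum>c\<in>low_exps a n. qvar ^ exp_sum n c) = q_number (a - 1) * (\<Prod>j=1..n - 2. q_number j)"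
proof -
  let ?r = "\<lambda>p. if a < p then p - 2 else p - 1"
  have "(\<Sum>c\<in>low_exps a n. qvar ^ exp_sum n c) = (\<Prod>p=2..n. q_number (?r p))"
    unfolding low_exps_def by (rule degree_generating_function) simp
  also have "\<dots> = q_number (a - 1) * (\<Prod>j=1..n - 2. q_number j)"
  proof (cases "a = 1")
    case True
    have "(\<Prod>p=2..n. q_number (?r p)) = 0"
      using assms True by (intro prod_zero bexI[of _ 2]) (auto simp: q_number_eq)
    then show ?thesis using True by (simp add: q_number_eq)
  next
    case False
    then have "2 \<le> a" using assms by simp
    have base: "(\<Prod>p=2..a. q_number (?r p)) = q_number (a - 1) * (\<Prod>j=1..a - 2. q_number j)"
    proof -
      have "(\<Prod>p=2..a. q_number (?r p)) = (\<Prod>p=2..a. q_number (p - 1))"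
        by (intro prod.cong) auto
      also have "\<dots> = (\<Sum>c\<in>all_exps a. qvar ^ exp_sum a c)"
        unfolding all_exps_def by (rule degree_generating_function[symmetric]) simp
      also have "\<dots> = q_number (a - 1) * (\<Prod>j=1..a - 2. q_number j)"
        using \<open>2 \<le> a\<close> by (rule sum_all_exps)
      finally show ?thesis .
    qed
    show ?thesis
      using assms(3)
    proof (induction n rule: dec_induct)
      case base
      show ?case by (rule \<open>(\<Prod>p=2..a. q_number (?r p)) = _\<close>)
    next
      case (step m)
      have "{2..Suc m} = insert (Suc m) {2..m}" "{1..Suc m - 2} = insert (m - 1) {1..m - 2}"
        using step.hyps \<open>2 \<le> a\<close> by auto
      moreover have "m - 1 \<notin> {1..m - 2}" using step.hyps \<open>2 \<le> a\<close> by auto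
      ultimately show ?case using step.IH step.hyps by simp
    qed
  qed
  finally show ?thesis .
qed

context first_row_hessenberg
begin

definition low_degree :: "nat \<Rightarrow> (nat \<times> (nat \<Rightarrow> nat)) set" where
  "low_degree k = {(d, c) \<in> {..<n} \<times> low_exps (h 1) n. d + exp_sum n c = k}"

definition high_degree :: "nat \<Rightarrow> (nat \<Rightarrow> nat) set" where
  "high_degree k = {c \<in> all_exps n - low_exps (h 1) n. exp_sum n c = k}"

lemma finite_degree_sets [simp]: "finite (low_degree k)" "finite (high_degree k)"
  by (auto simp: low_degree_def high_degree_def intro: finite_subset[of _ "{..<n} \<times> low_exps (h 1) n"])

lemma Bdeg_eq: "Bdeg k = low_degree k <+> ({1..n} \<times> high_degree k)"
  unfolding Bdeg_def basis_indices_def low_degree_def high_degree_def by auto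

lemma card_low_degree:
  assumes "n \<ge> 2"
  shows "int (card (low_degree k)) =
    coeff (q_number (h 1 - 1) * q_number n * (\<Prod>j=1..n - 2. q_number j)) k"
proof -
  have "q_number (h 1 - 1) * q_number n * (\<Prod>j=1..n - 2. q_number j) =
      q_number n * (\<Sum>c\<in>low_exps (h 1) n. qvar ^ exp_sum n c)"
    unfolding sum_low_exps[OF assms h1] by (simp only: mult_ac)
  also have "\<dots> = (\<Sum>x\<in>{..<n} \<times> low_exps (h 1) n. qvar ^ (fst x + exp_sum n (snd x)))"
    by (simp add: q_number_eq sum_product sum.cartesian_product case_prod_beta power_add)
  finally have "coeff (q_number (h 1 - 1) * q_number n * (\<Prod>j=1..n - 2. q_number j)) k =
      int (card {x \<in> {..<n} \<times> low_exps (h 1) n. fst x + exp_sum n (snd x) = k})"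
    by (simp only: coeff_degree_sum finite_cartesian_product finite_lessThan finite_low_exps)
  moreover have "{x \<in> {..<n} \<times> low_exps (h 1) n. fst x + exp_sum n (snd x) = k} = low_degree k"
    by (auto simp: low_degree_def)
  ultimately show ?thesis by simp
qed

text \<open>The high exponents are the complement of the low ones, and \<open>[n-1] - [a-1] =
  q\<^bsup>a-1\<^esup> [n-a]\<close> for \<open>a = h 1\<close>.\<close>

lemma card_high_degree:
  assumes "n \<ge> 2"
  shows "int (card (high_degree k)) =
    coeff (qvar ^ (h 1 - 1) * q_number (n - h 1) * (\<Prod>j=1..n - 2. q_number j)) k"
proof -
  let ?P = "\<Prod>j=1..n - 2. q_number j"
  have "q_number (n - 1) = q_number (h 1 - 1) + qvar ^ (h 1 - 1) * q_number (n - h 1)"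
    using q_number_add[of "h 1 - 1" "n - h 1"] h1 by simp
  then have "qvar ^ (h 1 - 1) * q_number (n - h 1) * ?P = q_number (n - 1) * ?P - q_number (h 1 - 1) * ?P"
    by (simp only: distrib_right add_diff_cancel_left')
  also have "\<dots> = (\<Sum>c\<in>all_exps n - low_exps (h 1) n. qvar ^ exp_sum n c)"
    unfolding sum_all_exps[OF assms, symmetric] sum_low_exps[OF assms h1, symmetric]
    by (rule sum_diff[symmetric]) (simp_all add: low_exps_subset)
  finally have "coeff (qvar ^ (h 1 - 1) * q_number (n - h 1) * ?P) k =
      int (card {c \<in> all_exps n - low_exps (h 1) n. exp_sum n c = k})"
    by (simp only: coeff_degree_sum finite_Diff finite_all_exps)
  then show ?thesis by (simp add: high_degree_def)
qed

text \<open>For \<open>n = 1\<close> the list \<open>[n - 1, 1]\<close> has a zero entry and is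
  not a partition; then no high exponents exist.\<close>

lemma high_degree_empty: "n = 1 \<Longrightarrow> high_degree k = {}"
  unfolding high_degree_def all_exps_def low_exps_def by simp

end

section \<open>The representation on cohomology\<close>

definition chern_sum :: "nat \<Rightarrow> cpoly \<Rightarrow> ((nat \<Rightarrow> nat \<Rightarrow> complex) \<times> unit) set cochain" where
  "chern_sum n f = (\<Sum>m\<in>Poly_Mapping.keys f. cscale (Poly_Mapping.lookup f m) (chern_monomial n m))"

lemma poly_to_BT_eq: "poly_to_BT n k f = coh_class (2 * k) (BT n) (chern_sum n f)"
  by (simp add: poly_to_BT_def chern_sum_def)

lemma chern_sum_superset:
  assumes "finite S" "Poly_Mapping.keys f \<subseteq> S"
  shows "chern_sum n f = (\<Sum>m\<in>S. cscale (Poly_Mapping.lookup f m) (chern_monomial n m))"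
  unfolding chern_sum_def using assms
  by (intro sum.mono_neutral_left) (auto simp: in_keys_iff cscale_def fun_eq_iff)

lemma cscale_add_left: "cscale (a + b) x = cscale a x + cscale b x"
  by (auto simp: cscale_def fun_eq_iff algebra_simps)

lemma chern_sum_add: "chern_sum n (f + g) = chern_sum n f + chern_sum n g"
proof -
  let ?S = "Poly_Mapping.keys f \<union> Poly_Mapping.keys g"
  have "chern_sum n (f + g) =
      (\<Sum>m\<in>?S. cscale (Poly_Mapping.lookup (f + g) m) (chern_monomial n m))"
    by (rule chern_sum_superset) (auto simp: Poly_Mapping.keys_add)
  also have "\<dots> = chern_sum n f + chern_sum n g"
    by (subst (1 2) chern_sum_superset[of ?S])
      (auto simp: lookup_add cscale_add_left sum.distrib)
  finally show ?thesis .
qed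

lemma chern_sum_scale: "chern_sum n (const c * f) = cscale c (chern_sum n f)"
proof (induction f rule: cpoly_induct)
  case zero
  show ?case by (auto simp: chern_sum_def cscale_def fun_eq_iff)
next
  case (single m d)
  have s: "chern_sum n (Poly_Mapping.single m e) = cscale e (chern_monomial n m)" for e
    by (subst chern_sum_superset[of "{m}"]) auto
  show ?case by (simp add: mult_single s cscale_simps)
next
  case (add f g)
  then show ?case by (simp only: distrib_left chern_sum_add cscale_simps)
qed

lemma homog_polys_scale: "f \<in> homog_polys n k \<Longrightarrow> const c * f \<in> homog_polys n k"
  using homog_mult[OF homog_const, of k f c] by (simp add: homog_polys_iff polys_mult)

lemma homog_polys_add: "f \<in> homog_polys n k \<Longrightarrow> g \<in> homog_polys n k \<Longrightarrow> f + g \<in> homog_polys n k"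
  by (simp add: homog_polys_iff polys_add homog_add)

locale hessenberg_cohomology = first_row_hessenberg n h for n h +
  fixes s :: "nat \<Rightarrow> complex"
  assumes hess: "hessenberg n h"
    and H_BT: "\<And>k. bij_betw (poly_to_BT n k) (homog_polys n k) (carrier (cohomology (2 * k) (BT n)))"
    and GKM_description: "\<And>k. bij_betw (restriction n k)
           (carrier (equiv_cohomology n s h (2 * k))) (GKM_degree n h k)"
    and forget_onto: "\<And>k. forget n s h (2 * k) ` carrier (equiv_cohomology n s h (2 * k)) =
           carrier (cohomology (2 * k) (hess_space n s h))"
    and forget_kernel: "\<And>k x. x \<in> carrier (equiv_cohomology n s h (2 * k)) \<Longrightarrow>
           forget n s h (2 * k) x = \<zero>\<^bsub>cohomology (2 * k) (hess_space n s h)\<^esub> \<longleftrightarrow>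
           restriction n k x \<in> GKM_t_ideal n h"
begin

abbreviation "HT k \<equiv> carrier (equiv_cohomology n s h (2 * k))"
abbreviation "hclass k \<equiv> coh_class (2 * k) (hess_borel n s h)"
abbreviation "xclass k \<equiv> coh_class (2 * k) (hess_space n s h)"
abbreviation "restr k \<equiv> restriction n k"
abbreviation "fgt k \<equiv> forget n s h (2 * k)"

lemma HT_cases:
  assumes "x \<in> HT k"
  obtains \<phi> where "\<phi> \<in> cocycles (2 * k) (hess_borel n s h)" "x = hclass k \<phi>"
  using assms unfolding equiv_cohomology_def cohomology_simps by blast

lemma HT_intro: "\<phi> \<in> cocycles (2 * k) (hess_borel n s h) \<Longrightarrow> hclass k \<phi> \<in> HT k"
  unfolding equiv_cohomology_def cohomology_simps by blast

text \<open>The continuity of the inclusion of a fixed point ensures that the pulled back class is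
  a class on \<open>BT\<close>, to which the inverse of \<open>poly_to_BT\<close> can be applied.\<close>

lemma restr_class:
  assumes \<phi>: "\<phi> \<in> cocycles (2 * k) (hess_borel n s h)" and w: "w \<in> Sn n"
  shows "restr k (hclass k \<phi>) w \<in> homog_polys n k"
    and "poly_to_BT n k (restr k (hclass k \<phi>) w) =
      coh_class (2 * k) (BT n) (cochain_pullback (2 * k) (BT n) (fixed_point_inclusion n w) \<phi>)"
proof -
  note cont = continuous_fixed_point_inclusion[OF w n_pos hess, of s]
  let ?\<psi> = "cochain_pullback (2 * k) (BT n) (fixed_point_inclusion n w) \<phi>"
  have "coh_pullback (2 * k) (BT n) (fixed_point_inclusion n w) (hclass k \<phi>) = coh_class (2 * k) (BT n) ?\<psi>"
    by (rule coh_pullback_class) (rule pullback_coboundary[OF cont])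
  then have eq: "restr k (hclass k \<phi>) w =
      inv_into (homog_polys n k) (poly_to_BT n k) (coh_class (2 * k) (BT n) ?\<psi>)"
    using w by (simp add: restriction_def)
  have "coh_class (2 * k) (BT n) ?\<psi> \<in> carrier (cohomology (2 * k) (BT n))"
    unfolding cohomology_simps by (rule imageI) (rule pullback_cocycle[OF cont \<phi>])
  then show "restr k (hclass k \<phi>) w \<in> homog_polys n k"
    "poly_to_BT n k (restr k (hclass k \<phi>) w) = coh_class (2 * k) (BT n) ?\<psi>"
    unfolding eq using bij_betw_apply[OF bij_betw_inv_into[OF H_BT]] bij_betw_inv_into_right[OF H_BT]
    by blast+
qed

lemma restr_extensional: "restrict (restr k x) (Sn n) = restr k x"
  by (simp add: restriction_def)

lemma restr_eqI:
  assumes "\<phi> \<in> cocycles (2 * k) (hess_borel n s h)"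
    and "\<And>w. w \<in> Sn n \<Longrightarrow> f w \<in> homog_polys n k"
    and "\<And>w. w \<in> Sn n \<Longrightarrow> poly_to_BT n k (f w) =
      coh_class (2 * k) (BT n) (cochain_pullback (2 * k) (BT n) (fixed_point_inclusion n w) \<phi>)"
  shows "restr k (hclass k \<phi>) = (\<lambda>w\<in>Sn n. f w)"
proof -
  have "restr k (hclass k \<phi>) w = f w" if w: "w \<in> Sn n" for w
    by (rule inj_onD[OF bij_betw_imp_inj_on[OF H_BT] _ restr_class(1)[OF assms(1) w] assms(2)[OF w]])
      (simp only: restr_class(2)[OF assms(1) w] assms(3)[OF w])
  then have "(\<lambda>w\<in>Sn n. restr k (hclass k \<phi>) w) = (\<lambda>w\<in>Sn n. f w)" by (rule restrict_ext)
  then show ?thesis by (simp only: restr_extensional)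
qed

lemma restr_add:
  assumes x: "\<phi> \<in> cocycles (2 * k) (hess_borel n s h)" and y: "\<psi> \<in> cocycles (2 * k) (hess_borel n s h)"
  shows "restr k (hclass k (\<phi> + \<psi>)) = (\<lambda>w\<in>Sn n. restr k (hclass k \<phi>) w + restr k (hclass k \<psi>) w)"
proof (rule restr_eqI)
  fix w assume w: "w \<in> Sn n"
  show "restr k (hclass k \<phi>) w + restr k (hclass k \<psi>) w \<in> homog_polys n k"
    by (intro homog_polys_add restr_class(1) x y w)
  show "poly_to_BT n k (restr k (hclass k \<phi>) w + restr k (hclass k \<psi>) w) =
      coh_class (2 * k) (BT n) (cochain_pullback (2 * k) (BT n) (fixed_point_inclusion n w) (\<phi> + \<psi>))"
    using restr_class(2)[OF x w] restr_class(2)[OF y w]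
    unfolding poly_to_BT_eq chern_sum_add pullback_add cohomology_add[symmetric] by (simp only:)
qed (rule cocycles_add[OF x y])

lemma restr_scale:
  assumes x: "\<phi> \<in> cocycles (2 * k) (hess_borel n s h)"
  shows "restr k (hclass k (cscale c \<phi>)) = (\<lambda>w\<in>Sn n. const c * restr k (hclass k \<phi>) w)"
proof (rule restr_eqI)
  fix w assume w: "w \<in> Sn n"
  show "const c * restr k (hclass k \<phi>) w \<in> homog_polys n k"
    by (intro homog_polys_scale restr_class(1) x w)
  show "poly_to_BT n k (const c * restr k (hclass k \<phi>) w) =
      coh_class (2 * k) (BT n) (cochain_pullback (2 * k) (BT n) (fixed_point_inclusion n w) (cscale c \<phi>))"
    using restr_class(2)[OF x w]
    unfolding poly_to_BT_eq chern_sum_scale pullback_cscale cohomology_smult[symmetric] by (simp only:)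
qed (rule cocycles_cscale[OF x])

lemma fgt_class:
  "fgt k (hclass k \<phi>) = xclass k (cochain_pullback (2 * k) (hess_space n s h) (fibre_inclusion n) \<phi>)"
proof -
  have "fgt k (hclass k 0) \<in> carrier (cohomology (2 * k) (hess_space n s h))"
    unfolding forget_onto[symmetric] by (intro imageI HT_intro cocycles_0)
  then show ?thesis
    unfolding forget_def by (intro coh_pullback_class pullback_coboundaries_if_class)
qed

lemma fgt_zero_iff:
  assumes "\<phi> \<in> cocycles (2 * k) (hess_borel n s h)"
  shows "cochain_pullback (2 * k) (hess_space n s h) (fibre_inclusion n) \<phi>
      \<in> coboundaries (2 * k) (hess_space n s h) \<longleftrightarrow> restr k (hclass k \<phi>) \<in> GKM_t_ideal n h"
  using forget_kernel[OF HT_intro[OF assms]]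
  unfolding fgt_class cohomology_simps coh_class_eq_iff by simp

text \<open>By linearity the statement about kernels extends to arbitrary fibres of the map.\<close>

lemma fgt_eq_iff:
  assumes x: "x \<in> HT k" and y: "y \<in> HT k"
  shows "fgt k x = fgt k y \<longleftrightarrow> (\<lambda>w\<in>Sn n. restr k x w - restr k y w) \<in> GKM_t_ideal n h"
proof -
  obtain \<phi> \<psi> where \<phi>: "\<phi> \<in> cocycles (2 * k) (hess_borel n s h)" "x = hclass k \<phi>"
    and \<psi>: "\<psi> \<in> cocycles (2 * k) (hess_borel n s h)" "y = hclass k \<psi>"
    using HT_cases[OF x] HT_cases[OF y] by metis
  let ?p = "cochain_pullback (2 * k) (hess_space n s h) (fibre_inclusion n)"
  note \<psi>' = cocycles_cscale[OF \<psi>(1), of "-1"]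
  have "fgt k x = fgt k y \<longleftrightarrow> ?p \<phi> - ?p \<psi> \<in> coboundaries (2 * k) (hess_space n s h)"
    unfolding \<phi>(2) \<psi>(2) fgt_class by (rule coh_class_eq_iff)
  also have "?p \<phi> - ?p \<psi> = ?p (\<phi> + cscale (-1) \<psi>)"
    unfolding pullback_add pullback_cscale by (simp only: cscale_simps diff_conv_add_uminus)
  also have "\<dots> \<in> coboundaries (2 * k) (hess_space n s h) \<longleftrightarrow>
      restr k (hclass k (\<phi> + cscale (-1) \<psi>)) \<in> GKM_t_ideal n h"
    by (rule fgt_zero_iff[OF cocycles_add[OF \<phi>(1) \<psi>']])
  also have "restr k (hclass k (\<phi> + cscale (-1) \<psi>)) = (\<lambda>w\<in>Sn n. restr k x w - restr k y w)"
    unfolding restr_add[OF \<phi>(1) \<psi>'] restr_scale[OF \<psi>(1)] \<phi>(2) \<psi>(2)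
    by (rule restrict_ext) (simp add: single_uminus)
  finally show ?thesis .
qed

definition lift :: "nat \<Rightarrow> ((nat \<Rightarrow> nat) \<Rightarrow> cpoly) \<Rightarrow> ((nat \<Rightarrow> nat \<Rightarrow> complex) \<times> flag) set cochain set" where
  "lift k \<alpha> = inv_into (HT k) (restr k) \<alpha>"

lemma lift: "\<alpha> \<in> GKM_degree n h k \<Longrightarrow> lift k \<alpha> \<in> HT k" "\<alpha> \<in> GKM_degree n h k \<Longrightarrow> restr k (lift k \<alpha>) = \<alpha>"
  unfolding lift_def
  using bij_betw_apply[OF bij_betw_inv_into[OF GKM_description]] bij_betw_inv_into_right[OF GKM_description]
  by blast+

lemma lift_unique: "x \<in> HT k \<Longrightarrow> restr k x = \<alpha> \<Longrightarrow> lift k \<alpha> = x"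
  unfolding lift_def using bij_betw_inv_into_left[OF GKM_description] by blast

lemma restr_in_GKM_degree: "x \<in> HT k \<Longrightarrow> restr k x \<in> GKM_degree n h k"
  by (rule bij_betw_apply[OF GKM_description])

text \<open>The composite of the inverse of the restriction to fixed points with the map to the
  ordinary cohomology. Along this linear surjection the structure of
  \<open>H\<^bsup>2k\<^esup>(X(h))\<close> is computed from \<open>GKM n h\<close>.\<close>

definition psi :: "nat \<Rightarrow> ((nat \<Rightarrow> nat) \<Rightarrow> cpoly) \<Rightarrow> flag cochain set" where
  "psi k \<alpha> = fgt k (lift k \<alpha>)"

lemma psi_eq_iff:
  assumes "\<alpha> \<in> GKM_degree n h k" "\<beta> \<in> GKM_degree n h k"
  shows "psi k \<alpha> = psi k \<beta> \<longleftrightarrow> (\<lambda>w\<in>Sn n. \<alpha> w - \<beta> w) \<in> GKM_t_ideal n h"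
  using fgt_eq_iff[OF lift(1)[OF assms(1)] lift(1)[OF assms(2)]]
  by (simp only: psi_def lift(2)[OF assms(1)] lift(2)[OF assms(2)])

lemma psi_restr: "x \<in> HT k \<Longrightarrow> psi k (restr k x) = fgt k x"
  by (simp add: psi_def lift_unique)

lemma psi_add:
  assumes "\<alpha> \<in> GKM_degree n h k" "\<beta> \<in> GKM_degree n h k"
  shows "psi k (\<lambda>w\<in>Sn n. \<alpha> w + \<beta> w) = psi k \<alpha> \<oplus>\<^bsub>cohomology (2 * k) (hess_space n s h)\<^esub> psi k \<beta>"
proof -
  obtain \<phi> \<psi> where \<phi>: "\<phi> \<in> cocycles (2 * k) (hess_borel n s h)" "lift k \<alpha> = hclass k \<phi>"
    and \<psi>: "\<psi> \<in> cocycles (2 * k) (hess_borel n s h)" "lift k \<beta> = hclass k \<psi>"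
    using HT_cases[OF lift(1)[OF assms(1)]] HT_cases[OF lift(1)[OF assms(2)]] by metis
  have "restr k (hclass k (\<phi> + \<psi>)) = (\<lambda>w\<in>Sn n. \<alpha> w + \<beta> w)"
    unfolding restr_add[OF \<phi>(1) \<psi>(1)] \<phi>(2)[symmetric] \<psi>(2)[symmetric]
    by (simp only: lift(2)[OF assms(1)] lift(2)[OF assms(2)])
  from lift_unique[OF HT_intro[OF cocycles_add[OF \<phi>(1) \<psi>(1)]] this]
  show ?thesis
    unfolding psi_def \<phi>(2) \<psi>(2) by (simp only: fgt_class pullback_add cohomology_add)
qed

lemma psi_scale:
  assumes "\<alpha> \<in> GKM_degree n h k"
  shows "psi k (\<lambda>w\<in>Sn n. const c * \<alpha> w) = c \<odot>\<^bsub>cohomology (2 * k) (hess_space n s h)\<^esub> psi k \<alpha>"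
proof -
  obtain \<phi> where \<phi>: "\<phi> \<in> cocycles (2 * k) (hess_borel n s h)" "lift k \<alpha> = hclass k \<phi>"
    using HT_cases[OF lift(1)[OF assms]] by metis
  have "restr k (hclass k (cscale c \<phi>)) = (\<lambda>w\<in>Sn n. const c * \<alpha> w)"
    unfolding restr_scale[OF \<phi>(1)] \<phi>(2)[symmetric] by (simp only: lift(2)[OF assms])
  from lift_unique[OF HT_intro[OF cocycles_cscale[OF \<phi>(1)]] this]
  show ?thesis
    unfolding psi_def \<phi>(2) by (simp only: fgt_class pullback_cscale cohomology_smult)
qed

text \<open>The action on ordinary cohomology uses a chosen lift. Two lifts differ by a member of
  the ideal, and the dot action preserves the ideal, so any lift gives the same result.\<close>

lemma tymoczko_psi:
  assumes v: "v \<in> Sn n" and \<alpha>: "\<alpha> \<in> GKM_degree n h k"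
  shows "tymoczko n s h k v (psi k \<alpha>) = psi k (dot_action n v \<alpha>)"
proof -
  let ?x = "inv_into (HT k) (fgt k) (psi k \<alpha>)"
  have mem: "psi k \<alpha> \<in> fgt k ` HT k" unfolding psi_def by (rule imageI) (rule lift(1)[OF \<alpha>])
  have x: "?x \<in> HT k" "fgt k ?x = psi k \<alpha>"
    using inv_into_into[OF mem] f_inv_into_f[OF mem] by auto
  note xG = restr_in_GKM_degree[OF x(1)]
  have "psi k (restr k ?x) = psi k \<alpha>" by (simp only: psi_restr[OF x(1)] x(2))
  then have diff: "(\<lambda>w\<in>Sn n. restr k ?x w - \<alpha> w) \<in> GKM_t_ideal n h"
    by (simp only: psi_eq_iff[OF xG \<alpha>])
  have "(\<lambda>w\<in>Sn n. dot_action n v (restr k ?x) w - dot_action n v \<alpha> w) =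
      dot_action n v (\<lambda>w\<in>Sn n. restr k ?x w - \<alpha> w)"
    unfolding dot_action_def
    by (rule restrict_ext) (simp add: perm_poly_eq_subst subst_diff Sn_comp Sn_inv v)
  also have "\<dots> \<in> GKM_t_ideal n h" by (rule dot_action_ideal[OF v diff])
  finally have "psi k (dot_action n v (restr k ?x)) = psi k (dot_action n v \<alpha>)"
    by (simp only: psi_eq_iff[OF dot_action_GKM_degree[OF v xG] dot_action_GKM_degree[OF v \<alpha>]])
  then show ?thesis
    by (simp only: tymoczko_def tymoczko_equiv_def psi_def lift_def)
qed

lemma lincomb_cong: "(\<And>b. b \<in> Bdeg k \<Longrightarrow> \<kappa> b = \<kappa>' b) \<Longrightarrow> lincomb k \<kappa> = lincomb k \<kappa>'"
  unfolding lincomb_def by (intro restrict_ext sum.cong) auto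

text \<open>The images of the basis elements of degree \<open>k\<close> form a basis of
  \<open>H\<^bsup>2k\<^esup>(X(h))\<close>, which the group permutes.\<close>

lemma hess_rep_iso_perm_rep: "rep_iso n (perm_rep (Bdeg k) basis_perm) (hess_rep n s h k)"
proof -
  let ?X = "Bdeg k" and ?H = "cohomology (2 * k) (hess_space n s h)"
  let ?\<Phi> = "\<lambda>\<kappa>. psi k (lincomb k \<kappa>)"
  note L = lincomb_in_GKM_degree
  have perm_X: "basis_perm g b \<in> ?X" if "g \<in> Sn n" "b \<in> ?X" for g b
    by (rule bij_betw_apply[OF basis_perm_bij[OF that(1)] that(2)])
  have eq_iff: "?\<Phi> \<kappa> = ?\<Phi> \<kappa>' \<longleftrightarrow> (\<forall>b\<in>?X. \<kappa> b = \<kappa>' b)" for \<kappa> \<kappa>'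
  proof
    assume "?\<Phi> \<kappa> = ?\<Phi> \<kappa>'"
    then have "(\<lambda>w\<in>Sn n. lincomb k \<kappa> w - lincomb k \<kappa>' w) \<in> GKM_t_ideal n h"
      by (simp only: psi_eq_iff[OF L L])
    also have "(\<lambda>w\<in>Sn n. lincomb k \<kappa> w - lincomb k \<kappa>' w) = lincomb k (\<lambda>b. \<kappa> b - \<kappa>' b)"
      unfolding lincomb_def
      by (rule restrict_ext) (simp add: single_diff left_diff_distrib sum_subtractf)
    finally have "\<kappa> b - \<kappa>' b = 0" if "b \<in> ?X" for b using independent_mod_ideal that by blast
    then show "\<forall>b\<in>?X. \<kappa> b = \<kappa>' b" by simp
  next
    assume "\<forall>b\<in>?X. \<kappa> b = \<kappa>' b"
    then show "?\<Phi> \<kappa> = ?\<Phi> \<kappa>'" using lincomb_cong[of k \<kappa> \<kappa>'] by simp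
  qed
  have surj: "\<exists>\<kappa>. ?\<Phi> \<kappa> = y" if y: "y \<in> carrier ?H" for y
  proof -
    obtain x where x: "x \<in> HT k" "y = fgt k x" using y unfolding forget_onto[symmetric] by blast
    obtain \<kappa> where "(\<lambda>w\<in>Sn n. restr k x w - lincomb k \<kappa> w) \<in> GKM_t_ideal n h"
      using spanning_mod_ideal[OF restr_in_GKM_degree[OF x(1)]] by (rule exE)
    then have "psi k (restr k x) = ?\<Phi> \<kappa>"
      by (simp only: psi_eq_iff[OF restr_in_GKM_degree[OF x(1)] L])
    then show ?thesis by (intro exI[of _ \<kappa>]) (simp only: psi_restr[OF x(1)] x(2))
  qed
  have into: "?\<Phi> \<kappa> \<in> carrier ?H" for \<kappa>
    unfolding forget_onto[symmetric] psi_def by (rule imageI) (rule lift(1)[OF L])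
  have "rep_iso n (fst (perm_rep ?X basis_perm), snd (perm_rep ?X basis_perm)) (?H, tymoczko n s h k)"
  proof (rule rep_iso_transport[where f = ?\<Phi>])
    show "is_rep n (fst (perm_rep ?X basis_perm), snd (perm_rep ?X basis_perm))"
      unfolding prod.collapse
      by (rule is_rep_perm_rep) (simp_all only: perm_X basis_perm_id basis_perm_comp)
    show "bij_betw ?\<Phi> (carrier (fst (perm_rep ?X basis_perm))) (carrier ?H)"
      unfolding perm_rep_def fun_rep_simps bij_betw_def
    proof
      show "inj_on ?\<Phi> (?X \<rightarrow>\<^sub>E UNIV)"
      proof (rule inj_onI)
        fix \<kappa> \<kappa>' assume "\<kappa> \<in> ?X \<rightarrow>\<^sub>E UNIV" "\<kappa>' \<in> ?X \<rightarrow>\<^sub>E UNIV" "?\<Phi> \<kappa> = ?\<Phi> \<kappa>'"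
        then show "\<kappa> = \<kappa>'" unfolding eq_iff by (intro PiE_ext) auto
      qed
      show "?\<Phi> ` (?X \<rightarrow>\<^sub>E UNIV) = carrier ?H"
      proof (intro equalityI subsetI)
        fix y assume "y \<in> carrier ?H"
        then obtain \<kappa> where "?\<Phi> \<kappa> = y" using surj by blast
        then have "y = ?\<Phi> (restrict \<kappa> ?X)" using eq_iff[of \<kappa> "restrict \<kappa> ?X"] by simp
        then show "y \<in> ?\<Phi> ` (?X \<rightarrow>\<^sub>E UNIV)" by (intro rev_image_eqI[of "restrict \<kappa> ?X"]) simp_all
      qed (use into in auto)
    qed
  next
    fix \<kappa> \<kappa>' :: "basis_index \<Rightarrow> complex" and c
    have a: "lincomb k (\<lambda>x\<in>?X. \<kappa> x + \<kappa>' x) = (\<lambda>w\<in>Sn n. lincomb k \<kappa> w + lincomb k \<kappa>' w)"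
      unfolding lincomb_def
      by (rule restrict_ext) (simp add: single_add distrib_right sum.distrib)
    show "?\<Phi> (\<kappa> \<oplus>\<^bsub>fst (perm_rep ?X basis_perm)\<^esub> \<kappa>') = ?\<Phi> \<kappa> \<oplus>\<^bsub>?H\<^esub> ?\<Phi> \<kappa>'"
      unfolding perm_rep_def fun_rep_simps a by (rule psi_add[OF L L])
    have m: "const (c * d) = const c * const d" for d by (simp add: mult_single)
    have b: "lincomb k (\<lambda>x\<in>?X. c * \<kappa> x) = (\<lambda>w\<in>Sn n. const c * lincomb k \<kappa> w)"
      unfolding lincomb_def
      by (rule restrict_ext) (simp add: m sum_distrib_left mult.assoc)
    show "?\<Phi> (c \<odot>\<^bsub>fst (perm_rep ?X basis_perm)\<^esub> \<kappa>) = c \<odot>\<^bsub>?H\<^esub> ?\<Phi> \<kappa>"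
      unfolding perm_rep_def fun_rep_simps b by (rule psi_scale[OF L])
  next
    have z: "lincomb k (\<lambda>x\<in>?X. 0) = (\<lambda>w\<in>Sn n. 0)"
      unfolding lincomb_def by (rule restrict_ext) simp
    have "restr k (lift k (lincomb k (\<lambda>x\<in>?X. 0))) \<in> GKM_t_ideal n h"
      by (subst lift(2)[OF L], subst z, rule zero_in_ideal)
    then show "?\<Phi> \<zero>\<^bsub>fst (perm_rep ?X basis_perm)\<^esub> = \<zero>\<^bsub>?H\<^esub>"
      unfolding perm_rep_def fun_rep_simps psi_def by (simp only: forget_kernel[OF lift(1)[OF L]])
  next
    fix g \<kappa> assume g: "g \<in> Sn n"
    have "lincomb k (\<lambda>x\<in>?X. \<kappa> (basis_perm (Hilbert_Choice.inv g) x)) = dot_action n g (lincomb k \<kappa>)"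
      unfolding dot_action_lincomb[OF g] by (rule lincomb_cong) simp
    then show "?\<Phi> (snd (perm_rep ?X basis_perm) g \<kappa>) = tymoczko n s h k g (?\<Phi> \<kappa>)"
      unfolding perm_rep_def fun_rep_simps by (simp only: tymoczko_psi[OF g L])
  qed
  then show ?thesis by (simp only: prod.collapse hess_rep_def)
qed

lemma hess_rep_iso_direct_sum:
  "rep_iso n (hess_rep n s h k) (direct_sum (map (Ind_trivial n)
     (replicate (card (low_degree k)) [n] @ replicate (card (high_degree k)) [n - 1, 1])))"
  using rep_iso_trans[OF rep_iso_sym[OF hess_rep_iso_perm_rep[of k]]
      perm_rep_iso_direct_sum[OF n_pos, of "low_degree k" "high_degree k", folded Bdeg_eq]]
  by simp

end

theorem corollary4p6:
  fixes n :: nat and h :: "nat \<Rightarrow> nat" and s :: "nat \<Rightarrow> complex"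
  assumes "n \<ge> 1"
    and "inj_on s {1..n}"
    and "hessenberg n h"
    and "\<forall>j\<in>{2..n}. h j = n"
    and H_BT: "\<And>k. bij_betw (poly_to_BT n k) (homog_polys n k) (carrier (cohomology (2 * k) (BT n)))"
    and GKM_description: "\<And>k. bij_betw (restriction n k)
           (carrier (equiv_cohomology n s h (2 * k))) (GKM_degree n h k)"
    and forget_onto: "\<And>k. forget n s h (2 * k) ` carrier (equiv_cohomology n s h (2 * k)) =
           carrier (cohomology (2 * k) (hess_space n s h))"
    and forget_kernel: "\<And>k x. x \<in> carrier (equiv_cohomology n s h (2 * k)) \<Longrightarrow>
           forget n s h (2 * k) x = \<zero>\<^bsub>cohomology (2 * k) (hess_space n s h)\<^esub> \<longleftrightarrow>
           restriction n k x \<in> GKM_t_ideal n h"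
  shows "(n \<ge> 2 \<longrightarrow>
           hess_R n s h = rep_poly_add n
             (rep_times_poly n (rep_class n (Ind_trivial n [n]))
               (q_number (h 1 - 1) * q_number n * (\<Prod>j=1..n-2. q_number j)))
             (rep_times_poly n (rep_class n (Ind_trivial n [n - 1, 1]))
               (qvar ^ (h 1 - 1) * q_number (n - h 1) * (\<Prod>j=1..n-2. q_number j))))
         \<and> (\<forall>k. is_permutation_rep n (hess_rep n s h k))"
proof -
  have "1 \<le> h 1" "h 1 \<le> n" using assms(1,3) unfolding hessenberg_def by auto
  then interpret hessenberg_cohomology n h s
    using assms by unfold_locales
  have "hess_R n s h = rep_poly_add n
      (rep_times_poly n (rep_class n (Ind_trivial n [n]))
        (q_number (h 1 - 1) * q_number n * (\<Prod>j=1..n-2. q_number j)))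
      (rep_times_poly n (rep_class n (Ind_trivial n [n - 1, 1]))
        (qvar ^ (h 1 - 1) * q_number (n - h 1) * (\<Prod>j=1..n-2. q_number j)))" if "n \<ge> 2"
    unfolding hess_R_def rep_poly_add_def rep_times_poly_def
      card_low_degree[OF that, symmetric] card_high_degree[OF that, symmetric]
    by (rule ext) (rule rep_class_two_types[OF assms(1) hess_rep_iso_direct_sum])
  moreover have "is_permutation_rep n (hess_rep n s h k)" for k
  proof -
    let ?L = "replicate (card (low_degree k)) [n] @ replicate (card (high_degree k)) [n - 1, 1]"
    have "is_partition n \<mu>" if \<mu>: "\<mu> \<in> set ?L" for \<mu>
    proof -
      from \<mu> consider "\<mu> = [n]" | "\<mu> = [n - 1, 1]" "high_degree k \<noteq> {}" by auto
      then show ?thesis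
      proof cases
        case 2
        then have "n \<noteq> 1" using high_degree_empty[of k] by blast
        then have "2 \<le> n" using assms(1) by simp
        then show ?thesis using 2 by (auto simp: is_partition_def)
      qed (use assms(1) in \<open>simp add: is_partition_def\<close>)
    qed
    then show ?thesis
      unfolding is_permutation_rep_def using hess_rep_iso_direct_sum[of k] by blast
  qed
  ultimately show ?thesis by blast
qed

end
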